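(* Let $(m_l)_{l\ge3}$ be integers with $|m_l|\le l$ and $\lim_{l\to\infty}m_l/l=q\in[-1,1]$. Then $$\lim_{l\to\infty}C(e^0_3,e^{m_l}_l)=-\frac{525}{32\pi}q^4(1-q^2).$$
   Context: $C$ is the sectional curvature of $\mathrm{SDiff}(\mathbb S^2)$ (right-invariant $L^2$ metric for the area form $\sin\theta\,d\theta\wedge d\phi$), defined for complex directions by $C(u,v)=\langle R(u,v)u,v\rangle/(\|u\|^2\|v\|^2-|\langle u,v\rangle|^2)$ with $R$ extended complex-linearly and the Hermitian $L^2$ product; $R(u,v)w=-\nabla_u\nabla_vw+\nabla_v\nabla_uw+\nabla_{[u,v]}w$, $\nabla_uv=\frac12([u,v]-B(u,v)-B(v,u))$, $\langle B(u,v),w\rangle=\langle u,[v,w]\rangle$. $e^m_l=\mathrm{sgrad}(Y^m_l/\sqrt{l(l+1)})$, $\mathrm{sgrad}f=\frac1{\sin\theta}(\partial_\phi f\partial_\theta-\partial_\theta f\partial_\phi)$, where $Y^m_l=\big[\frac{(l-m)!}{(l+m)!}\frac{2l+1}{4\pi}\big]^{1/2}e^{im\phi}P^m_l(\cos\theta)$, $P^m_l(z)=(1-z^2)^{m/2}\frac1{2^ll!}\frac{d^{l+m}}{dz^{l+m}}(z^2-1)^l$. In particular $e^0_3=\frac18\sqrt{21/\pi}(5\cos^2\theta-1)\partial_\phi$. *)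

theory Defs
  imports "HOL-Analysis.Analysis"
begin

fun Ck :: "nat \<Rightarrow> ('a::euclidean_space \<Rightarrow> 'b::real_normed_vector) set" where
  "Ck 0 = {f. continuous_on UNIV f}"
| "Ck (Suc k) = {f. (\<forall>x. f differentiable (at x)) \<and>
                    (\<forall>v. (\<lambda>x. frechet_derivative f (at x) v) \<in> Ck k)}"

definition smoothC :: "('a::euclidean_space \<Rightarrow> 'b::real_normed_vector) \<Rightarrow> bool" where
  "smoothC f \<longleftrightarrow> (\<forall>k. f \<in> Ck k)"

text \<open>A (complexified) vector field in the chart is given by its components
  (a, b), meaning a d/dtheta + b d/dphi, as functions of (theta, phi).\<close>

type_synonym vfield = "real \<times> real \<Rightarrow> complex \<times> complex"

definition sph :: "real \<times> real \<Rightarrow> real \<times> real \<times> real" where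
  "sph p = (sin (fst p) * cos (snd p), sin (fst p) * sin (snd p), cos (fst p))"

definition d_theta :: "(real \<times> real \<Rightarrow> complex) \<Rightarrow> real \<times> real \<Rightarrow> complex" where
  "d_theta F p = vector_derivative (\<lambda>t. F (t, snd p)) (at (fst p))"

definition d_phi :: "(real \<times> real \<Rightarrow> complex) \<Rightarrow> real \<times> real \<Rightarrow> complex" where
  "d_phi F p = vector_derivative (\<lambda>t. F (fst p, t)) (at (snd p))"

definition sgrad :: "(real \<times> real \<Rightarrow> complex) \<Rightarrow> vfield" where
  "sgrad F p = (d_phi F p / complex_of_real (sin (fst p)),
               - d_theta F p / complex_of_real (sin (fst p)))"

text \<open>Smooth (complexified) divergence-free vector fields on S^2:
  symplectic gradients of smooth functions on the sphere.\<close>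
definition SVect :: "vfield set" where
  "SVect = {sgrad (\<lambda>p. f (sph p)) | f :: real \<times> real \<times> real \<Rightarrow> complex. smoothC f}"

definition vadd :: "vfield \<Rightarrow> vfield \<Rightarrow> vfield" where
  "vadd X Y p = (fst (X p) + fst (Y p), snd (X p) + snd (Y p))"

definition vscale :: "complex \<Rightarrow> vfield \<Rightarrow> vfield" where
  "vscale c X p = (c * fst (X p), c * snd (X p))"

definition vsub :: "vfield \<Rightarrow> vfield \<Rightarrow> vfield" where
  "vsub X Y = vadd X (vscale (-1) Y)"

definition dir_der :: "vfield \<Rightarrow> (real \<times> real \<Rightarrow> complex) \<Rightarrow> real \<times> real \<Rightarrow> complex" where
  "dir_der X g p = fst (X p) * d_theta g p + snd (X p) * d_phi g p"

definition lie :: "vfield \<Rightarrow> vfield \<Rightarrow> vfield" where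
  "lie X Y p = (dir_der X (\<lambda>q. fst (Y q)) p - dir_der Y (\<lambda>q. fst (X q)) p,
               dir_der X (\<lambda>q. snd (Y q)) p - dir_der Y (\<lambda>q. snd (X q)) p)"

text \<open>The chart domain (0,pi) x (0,2pi); area form sin theta dtheta dphi;
  round metric |d/dtheta|^2 = 1, |d/dphi|^2 = sin^2 theta.\<close>
definition chart :: "(real \<times> real) set" where
  "chart = {0<..<pi} \<times> {0<..<2*pi}"

definition herm :: "vfield \<Rightarrow> vfield \<Rightarrow> complex" where
  "herm X Y = (LINT p : chart | lborel.
      (fst (X p) * cnj (fst (Y p)) + complex_of_real ((sin (fst p))\<^sup>2) * snd (X p) * cnj (snd (Y p)))
      * complex_of_real (sin (fst p)))"

definition bil :: "vfield \<Rightarrow> vfield \<Rightarrow> complex" where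
  "bil X Y = (LINT p : chart | lborel.
      (fst (X p) * fst (Y p) + complex_of_real ((sin (fst p))\<^sup>2) * snd (X p) * snd (Y p))
      * complex_of_real (sin (fst p)))"

definition Bop :: "vfield \<Rightarrow> vfield \<Rightarrow> vfield" where
  "Bop u v = (THE z. z \<in> SVect \<and> (\<forall>w\<in>SVect. bil z w = bil u (lie v w)))"

definition nabla :: "vfield \<Rightarrow> vfield \<Rightarrow> vfield" where
  "nabla u v = vscale (1/2) (vsub (vsub (lie u v) (Bop u v)) (Bop v u))"

definition Rcurv :: "vfield \<Rightarrow> vfield \<Rightarrow> vfield \<Rightarrow> vfield" where
  "Rcurv u v w = vadd (vadd (vscale (-1) (nabla u (nabla v w))) (nabla v (nabla u w)))
                      (nabla (lie u v) w)"

definition sec_curv :: "vfield \<Rightarrow> vfield \<Rightarrow> complex" where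
  "sec_curv u v = herm (Rcurv u v u) v /
     (herm u u * herm v v - complex_of_real ((cmod (herm u v))\<^sup>2))"

definition assoc_leg :: "nat \<Rightarrow> int \<Rightarrow> real \<Rightarrow> real" where
  "assoc_leg l m z = (1 - z\<^sup>2) powr (real_of_int m / 2) * (1 / (2 ^ l * fact l)) *
      (deriv ^^ nat (int l + m)) (\<lambda>x. (x\<^sup>2 - 1) ^ l) z"

definition Ysh :: "nat \<Rightarrow> int \<Rightarrow> real \<times> real \<Rightarrow> complex" where
  "Ysh l m p = complex_of_real (sqrt (fact (nat (int l - m)) / fact (nat (int l + m))
                 * (2 * real l + 1) / (4 * pi)))
             * exp (\<i> * of_int m * of_real (snd p))
             * complex_of_real (assoc_leg l m (cos (fst p)))"

definition ebasis :: "nat \<Rightarrow> int \<Rightarrow> vfield" where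
  "ebasis l m = sgrad (\<lambda>p. Ysh l m p / complex_of_real (sqrt (real l * (real l + 1))))"

end

theory Submission
  imports Defs "HOL-Computational_Algebra.Polynomial" "HOL-Real_Asymp.Real_Asymp"
begin

text \<open>Only the values of the fields on the chart matter, and there the zonal field
  \<open>u = e\<^sup>0\<^sub>3\<close> is \<open>U(\<theta>) \<partial>\<phi>\<close> with \<open>U = \<kappa> (5 cos\<^sup>2 \<theta> - 1)\<close>, \<open>\<kappa>\<^sup>2 = 21/(64 \<pi>)\<close>.
  On stream functions of angular frequency \<open>m\<close> the bracket with \<open>u\<close> is multiplication by
  \<open>T = i m U\<close>, and integration by parts gives \<open>B(u, w) = - 12 \<Delta>\<^sup>-\<^sup>1 T w\<close> and
  \<open>B(w, u) = - \<Delta>\<^sup>-\<^sup>1 T \<Delta> w\<close>. By the three-term recurrence of the Legendre functions, \<open>T\<close> couples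
  the degree \<open>n\<close> only to \<open>n - 2\<close>, \<open>n\<close>, \<open>n + 2\<close>, while \<open>\<Delta>\<close> acts as \<open>- n (n + 1)\<close>. Hence
  the curvature is the diagonal coefficient of a product of two banded operators, an explicit
  rational function of \<open>l\<close> and \<open>m\<close>. The contributions of \<open>l \<plusminus> 2\<close> are of order \<open>l\<close> and cancel to
  leading order; the limit comes from the variation of the recurrence coefficients
  with \<open>l\<close>.\<close>

section \<open>Smooth functions in spherical coordinates\<close>

text \<open>\<open>Bop\<close> is a definite description over \<open>SVect\<close>, whose members
  are functions on the whole coordinate plane, while \<open>bil\<close> sees only the open chart.
  Each value of \<open>Bop\<close> therefore needs a representative, and uniqueness needs that a
  stream function with zero energy on the chart is constant everywhere. The representative calls for
  an inverse Laplacian; it is applied only to finite combinations of harmonics, by dividing by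
  \<open>eigval\<close>. Two covariant derivatives starting at degree \<open>l\<close> reach the
  divisor \<open>eigval (l - 4)\<close>, whence the bound \<open>l \<ge> 5\<close>. The factor 12 is
  \<open>eigval 3\<close>, the eigenvalue of the stream function of the zonal field. That field is a
  steady Euler flow, so \<open>nabla ufield ufield\<close> vanishes and one of the three terms of
  \<open>Rcurv\<close> drops out. The curvature does not change when its second argument is
  multiplied by a nonzero constant. The harmonics can thus stay unnormalised, and negative orders
  reduce to positive ones up to a nonzero factor whose value is never computed.\<close>

lemma Ck_Suc_imp_Ck: "f \<in> Ck (Suc k) \<Longrightarrow> f \<in> Ck k"
proof (induction k arbitrary: f)
  case 0
  then show ?case
    by (auto intro!: continuous_at_imp_continuous_on differentiable_imp_continuous_within)
qed auto

lemma Ck_Suc_has_derivative: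
  "f \<in> Ck (Suc k) \<Longrightarrow> (f has_derivative frechet_derivative f (at x)) (at x)"
  by (simp flip: frechet_derivative_works)

lemma Ck_const: "(\<lambda>x. c) \<in> Ck k"
  by (induction k arbitrary: c) auto

lemma Ck_bounded_linear_compose:
  assumes "bounded_linear L" "f \<in> Ck k"
  shows "(\<lambda>x. L (f x)) \<in> Ck k"
  using assms(2)
proof (induction k arbitrary: f)
  case 0
  then show ?case
    using bounded_linear.continuous_on[OF assms(1)] by auto
next
  case (Suc k)
  have d: "((\<lambda>x. L (f x)) has_derivative (\<lambda>v. L (frechet_derivative f (at x) v))) (at x)" for x
    by (intro bounded_linear.has_derivative[OF assms(1)] Ck_Suc_has_derivative[OF Suc.prems])
  have "frechet_derivative (\<lambda>x. L (f x)) (at x) = (\<lambda>v. L (frechet_derivative f (at x) v))" for x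
    by (rule frechet_derivative_at[OF d, symmetric])
  then show ?case
    using Suc differentiableI[OF d] by auto
qed

lemma Ck_add:
  assumes "f \<in> Ck k" "g \<in> Ck k"
  shows "(\<lambda>x. f x + g x) \<in> Ck k"
  using assms
proof (induction k arbitrary: f g)
  case 0
  then show ?case by (auto intro: continuous_intros)
next
  case (Suc k)
  have d: "((\<lambda>x. f x + g x) has_derivative
       (\<lambda>v. frechet_derivative f (at x) v + frechet_derivative g (at x) v)) (at x)" for x
    by (intro has_derivative_add Ck_Suc_has_derivative[OF Suc.prems(1)] Ck_Suc_has_derivative[OF Suc.prems(2)])
  have "frechet_derivative (\<lambda>x. f x + g x) (at x) =
       (\<lambda>v. frechet_derivative f (at x) v + frechet_derivative g (at x) v)" for x
    by (rule frechet_derivative_at[OF d, symmetric])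
  then show ?case
    using Suc differentiableI[OF d] by auto
qed

lemma Ck_mult:
  fixes f g :: "'a::euclidean_space \<Rightarrow> 'b::real_normed_algebra"
  assumes "f \<in> Ck k" "g \<in> Ck k"
  shows "(\<lambda>x. f x * g x) \<in> Ck k"
  using assms
proof (induction k arbitrary: f g)
  case 0
  then show ?case by (auto intro: continuous_intros)
next
  case (Suc k)
  have d: "((\<lambda>x. f x * g x) has_derivative
       (\<lambda>v. f x * frechet_derivative g (at x) v + frechet_derivative f (at x) v * g x)) (at x)" for x
    by (intro has_derivative_mult Ck_Suc_has_derivative[OF Suc.prems(1)] Ck_Suc_has_derivative[OF Suc.prems(2)])
  have "frechet_derivative (\<lambda>x. f x * g x) (at x) =
       (\<lambda>v. f x * frechet_derivative g (at x) v + frechet_derivative f (at x) v * g x)" for x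
    by (rule frechet_derivative_at[OF d, symmetric])
  moreover have "f \<in> Ck k" "g \<in> Ck k"
    using Suc.prems Ck_Suc_imp_Ck by blast+
  ultimately show ?case
    using Suc differentiableI[OF d] by (auto intro!: Ck_add)
qed

lemma Ck_bounded_linear: "bounded_linear L \<Longrightarrow> L \<in> Ck k"
proof (cases k)
  case 0
  then show "bounded_linear L \<Longrightarrow> L \<in> Ck k"
    by (simp add: linear_continuous_on)
next
  case (Suc j)
  assume L: "bounded_linear L"
  then have d: "(L has_derivative L) (at x)" for x
    by (rule bounded_linear.has_derivative) (rule has_derivative_ident)
  have "frechet_derivative L (at x) = L" "L differentiable (at x)" for x
    using frechet_derivative_at[OF d, symmetric] d by (simp, auto simp: differentiable_def)
  then show ?thesis
    using Suc by (simp add: Ck_const)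
qed

lemma smoothC_const: "smoothC (\<lambda>x. c)"
  and smoothC_add: "smoothC f \<Longrightarrow> smoothC g \<Longrightarrow> smoothC (\<lambda>x. f x + g x)"
  and smoothC_bounded_linear: "bounded_linear L \<Longrightarrow> smoothC L"
  and smoothC_bounded_linear_compose: "bounded_linear L \<Longrightarrow> smoothC h \<Longrightarrow> smoothC (\<lambda>x. L (h x))"
  by (auto simp: smoothC_def Ck_const Ck_add Ck_bounded_linear Ck_bounded_linear_compose)

lemma smoothC_mult:
  fixes f g :: "'a::euclidean_space \<Rightarrow> 'b::real_normed_algebra"
  shows "smoothC f \<Longrightarrow> smoothC g \<Longrightarrow> smoothC (\<lambda>x. f x * g x)"
  by (auto simp: smoothC_def Ck_mult)

lemma smoothC_frechet_derivative: "smoothC f \<Longrightarrow> smoothC (\<lambda>x. frechet_derivative f (at x) v)"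
proof -
  assume "smoothC f"
  then have "f \<in> Ck (Suc k)" for k unfolding smoothC_def by blast
  then show ?thesis unfolding smoothC_def by simp
qed

lemma smoothC_has_derivative: "smoothC f \<Longrightarrow> (f has_derivative frechet_derivative f (at x)) (at x)"
  unfolding smoothC_def by (rule Ck_Suc_has_derivative) blast

lemma smoothC_continuous_on: "smoothC f \<Longrightarrow> continuous_on A f"
  unfolding smoothC_def by (metis Ck.simps(1) continuous_on_subset mem_Collect_eq subset_UNIV)

text \<open>Differentiating \<open>f (sph p)\<close> produces factors such as the cosine of the
  longitude, which are not smooth functions on the sphere, so pullbacks alone are not closed under
  \<open>d_theta\<close> and \<open>d_phi\<close>. This algebra is. Its members are continuous on
  the closed rectangle and periodic in the longitude, as integration by parts requires. The cosine
  of the colatitude is the height coordinate and comes from \<open>comp_sph\<close>.\<close>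

inductive_set chart_alg :: "(real \<times> real \<Rightarrow> complex) set" where
  comp_sph: "smoothC f \<Longrightarrow> (\<lambda>p. f (sph p)) \<in> chart_alg"
| sin_fst: "(\<lambda>p. complex_of_real (sin (fst p))) \<in> chart_alg"
| sin_snd: "(\<lambda>p. complex_of_real (sin (snd p))) \<in> chart_alg"
| cos_snd: "(\<lambda>p. complex_of_real (cos (snd p))) \<in> chart_alg"
| add: "F \<in> chart_alg \<Longrightarrow> H \<in> chart_alg \<Longrightarrow> (\<lambda>p. F p + H p) \<in> chart_alg"
| mult: "F \<in> chart_alg \<Longrightarrow> H \<in> chart_alg \<Longrightarrow> (\<lambda>p. F p * H p) \<in> chart_alg"

lemma chart_alg_const: "(\<lambda>p. c) \<in> chart_alg"
  using chart_alg.comp_sph[OF smoothC_const] .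

lemma smoothC_height: "smoothC (\<lambda>x::real \<times> real \<times> real. complex_of_real (snd (snd x)))"
  by (intro smoothC_bounded_linear bounded_linear_compose[OF bounded_linear_of_real]
      bounded_linear_compose[OF bounded_linear_snd] bounded_linear_snd)

lemma chart_alg_cos_fst: "(\<lambda>p. complex_of_real (cos (fst p))) \<in> chart_alg"
  using chart_alg.comp_sph[OF smoothC_height] by (simp add: sph_def)

lemma chart_alg_uminus: "F \<in> chart_alg \<Longrightarrow> (\<lambda>p. - F p) \<in> chart_alg"
  using chart_alg.mult[OF chart_alg_const[of "-1"]] by simp

lemma chart_alg_diff: "F \<in> chart_alg \<Longrightarrow> H \<in> chart_alg \<Longrightarrow> (\<lambda>p. F p - H p) \<in> chart_alg"
  using chart_alg.add[OF _ chart_alg_uminus] by simp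

lemma chart_alg_power: "F \<in> chart_alg \<Longrightarrow> (\<lambda>p. F p ^ n) \<in> chart_alg"
  by (induction n) (auto intro: chart_alg_const chart_alg.mult)

lemma continuous_on_sph: "continuous_on A sph"
  unfolding sph_def by (intro continuous_intros)

lemma chart_alg_continuous_on: "F \<in> chart_alg \<Longrightarrow> continuous_on A F"
proof (induction rule: chart_alg.induct)
  case (comp_sph f)
  show "continuous_on A (\<lambda>p. f (sph p))"
    using continuous_on_compose[OF continuous_on_sph smoothC_continuous_on[OF comp_sph], of A] by (simp add: o_def)
qed (intro continuous_intros; assumption)+

lemma chart_alg_periodic: "F \<in> chart_alg \<Longrightarrow> F (a, b + 2 * pi) = F (a, b)"
  by (induction rule: chart_alg.induct) (simp_all add: sph_def)

lemma has_vector_derivative_smooth_compose: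
  fixes f :: "real \<times> real \<times> real \<Rightarrow> complex"
  assumes f: "smoothC f"
    and "(X has_vector_derivative X') (at t)" "(Y has_vector_derivative Y') (at t)"
      "(Z has_vector_derivative Z') (at t)"
  defines "D \<equiv> \<lambda>v. frechet_derivative f (at (X t, Y t, Z t)) v"
  shows "((\<lambda>t. f (X t, Y t, Z t)) has_vector_derivative
     of_real X' * D (1,0,0) + of_real Y' * D (0,1,0) + of_real Z' * D (0,0,1)) (at t)"
proof -
  have "((\<lambda>t. (X t, Y t, Z t)) has_derivative (\<lambda>h. (h *\<^sub>R X', h *\<^sub>R Y', h *\<^sub>R Z'))) (at t)"
    using assms(2-4) unfolding has_vector_derivative_def by (intro has_derivative_Pair)
  from has_derivative_compose[OF this smoothC_has_derivative[OF f]]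
  have d: "((\<lambda>t. f (X t, Y t, Z t)) has_derivative (\<lambda>h. D (h *\<^sub>R X', h *\<^sub>R Y', h *\<^sub>R Z'))) (at t)"
    by (simp add: D_def)
  have lin: "linear D"
    unfolding D_def using has_derivative_linear[OF smoothC_has_derivative[OF f]] by simp
  have "D (h *\<^sub>R X', h *\<^sub>R Y', h *\<^sub>R Z') =
     h *\<^sub>R (of_real X' * D (1,0,0) + of_real Y' * D (0,1,0) + of_real Z' * D (0,0,1))" for h
  proof -
    have "(h *\<^sub>R X', h *\<^sub>R Y', h *\<^sub>R Z') =
       h *\<^sub>R (X' *\<^sub>R (1,0,0) + Y' *\<^sub>R (0,1,0) + Z' *\<^sub>R (0,0,1))" by simp
    then show ?thesis
      by (simp only: linear_scale[OF lin] linear_add[OF lin]) (simp add: scaleR_conv_of_real)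
  qed
  then show ?thesis using d by (simp add: has_vector_derivative_def)
qed

lemma sph_d_theta:
  fixes f :: "real \<times> real \<times> real \<Rightarrow> complex"
  assumes f: "smoothC f"
  defines "D \<equiv> \<lambda>v p. frechet_derivative f (at (sph p)) v"
  shows "((\<lambda>t. f (sph (t, b))) has_vector_derivative
      of_real (cos a) * of_real (cos b) * D (1,0,0) (a, b)
    + of_real (cos a) * of_real (sin b) * D (0,1,0) (a, b)
    + - of_real (sin a) * D (0,0,1) (a, b)) (at a)"
proof -
  have "((\<lambda>t. f (sin t * cos b, sin t * sin b, cos t)) has_vector_derivative
      of_real (cos a * cos b) * D (1,0,0) (a, b)
    + of_real (cos a * sin b) * D (0,1,0) (a, b)
    + of_real (- sin a) * D (0,0,1) (a, b)) (at a)"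
    unfolding D_def sph_def fst_conv snd_conv
    by (rule has_vector_derivative_smooth_compose[OF f, where X="\<lambda>t. sin t * cos b" and Y="\<lambda>t. sin t * sin b" and Z="cos"])
      (auto intro!: derivative_eq_intros simp flip: has_real_derivative_iff_has_vector_derivative)
  then show ?thesis by (simp add: sph_def)
qed

text \<open>The sine of the colatitude is factored out because both moving coordinates carry it; the
  regularity at the poles in \<open>sphere_fun_d_phi\<close> rests on this form.\<close>

lemma sph_d_phi:
  fixes f :: "real \<times> real \<times> real \<Rightarrow> complex"
  assumes f: "smoothC f"
  defines "D \<equiv> \<lambda>v p. frechet_derivative f (at (sph p)) v"
  shows "((\<lambda>t. f (sph (a, t))) has_vector_derivative
      of_real (sin a) * (of_real (cos b) * D (0,1,0) (a, b) + - of_real (sin b) * D (1,0,0) (a, b))) (at b)"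
proof -
  have "((\<lambda>t. f (sin a * cos t, sin a * sin t, cos a)) has_vector_derivative
      of_real (- (sin a * sin b)) * D (1,0,0) (a, b)
    + of_real (sin a * cos b) * D (0,1,0) (a, b)
    + of_real 0 * D (0,0,1) (a, b)) (at b)"
    unfolding D_def sph_def fst_conv snd_conv
    by (rule has_vector_derivative_smooth_compose[OF f, where X="\<lambda>t. sin a * cos t" and Y="\<lambda>t. sin a * sin t" and Z="\<lambda>t. cos a"])
      (auto intro!: derivative_eq_intros simp flip: has_real_derivative_iff_has_vector_derivative)
  then show ?thesis by (simp add: sph_def algebra_simps)
qed

text \<open>\<open>d_theta\<close> and \<open>d_phi\<close> are defined by
  \<open>vector_derivative\<close>, which says nothing before differentiability is known. Hence the
  existential form: differentiability and closure of the algebra come out of one induction.\<close>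

lemma chart_alg_partial: 
  assumes "F \<in> chart_alg"
  shows "\<exists>F'\<in>chart_alg. \<forall>a b. ((\<lambda>t. F (t, b)) has_vector_derivative F' (a, b)) (at a)" (is ?t)
    and "\<exists>F'\<in>chart_alg. \<forall>a b. ((\<lambda>t. F (a, t)) has_vector_derivative F' (a, b)) (at b)" (is ?p)
proof -
  note rules = chart_alg_const chart_alg.intros chart_alg_cos_fst chart_alg_uminus
  have "?t \<and> ?p" using assms
  proof (induction rule: chart_alg.induct)
    case (comp_sph f)
    define D where "D \<equiv> \<lambda>v p. frechet_derivative f (at (sph p)) v"
    have D: "D v \<in> chart_alg" for v
      unfolding D_def using comp_sph by (intro chart_alg.comp_sph smoothC_frechet_derivative)
    show ?case
    proof (intro conjI bexI allI)
      show "((\<lambda>t. f (sph (t, b))) has_vector_derivative (\<lambda>p. of_real (cos (fst p)) * of_real (cos (snd p)) * D (1,0,0) p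
         + of_real (cos (fst p)) * of_real (sin (snd p)) * D (0,1,0) p + - of_real (sin (fst p)) * D (0,0,1) p) (a, b)) (at a)" for a b
        using sph_d_theta[OF comp_sph] by (simp add: D_def)
      show "((\<lambda>t. f (sph (a, t))) has_vector_derivative (\<lambda>p. of_real (sin (fst p)) * (of_real (cos (snd p)) * D (0,1,0) p
         + - of_real (sin (snd p)) * D (1,0,0) p)) (a, b)) (at b)" for a b
        using sph_d_phi[OF comp_sph] by (simp add: D_def)
    qed (intro rules D)+
  next
    case sin_fst
    show ?case
    proof (intro conjI bexI allI)
      show "((\<lambda>t. of_real (sin (fst (t, b)))) has_vector_derivative (\<lambda>p. complex_of_real (cos (fst p))) (a, b)) (at a)" for a b :: real
        by (auto intro!: has_vector_derivative_of_real derivative_eq_intros)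
      show "((\<lambda>t. complex_of_real (sin (fst (a, t)))) has_vector_derivative (\<lambda>p. 0) (a, b)) (at b)" for a b :: real
        by simp
    qed (intro rules)+
  next
    case sin_snd
    show ?case
    proof (intro conjI bexI allI)
      show "((\<lambda>t. of_real (sin (snd (a, t)))) has_vector_derivative (\<lambda>p. complex_of_real (cos (snd p))) (a, b)) (at b)" for a b :: real
        by (auto intro!: has_vector_derivative_of_real derivative_eq_intros)
      show "((\<lambda>t. complex_of_real (sin (snd (t, b)))) has_vector_derivative (\<lambda>p. 0) (a, b)) (at a)" for a b :: real
        by simp
    qed (intro rules)+
  next
    case cos_snd
    show ?case
    proof (intro conjI bexI allI)
      have "((\<lambda>t. of_real (cos t)) has_vector_derivative complex_of_real (- sin b)) (at b)" for b :: real
        by (rule has_vector_derivative_of_real) (auto intro!: derivative_eq_intros)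
      then show "((\<lambda>t. of_real (cos (snd (a, t)))) has_vector_derivative (\<lambda>p. - complex_of_real (sin (snd p))) (a, b)) (at b)" for a b :: real
        by simp
      show "((\<lambda>t. complex_of_real (cos (snd (t, b)))) has_vector_derivative (\<lambda>p. 0) (a, b)) (at a)" for a b :: real
        by simp
    qed (intro rules)+
  next
    case (add F H)
    then obtain Ft Fp Ht Hp where FH: "Ft \<in> chart_alg" "Fp \<in> chart_alg" "Ht \<in> chart_alg" "Hp \<in> chart_alg"
      "\<And>a b. ((\<lambda>t. F (t, b)) has_vector_derivative Ft (a, b)) (at a)"
      "\<And>a b. ((\<lambda>t. F (a, t)) has_vector_derivative Fp (a, b)) (at b)"
      "\<And>a b. ((\<lambda>t. H (t, b)) has_vector_derivative Ht (a, b)) (at a)"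
      "\<And>a b. ((\<lambda>t. H (a, t)) has_vector_derivative Hp (a, b)) (at b)"
      by blast
    show ?case
      using FH by (intro conjI bexI[of _ "\<lambda>p. Ft p + Ht p"] bexI[of _ "\<lambda>p. Fp p + Hp p"] allI
        has_vector_derivative_add rules) auto
  next
    case (mult F H)
    then obtain Ft Fp Ht Hp where FH: "Ft \<in> chart_alg" "Fp \<in> chart_alg" "Ht \<in> chart_alg" "Hp \<in> chart_alg"
      "\<And>a b. ((\<lambda>t. F (t, b)) has_vector_derivative Ft (a, b)) (at a)"
      "\<And>a b. ((\<lambda>t. F (a, t)) has_vector_derivative Fp (a, b)) (at b)"
      "\<And>a b. ((\<lambda>t. H (t, b)) has_vector_derivative Ht (a, b)) (at a)"
      "\<And>a b. ((\<lambda>t. H (a, t)) has_vector_derivative Hp (a, b)) (at b)"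
      by blast
    show ?case
      using FH mult.hyps by (intro conjI bexI[of _ "\<lambda>p. F p * Ht p + Ft p * H p"]
        bexI[of _ "\<lambda>p. F p * Hp p + Fp p * H p"] allI has_vector_derivative_mult rules) auto
  qed
  then show ?t ?p by blast+
qed

text \<open>The derivative is required at every point, so that the result is an equality of
  functions and can be rewritten inside a second derivative.\<close>

lemma d_theta_eqI:
  "(\<And>a b. ((\<lambda>t. F (t, b)) has_vector_derivative F' (a, b)) (at a)) \<Longrightarrow> d_theta F = F'"
  by (auto simp: d_theta_def fun_eq_iff intro!: vector_derivative_at)

lemma d_phi_eqI:
  "(\<And>a b. ((\<lambda>t. F (a, t)) has_vector_derivative F' (a, b)) (at b)) \<Longrightarrow> d_phi F = F'"
  by (auto simp: d_phi_def fun_eq_iff intro!: vector_derivative_at)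

lemma chart_alg_has_d_theta:
  assumes "F \<in> chart_alg"
  shows "((\<lambda>t. F (t, b)) has_vector_derivative d_theta F (a, b)) (at a)"
  using chart_alg_partial(1)[OF assms] by (metis d_theta_eqI)

lemma chart_alg_has_d_phi:
  assumes "F \<in> chart_alg"
  shows "((\<lambda>t. F (a, t)) has_vector_derivative d_phi F (a, b)) (at b)"
  using chart_alg_partial(2)[OF assms] by (metis d_phi_eqI)

lemma chart_alg_d_theta: "F \<in> chart_alg \<Longrightarrow> d_theta F \<in> chart_alg"
  using chart_alg_partial(1)[of F] d_theta_eqI by metis

lemma chart_alg_d_phi: "F \<in> chart_alg \<Longrightarrow> d_phi F \<in> chart_alg"
  using chart_alg_partial(2)[of F] d_phi_eqI by metis

lemmas chart_alg_rules =
  chart_alg_const chart_alg.sin_fst chart_alg.sin_snd chart_alg.cos_snd chart_alg_cos_fst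
  chart_alg_uminus chart_alg.add chart_alg_diff chart_alg.mult chart_alg_power
  chart_alg_d_theta chart_alg_d_phi

lemma d_theta_simps:
  "d_theta (\<lambda>p. c) = (\<lambda>p. 0)"
  "d_theta (\<lambda>p. complex_of_real (sin (fst p))) = (\<lambda>p. of_real (cos (fst p)))"
  "d_theta (\<lambda>p. complex_of_real (cos (fst p))) = (\<lambda>p. - of_real (sin (fst p)))"
  "F \<in> chart_alg \<Longrightarrow> d_theta (\<lambda>p. - F p) = (\<lambda>p. - d_theta F p)"
  "F \<in> chart_alg \<Longrightarrow> H \<in> chart_alg \<Longrightarrow> d_theta (\<lambda>p. F p + H p) = (\<lambda>p. d_theta F p + d_theta H p)"
  "F \<in> chart_alg \<Longrightarrow> H \<in> chart_alg \<Longrightarrow> d_theta (\<lambda>p. F p - H p) = (\<lambda>p. d_theta F p - d_theta H p)"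
  "F \<in> chart_alg \<Longrightarrow> H \<in> chart_alg \<Longrightarrow> d_theta (\<lambda>p. F p * H p) = (\<lambda>p. F p * d_theta H p + d_theta F p * H p)"
proof -
  show "d_theta (\<lambda>p. complex_of_real (cos (fst p))) = (\<lambda>p. - of_real (sin (fst p)))"
    unfolding of_real_minus[symmetric]
    by (rule d_theta_eqI, unfold fst_conv, rule has_vector_derivative_of_real) (auto intro!: derivative_eq_intros)
qed (rule d_theta_eqI; auto intro!: has_vector_derivative_minus has_vector_derivative_add has_vector_derivative_diff
   has_vector_derivative_mult has_vector_derivative_of_real chart_alg_has_d_theta derivative_eq_intros)+

lemma d_phi_simps:
  "d_phi (\<lambda>p. c) = (\<lambda>p. 0)"
  "d_phi (\<lambda>p. complex_of_real (sin (fst p))) = (\<lambda>p. 0)"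
  "d_phi (\<lambda>p. complex_of_real (cos (fst p))) = (\<lambda>p. 0)"
  "F \<in> chart_alg \<Longrightarrow> d_phi (\<lambda>p. - F p) = (\<lambda>p. - d_phi F p)"
  "F \<in> chart_alg \<Longrightarrow> H \<in> chart_alg \<Longrightarrow> d_phi (\<lambda>p. F p + H p) = (\<lambda>p. d_phi F p + d_phi H p)"
  "F \<in> chart_alg \<Longrightarrow> H \<in> chart_alg \<Longrightarrow> d_phi (\<lambda>p. F p - H p) = (\<lambda>p. d_phi F p - d_phi H p)"
  "F \<in> chart_alg \<Longrightarrow> H \<in> chart_alg \<Longrightarrow> d_phi (\<lambda>p. F p * H p) = (\<lambda>p. F p * d_phi H p + d_phi F p * H p)"
  by (rule d_phi_eqI; auto intro!: has_vector_derivative_minus has_vector_derivative_add has_vector_derivative_diff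
   has_vector_derivative_mult chart_alg_has_d_phi)+

section \<open>Integration over the chart and uniqueness of stream fields\<close>

abbreviation sn :: "real \<times> real \<Rightarrow> complex" where
  "sn p \<equiv> complex_of_real (sin (fst p))"

abbreviation cs :: "real \<times> real \<Rightarrow> complex" where
  "cs p \<equiv> complex_of_real (cos (fst p))"

definition chart_int :: "(real \<times> real \<Rightarrow> complex) \<Rightarrow> complex" where
  "chart_int F = integral (cbox (0, 0) (pi, 2 * pi)) F"

lemma chart_eq_box: "chart = box (0, 0) (pi, 2 * pi)"
  by (auto simp: chart_def box_def Basis_prod_def)

lemma open_chart: "open chart"
  unfolding chart_eq_box by (rule open_box)

lemma closure_chart: "closure chart = cbox (0, 0) (pi, 2 * pi)"
proof -
  have "(pi / 2, pi) \<in> chart" by (simp add: chart_def)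
  then show ?thesis unfolding chart_eq_box by (intro closure_box) auto
qed

lemma sn_nonzero: "p \<in> chart \<Longrightarrow> sn p \<noteq> 0"
  using sin_gt_zero[of "fst p"] by (auto simp: chart_def)

text \<open>The integrands contain quotients by the sine, which take default values at the poles. On
  the open chart they agree with a continuous function on the closed rectangle, and the boundary is
  a null set. The Lebesgue integral of the definitions is thereby traded for a gauge integral, to
  which Fubini and the fundamental theorem apply.\<close>

lemma chart_lint_eq:
  assumes F: "F \<in> chart_alg" and eq: "\<And>p. p \<in> chart \<Longrightarrow> H p = F p"
  shows "(LINT p : chart | lborel. H p) = chart_int F"
proof -
  have "set_integrable lborel (cbox (0, 0) (pi, 2 * pi)) F"
    unfolding set_integrable_def
    by (intro borel_integrable_compact compact_cbox chart_alg_continuous_on F)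
  then have "set_integrable lborel chart F"
    by (rule set_integrable_subset) (use closure_subset closure_chart open_chart in auto)
  then have "(LINT p : chart | lborel. F p) = chart_int F"
    by (simp add: set_borel_integral_eq_integral chart_eq_box integral_open_interval chart_int_def)
  moreover have "(LINT p : chart | lborel. H p) = (LINT p : chart | lborel. F p)"
    using eq by (intro set_lebesgue_integral_cong) (auto simp: open_chart)
  ultimately show ?thesis by simp
qed

lemma chart_int_d_theta:
  assumes P: "P \<in> chart_alg" and 0: "\<And>y. P (0, y) = 0" "\<And>y. P (pi, y) = 0"
  shows "chart_int (d_theta P) = 0"
proof -
  have cont: "continuous_on A (\<lambda>(x, y). d_theta P (x, y))" for A
    using chart_alg_continuous_on[OF chart_alg_d_theta[OF P]] by simp
  have "chart_int (d_theta P) = integral {0..pi} (\<lambda>x. integral {0..2*pi} (\<lambda>y. d_theta P (x, y)))"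
    unfolding chart_int_def using integral_prod_continuous[OF cont] by simp
  also have "\<dots> = integral {0..2*pi} (\<lambda>y. integral {0..pi} (\<lambda>x. d_theta P (x, y)))"
    using integral_swap_continuous[OF cont] by simp
  also have "(\<lambda>y. integral {0..pi} (\<lambda>x. d_theta P (x, y))) = (\<lambda>y. P (pi, y) - P (0, y))"
    by (rule ext, rule integral_unique, rule fundamental_theorem_of_calculus[where f="\<lambda>x. P (x, y)" for y])
      (simp_all add: has_vector_derivative_at_within chart_alg_has_d_theta[OF P])
  finally show ?thesis by (simp add: 0)
qed

lemma chart_int_d_phi:
  assumes P: "P \<in> chart_alg"
  shows "chart_int (d_phi P) = 0"
proof -
  have "chart_int (d_phi P) = integral {0..pi} (\<lambda>x. integral {0..2*pi} (\<lambda>y. d_phi P (x, y)))"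
    unfolding chart_int_def
    using integral_prod_continuous[OF chart_alg_continuous_on[OF chart_alg_d_phi[OF P]]] by simp
  also have "(\<lambda>x. integral {0..2*pi} (\<lambda>y. d_phi P (x, y))) = (\<lambda>x. P (x, 2 * pi) - P (x, 0))"
    by (rule ext, rule integral_unique, rule fundamental_theorem_of_calculus[where f="\<lambda>y. P (x, y)" for x])
      (simp_all add: has_vector_derivative_at_within chart_alg_has_d_phi[OF P])
  finally show ?thesis using chart_alg_periodic[OF P, of _ 0] by simp
qed

lemma chart_alg_integrable: "F \<in> chart_alg \<Longrightarrow> F integrable_on cbox (0, 0) (pi, 2 * pi)"
  by (intro integrable_continuous chart_alg_continuous_on)

lemma chart_int_add:
  "F \<in> chart_alg \<Longrightarrow> H \<in> chart_alg \<Longrightarrow> chart_int (\<lambda>p. F p + H p) = chart_int F + chart_int H"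
  unfolding chart_int_def by (intro integral_add chart_alg_integrable)

lemma chart_int_cmult: "chart_int (\<lambda>p. c * F p) = c * chart_int F"
  unfolding chart_int_def by simp

text \<open>Every integration by parts on fields below is one use of this rule: a potential
  \<open>P\<close> that vanishes at the poles and a periodic \<open>Q\<close> are exhibited, and
  what remains is a pointwise identity on the chart.\<close>

lemma chart_lint_by_parts:
  assumes "F \<in> chart_alg" "P \<in> chart_alg" "Q \<in> chart_alg"
    and "\<And>y. P (0, y) = 0" "\<And>y. P (pi, y) = 0"
    and "\<And>p. p \<in> chart \<Longrightarrow> H p = F p + d_theta P p + d_phi Q p"
  shows "(LINT p : chart | lborel. H p) = chart_int F"
proof -
  have "(LINT p : chart | lborel. H p) = chart_int (\<lambda>p. F p + d_theta P p + d_phi Q p)"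
    using assms by (intro chart_lint_eq chart_alg_rules) auto
  also have "\<dots> = chart_int F"
    using assms by (simp add: chart_int_add chart_alg_rules chart_int_d_theta chart_int_d_phi)
  finally show ?thesis .
qed

section \<open>Functions and fields that agree on the chart\<close>

definition chart_eq :: "(real \<times> real \<Rightarrow> 'a) \<Rightarrow> (real \<times> real \<Rightarrow> 'a) \<Rightarrow> bool" where
  "chart_eq X Y \<longleftrightarrow> (\<forall>p\<in>chart. X p = Y p)"

lemma chart_eq_refl [simp]: "chart_eq X X"
  and chart_eq_sym: "chart_eq X Y \<Longrightarrow> chart_eq Y X"
  and chart_eq_trans [trans]: "chart_eq X Y \<Longrightarrow> chart_eq Y Z \<Longrightarrow> chart_eq X Z"
  by (auto simp: chart_eq_def)

text \<open>The chart is open, so near \<open>p\<close> the coordinate line stays inside it.\<close>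

lemma d_theta_chart_cong:
  assumes "chart_eq F H" "p \<in> chart" shows "d_theta F p = d_theta H p"
  unfolding d_theta_def
proof (rule vector_derivative_cong_eq)
  have "open ((\<lambda>t. (t, snd p)) -` chart)"
    by (intro open_vimage open_chart continuous_intros)
  moreover have "fst p \<in> (\<lambda>t. (t, snd p)) -` chart" using assms by simp
  ultimately have "eventually (\<lambda>t. t \<in> (\<lambda>t. (t, snd p)) -` chart) (nhds (fst p))"
    by (rule eventually_nhds_in_open)
  then show "eventually (\<lambda>t. t \<in> UNIV \<longrightarrow> F (t, snd p) = H (t, snd p)) (nhds (fst p))"
    by eventually_elim (use assms in \<open>auto simp: chart_eq_def\<close>)
qed (auto simp: assms)

lemma d_phi_chart_cong:
  assumes "chart_eq F H" "p \<in> chart" shows "d_phi F p = d_phi H p"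
  unfolding d_phi_def
proof (rule vector_derivative_cong_eq)
  have "open ((\<lambda>t. (fst p, t)) -` chart)"
    by (intro open_vimage open_chart continuous_intros)
  moreover have "snd p \<in> (\<lambda>t. (fst p, t)) -` chart" using assms by simp
  ultimately have "eventually (\<lambda>t. t \<in> (\<lambda>t. (fst p, t)) -` chart) (nhds (snd p))"
    by (rule eventually_nhds_in_open)
  then show "eventually (\<lambda>t. t \<in> UNIV \<longrightarrow> F (fst p, t) = H (fst p, t)) (nhds (snd p))"
    by eventually_elim (use assms in \<open>auto simp: chart_eq_def\<close>)
qed (auto simp: assms)

lemma sgrad_chart_cong: "chart_eq F H \<Longrightarrow> chart_eq (sgrad F) (sgrad H)"
  by (auto simp: chart_eq_def[of "sgrad _"] sgrad_def d_theta_chart_cong d_phi_chart_cong)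

lemma vadd_chart_cong: "chart_eq X X' \<Longrightarrow> chart_eq Y Y' \<Longrightarrow> chart_eq (vadd X Y) (vadd X' Y')"
  and vscale_chart_cong: "chart_eq X X' \<Longrightarrow> chart_eq (vscale c X) (vscale c X')"
  and vsub_chart_cong: "chart_eq X X' \<Longrightarrow> chart_eq Y Y' \<Longrightarrow> chart_eq (vsub X Y) (vsub X' Y')"
  by (auto simp: chart_eq_def vadd_def vscale_def vsub_def)

lemma lie_chart_cong:
  assumes "chart_eq X X'" "chart_eq Y Y'"
  shows "chart_eq (lie X Y) (lie X' Y')"
proof -
  have "chart_eq (\<lambda>p. fst (X p)) (\<lambda>p. fst (X' p))" "chart_eq (\<lambda>p. fst (Y p)) (\<lambda>p. fst (Y' p))"
    "chart_eq (\<lambda>p. snd (X p)) (\<lambda>p. snd (X' p))" "chart_eq (\<lambda>p. snd (Y p)) (\<lambda>p. snd (Y' p))"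
    using assms by (auto simp: chart_eq_def)
  note this[THEN d_theta_chart_cong] this[THEN d_phi_chart_cong]
  then show ?thesis
    using assms by (auto simp: chart_eq_def lie_def dir_der_def)
qed

lemma bil_chart_cong: "chart_eq X X' \<Longrightarrow> chart_eq Y Y' \<Longrightarrow> bil X Y = bil X' Y'"
  unfolding bil_def by (intro set_lebesgue_integral_cong) (auto simp: open_chart chart_eq_def)

lemma herm_chart_cong: "chart_eq X X' \<Longrightarrow> chart_eq Y Y' \<Longrightarrow> herm X Y = herm X' Y'"
  unfolding herm_def by (intro set_lebesgue_integral_cong) (auto simp: open_chart chart_eq_def)

text \<open>The conclusion is a true equality, not only one on the chart, because the description
  that defines \<open>Bop\<close> sees its arguments only through \<open>bil\<close>.\<close>

lemma Bop_chart_cong: "chart_eq X X' \<Longrightarrow> chart_eq Y Y' \<Longrightarrow> Bop X Y = Bop X' Y'"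
proof -
  assume "chart_eq X X'" "chart_eq Y Y'"
  then have "bil X (lie Y w) = bil X' (lie Y' w)" for w
    by (intro bil_chart_cong lie_chart_cong) simp_all
  then show ?thesis by (simp add: Bop_def)
qed

lemma nabla_chart_cong: "chart_eq X X' \<Longrightarrow> chart_eq Y Y' \<Longrightarrow> chart_eq (nabla X Y) (nabla X' Y')"
  unfolding nabla_def
  by (auto intro!: vscale_chart_cong vsub_chart_cong lie_chart_cong simp: Bop_chart_cong[of X X' Y Y'] Bop_chart_cong[of Y Y' X X'])

lemma sec_curv_chart_cong:
  assumes "chart_eq X X'" "chart_eq Y Y'"
  shows "sec_curv X Y = sec_curv X' Y'"
proof -
  have "chart_eq (Rcurv X Y X) (Rcurv X' Y' X')"
    unfolding Rcurv_def by (intro vadd_chart_cong vscale_chart_cong nabla_chart_cong lie_chart_cong assms)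
  then show ?thesis
    using herm_chart_cong assms unfolding sec_curv_def by metis
qed

section \<open>Stream functions on the sphere and uniqueness of their fields\<close>

definition sphere_fun :: "(real \<times> real \<Rightarrow> complex) \<Rightarrow> bool" where
  "sphere_fun g \<longleftrightarrow> (\<exists>f. smoothC f \<and> g = (\<lambda>p. f (sph p)))"

lemma SVect_eq: "SVect = {sgrad g | g. sphere_fun g}"
  by (auto simp: SVect_def sphere_fun_def)

lemma sphere_fun_chart_alg: "sphere_fun g \<Longrightarrow> g \<in> chart_alg"
  by (auto simp: sphere_fun_def intro: chart_alg.comp_sph)

lemma sphere_fun_const: "sphere_fun (\<lambda>p. c)"
  unfolding sphere_fun_def by (rule exI[of _ "\<lambda>x. c"]) (simp add: smoothC_const)

lemma sphere_fun_add: "sphere_fun g \<Longrightarrow> sphere_fun h \<Longrightarrow> sphere_fun (\<lambda>p. g p + h p)"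
  unfolding sphere_fun_def using smoothC_add by blast

lemma sphere_fun_mult: "sphere_fun g \<Longrightarrow> sphere_fun h \<Longrightarrow> sphere_fun (\<lambda>p. g p * h p)"
  unfolding sphere_fun_def using smoothC_mult by blast

lemma sphere_fun_cnj: "sphere_fun g \<Longrightarrow> sphere_fun (\<lambda>p. cnj (g p))"
  unfolding sphere_fun_def using smoothC_bounded_linear_compose[OF bounded_linear_cnj] by blast

lemma sphere_fun_power: "sphere_fun g \<Longrightarrow> sphere_fun (\<lambda>p. g p ^ n)"
  by (induction n) (auto intro: sphere_fun_const sphere_fun_mult)

lemma sphere_fun_cos: "sphere_fun cs"
  unfolding sphere_fun_def
  by (intro exI[of _ "\<lambda>x. complex_of_real (snd (snd x))"]) (simp add: sph_def smoothC_height)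

text \<open>The derivative along the parallels vanishes at the poles to first order, which is what makes
  all the chart expressions below regular there.\<close>
lemma sphere_fun_d_phi:
  assumes "sphere_fun g"
  obtains G where "G \<in> chart_alg" "d_phi g = (\<lambda>p. sn p * G p)"
proof -
  obtain f where f: "smoothC f" "g = (\<lambda>p. f (sph p))"
    using assms by (auto simp: sphere_fun_def)
  let ?D = "\<lambda>v p. frechet_derivative f (at (sph p)) v"
  let ?G = "\<lambda>p. of_real (cos (snd p)) * ?D (0,1,0) p + - of_real (sin (snd p)) * ?D (1,0,0) p"
  have "?D v \<in> chart_alg" for v
    by (rule chart_alg.comp_sph[OF smoothC_frechet_derivative[OF f(1)]])
  then have "?G \<in> chart_alg"
    by (intro chart_alg_rules)
  moreover have "d_phi g = (\<lambda>p. sn p * ?G p)"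
    unfolding f(2) by (rule d_phi_eqI) (use sph_d_phi[OF f(1)] in simp)
  ultimately show ?thesis using that by blast
qed

lemma d_theta_div_sin:
  assumes "F \<in> chart_alg" "p \<in> chart"
  shows "d_theta (\<lambda>q. F q / sn q) p = d_theta F p / sn p - F p * cs p / (sn p)\<^sup>2"
proof -
  obtain a b where p: "p = (a, b)" by fastforce
  have s: "sin a \<noteq> 0" using sn_nonzero[OF assms(2)] p by simp
  have "((\<lambda>t. of_real (inverse (sin t))) has_vector_derivative complex_of_real (- cos a / (sin a)\<^sup>2)) (at a)"
    using s by (intro has_vector_derivative_of_real)
      (auto intro!: derivative_eq_intros simp: divide_simps power2_eq_square)
  from has_vector_derivative_mult[OF chart_alg_has_d_theta[OF assms(1), of b a] this]
  have "((\<lambda>t. F (t, b) / of_real (sin t)) has_vector_derivative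
     F (a, b) * complex_of_real (- cos a / (sin a)\<^sup>2) + d_theta F (a, b) * of_real (inverse (sin a))) (at a)"
    by (simp add: divide_inverse of_real_inverse)
  from vector_derivative_at[OF this] show ?thesis
    by (simp add: p d_theta_def divide_simps)
qed

text \<open>Along a parallel the divisor is constant, so the rule holds at the poles as well, where
  both sides are 0 by the convention for division by 0.\<close>

lemma d_phi_div_sin:
  assumes "F \<in> chart_alg"
  shows "d_phi (\<lambda>q. F q / sn q) p = d_phi F p / sn p"
proof -
  obtain a b where p: "p = (a, b)" by fastforce
  from vector_derivative_at[OF has_vector_derivative_divide[OF chart_alg_has_d_phi[OF assms, of a b], of "of_real (sin a)"]]
  show ?thesis by (simp add: p d_phi_def)
qed

lemma sgrad_deriv_simps:
  assumes "g \<in> chart_alg" "p \<in> chart"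
  shows "d_theta (\<lambda>q. fst (sgrad g q)) p = d_theta (d_phi g) p / sn p - d_phi g p * cs p / (sn p)\<^sup>2"
    "d_theta (\<lambda>q. snd (sgrad g q)) p = - d_theta (d_theta g) p / sn p + d_theta g p * cs p / (sn p)\<^sup>2"
    "d_phi (\<lambda>q. fst (sgrad g q)) p = d_phi (d_phi g) p / sn p"
    "d_phi (\<lambda>q. snd (sgrad g q)) p = - d_phi (d_theta g) p / sn p"
  using assms d_theta_div_sin[OF chart_alg_uminus, of "d_theta g" p] d_phi_div_sin[OF chart_alg_uminus, of "d_theta g" p]
  by (simp_all add: sgrad_def d_theta_div_sin d_phi_div_sin chart_alg_rules d_theta_simps d_phi_simps)

lemma sgrad_const: "sgrad (\<lambda>p. c) = (\<lambda>p. (0, 0))"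
  by (simp add: sgrad_def d_theta_simps d_phi_simps fun_eq_iff)

lemma cnj_d_theta: "F \<in> chart_alg \<Longrightarrow> d_theta (\<lambda>p. cnj (F p)) = (\<lambda>p. cnj (d_theta F p))"
  by (rule d_theta_eqI) (intro has_vector_derivative_cnj chart_alg_has_d_theta)

lemma cnj_d_phi: "F \<in> chart_alg \<Longrightarrow> d_phi (\<lambda>p. cnj (F p)) = (\<lambda>p. cnj (d_phi F p))"
  by (rule d_phi_eqI) (intro has_vector_derivative_cnj chart_alg_has_d_phi)

lemma chart_alg_cnj: "F \<in> chart_alg \<Longrightarrow> (\<lambda>p. cnj (F p)) \<in> chart_alg"
proof (induction rule: chart_alg.induct)
  case (comp_sph f)
  then show ?case
    using sphere_fun_chart_alg[OF sphere_fun_cnj] by (auto simp: sphere_fun_def)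
qed (simp_all add: chart_alg_rules)

lemma sgrad_cnj: "F \<in> chart_alg \<Longrightarrow> sgrad (\<lambda>p. cnj (F p)) = (\<lambda>p. (cnj (fst (sgrad F p)), cnj (snd (sgrad F p))))"
  by (simp add: sgrad_def cnj_d_theta cnj_d_phi fun_eq_iff)

lemma herm_eq_bil: "herm X Y = bil X (\<lambda>p. (cnj (fst (Y p)), cnj (snd (Y p))))"
  by (simp add: herm_def bil_def)

lemma herm_sgrad: "g \<in> chart_alg \<Longrightarrow> herm X (sgrad g) = bil X (sgrad (\<lambda>p. cnj (g p)))"
  by (simp add: herm_eq_bil sgrad_cnj)

text \<open>This carries identities from the closed rectangle to the whole coordinate plane. If
  reducing the colatitude to the interval from 0 to pi flips the sign of its sine, the longitude is
  turned by half a circle.\<close>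

lemma sphere_chart_point:
  obtains q where "q \<in> cbox (0, 0) (pi, 2 * pi)" "sph q = sph p"
proof -
  obtain a b where p: "p = (a, b)" by fastforce
  let ?th = "arccos (cos a)"
  have th: "0 \<le> ?th" "?th \<le> pi" "cos ?th = cos a"
    by (simp_all add: arccos_lbound arccos_ubound)
  have "(sin ?th)\<^sup>2 = (sin a)\<^sup>2"
    by (metis sin_squared_eq th(3))
  then consider "sin ?th = sin a" | "sin ?th = - sin a" by (auto simp: power2_eq_iff)
  then show ?thesis
  proof cases
    case 1
    obtain t where "0 \<le> t" "t < 2 * pi" "cos b = cos t" "sin b = sin t"
      using sincos_total_2pi[of "cos b" "sin b"] by auto
    then show ?thesis using that[of "(?th, t)"] th 1 by (auto simp: p sph_def)
  next
    case 2
    obtain t where "0 \<le> t" "t < 2 * pi" "- cos b = cos t" "- sin b = sin t"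
      using sincos_total_2pi[of "- cos b" "- sin b"] by auto
    then show ?thesis using that[of "(?th, t)"] th 2 by (auto simp: p sph_def simp flip: \<open>- cos b = cos t\<close> \<open>- sin b = sin t\<close>)
  qed
qed

lemma chart_int_nonneg_eq_0:
  assumes F: "F \<in> chart_alg" and r: "\<And>p. p \<in> chart \<Longrightarrow> F p = of_real (r p)" "\<And>p. p \<in> chart \<Longrightarrow> 0 \<le> r p"
    and "chart_int F = 0" "p \<in> chart"
  shows "F p = 0"
proof -
  let ?B = "cbox (0, 0) (pi, 2 * pi)"
  have c: "continuous_on ?B (\<lambda>p. Re (F p))"
    by (intro continuous_intros chart_alg_continuous_on[OF F])
  have "integral ?B (\<lambda>p. Re (F p)) = Re (chart_int F)"
    unfolding chart_int_def using chart_alg_integrable[OF F] integral_linear[of F ?B Re]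
    by (simp add: bounded_linear_Re o_def)
  then have z: "((\<lambda>p. Re (F p)) has_integral 0) ?B"
    using integrable_continuous[OF c] \<open>chart_int F = 0\<close> by (metis has_integral_integral zero_complex.sel(1))
  have "p \<in> ?B"
    using \<open>p \<in> chart\<close> closure_subset[of chart] closure_chart by blast
  then have "Re (F p) = 0"
    by (intro has_integral_0_cbox_imp_0[OF c _ z]) (use r \<open>p \<in> chart\<close> chart_eq_box in auto)
  then show ?thesis
    using r \<open>p \<in> chart\<close> by (simp add: complex_eq_iff)
qed

text \<open>Testing against the conjugate turns \<open>bil\<close> into the energy, so both partial
  derivatives of \<open>g\<close> vanish on the chart. Thus \<open>g\<close> is constant there, by
  continuity on the closure, and, since it descends to the sphere, on the whole plane. The
  uniqueness in \<open>Bop\<close> demands this global conclusion.\<close>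

lemma sgrad_eq_0_if_bil_0:
  assumes g: "sphere_fun g" and 0: "bil (sgrad g) (sgrad (\<lambda>p. cnj (g p))) = 0"
  shows "sgrad g = (\<lambda>p. (0, 0))"
proof -
  have gA: "g \<in> chart_alg" by (rule sphere_fun_chart_alg[OF g])
  obtain G where G: "G \<in> chart_alg" "d_phi g = (\<lambda>p. sn p * G p)"
    using sphere_fun_d_phi[OF g] .
  let ?F = "\<lambda>p. sn p * (G p * cnj (G p) + d_theta g p * cnj (d_theta g p))"
  have F: "?F \<in> chart_alg"
    by (intro chart_alg_rules chart_alg_cnj G gA)
  have "bil (sgrad g) (sgrad (\<lambda>p. cnj (g p))) = chart_int ?F"
    unfolding bil_def
    by (rule chart_lint_eq[OF F])
      (auto simp: sgrad_def cnj_d_theta cnj_d_phi gA G divide_simps power2_eq_square algebra_simps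
        dest!: sn_nonzero)
  then have "chart_int ?F = 0" using 0 by simp
  have F0: "?F p = 0" if "p \<in> chart" for p
  proof (rule chart_int_nonneg_eq_0[OF F _ _ \<open>chart_int ?F = 0\<close> that])
    show "?F p = of_real (sin (fst p) * ((cmod (G p))\<^sup>2 + (cmod (d_theta g p))\<^sup>2))" for p
      by (simp add: complex_norm_square del: of_real_power)
    show "0 \<le> sin (fst p) * ((cmod (G p))\<^sup>2 + (cmod (d_theta g p))\<^sup>2)" if "p \<in> chart" for p
      using that sin_gt_zero[of "fst p"] by (auto simp: chart_def)
  qed
  have Z: "G p = 0 \<and> d_theta g p = 0" if "p \<in> chart" for p
  proof -
    have "G p * cnj (G p) + d_theta g p * cnj (d_theta g p) = 0"
      using F0[OF that] sn_nonzero[OF that] by simp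
    then have "complex_of_real ((cmod (G p))\<^sup>2 + (cmod (d_theta g p))\<^sup>2) = 0"
      by (simp add: complex_norm_square del: of_real_power)
    then have "(cmod (G p))\<^sup>2 + (cmod (d_theta g p))\<^sup>2 = 0"
      by (simp only: of_real_eq_0_iff)
    then show ?thesis by (simp add: add_nonneg_eq_0_iff)
  qed
  have th: "g (a, b) = g (a', b)" if "a \<in> {0<..<pi}" "a' \<in> {0<..<pi}" "b \<in> {0<..<2*pi}" for a a' b
  proof (rule has_derivative_zero_unique_connected[where f="\<lambda>t. g (t, b)" and s="{0<..<pi}"])
    show "((\<lambda>t. g (t, b)) has_derivative (\<lambda>h. 0)) (at t)" if "t \<in> {0<..<pi}" for t
      using chart_alg_has_d_theta[OF gA, of b t] Z[of "(t, b)"] that \<open>b \<in> _\<close>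
      by (auto simp: has_vector_derivative_def chart_def intro: has_derivative_at_withinI)
  qed (use that in auto)
  have ph: "g (a, b) = g (a, b')" if "a \<in> {0<..<pi}" "b \<in> {0<..<2*pi}" "b' \<in> {0<..<2*pi}" for a b b'
  proof (rule has_derivative_zero_unique_connected[where f="\<lambda>t. g (a, t)" and s="{0<..<2*pi}"])
    show "((\<lambda>t. g (a, t)) has_derivative (\<lambda>h. 0)) (at t)" if "t \<in> {0<..<2*pi}" for t
      using chart_alg_has_d_phi[OF gA, of a t] Z[of "(a, t)"] that \<open>a \<in> _\<close> G(2)
      by (auto simp: has_vector_derivative_def chart_def intro: has_derivative_at_withinI)
  qed (use that in auto)
  define c where "c = g (pi / 2, pi)"
  have "g p = c" if "p \<in> chart" for p
  proof -
    have "g p = g (pi / 2, snd p)" using th[of "fst p" "pi/2" "snd p"] that by (auto simp: chart_def)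
    also have "\<dots> = c" unfolding c_def using that by (intro ph) (auto simp: chart_def)
    finally show ?thesis .
  qed
  then have "g ` closure chart \<subseteq> {c}"
    by (intro image_closure_subset chart_alg_continuous_on[OF gA]) auto
  then have box: "g q = c" if "q \<in> cbox (0, 0) (pi, 2 * pi)" for q
    using that closure_chart by auto
  have "g p = c" for p
  proof -
    obtain q where "q \<in> cbox (0, 0) (pi, 2 * pi)" "sph q = sph p" by (rule sphere_chart_point)
    moreover have "g p = g q" using g \<open>sph q = sph p\<close> by (auto simp: sphere_fun_def)
    ultimately show ?thesis using box by simp
  qed
  then have "g = (\<lambda>p. c)" by auto
  then show ?thesis by (simp add: sgrad_const)
qed

lemma sgrad_add: "F \<in> chart_alg \<Longrightarrow> H \<in> chart_alg \<Longrightarrow> sgrad (\<lambda>p. F p + H p) = vadd (sgrad F) (sgrad H)"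
  by (simp add: sgrad_def vadd_def d_theta_simps d_phi_simps fun_eq_iff add_divide_distrib diff_divide_distrib)

lemma sgrad_cmult: "F \<in> chart_alg \<Longrightarrow> sgrad (\<lambda>p. c * F p) = vscale c (sgrad F)"
  by (simp add: sgrad_def vscale_def d_theta_simps d_phi_simps fun_eq_iff chart_alg_const)

section \<open>The operator B against the zonal field\<close>

text \<open>For uniqueness, the difference of two candidates is again the field of a sphere function
  \<open>d\<close>, and \<open>SVect\<close> contains the field of the conjugate of
  \<open>d\<close>; testing against it shows that the difference has zero energy.\<close>

lemma Bop_eqI:
  assumes z: "z \<in> SVect" and eq: "\<And>g. sphere_fun g \<Longrightarrow> bil z (sgrad g) = bil u (lie v (sgrad g))"
  shows "Bop u v = z"
  unfolding Bop_def
proof (rule the_equality)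
  show "z \<in> SVect \<and> (\<forall>w\<in>SVect. bil z w = bil u (lie v w))"
    using z eq by (auto simp: SVect_eq)
next
  fix z' assume z': "z' \<in> SVect \<and> (\<forall>w\<in>SVect. bil z' w = bil u (lie v w))"
  then obtain a b where ab: "sphere_fun a" "z' = sgrad a" "sphere_fun b" "z = sgrad b"
    using z by (auto simp: SVect_eq)
  note A = ab(1,3)[THEN sphere_fun_chart_alg]
  define d where "d = (\<lambda>p. a p + (-1) * b p)"
  have d: "sphere_fun d"
    unfolding d_def by (intro sphere_fun_add sphere_fun_mult sphere_fun_const ab)
  have dg: "sgrad d = vadd z' (vscale (-1) z)"
    unfolding d_def ab using A by (simp only: sgrad_add sgrad_cmult chart_alg_rules)
  let ?w = "sgrad (\<lambda>p. cnj (d p))"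
  have w: "sphere_fun (\<lambda>p. cnj (d p))" by (rule sphere_fun_cnj[OF d])
  \<comment> \<open>\<open>bil\<close> may be split over a difference only if both integrands are
    integrable; this replaces each of them by a member of \<open>chart_alg\<close>.\<close>
  have bilA: "\<exists>F\<in>chart_alg. \<forall>p\<in>chart. (fst (sgrad c p) * fst (?w p) + complex_of_real ((sin (fst p))\<^sup>2) * snd (sgrad c p) * snd (?w p))
      * complex_of_real (sin (fst p)) = F p" if c: "sphere_fun c" for c
  proof -
    obtain C D where "C \<in> chart_alg" "d_phi c = (\<lambda>p. sn p * C p)" 
      "D \<in> chart_alg" "d_phi (\<lambda>p. cnj (d p)) = (\<lambda>p. sn p * D p)" 
      using sphere_fun_d_phi[OF c] sphere_fun_d_phi[OF w] by metis
    then show ?thesis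
      using sphere_fun_chart_alg[OF c] sphere_fun_chart_alg[OF w]
      by (intro bexI[of _ "\<lambda>p. sn p * (C p * D p + d_theta c p * d_theta (\<lambda>p. cnj (d p)) p)"])
        (auto simp: sgrad_def divide_simps power2_eq_square algebra_simps intro!: chart_alg_rules dest!: sn_nonzero)
  qed
  obtain F1 where F1: "F1 \<in> chart_alg" "\<And>p. p \<in> chart \<Longrightarrow> (fst (z' p) * fst (?w p) + complex_of_real ((sin (fst p))\<^sup>2) * snd (z' p) * snd (?w p))
      * complex_of_real (sin (fst p)) = F1 p" using bilA[OF ab(1)] ab(2) by auto
  obtain F2 where F2: "F2 \<in> chart_alg" "\<And>p. p \<in> chart \<Longrightarrow> (fst (z p) * fst (?w p) + complex_of_real ((sin (fst p))\<^sup>2) * snd (z p) * snd (?w p))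
      * complex_of_real (sin (fst p)) = F2 p" using bilA[OF ab(3)] ab(4) by auto
  have "bil (sgrad d) ?w = chart_int (\<lambda>p. F1 p + (-1) * F2 p)"
    unfolding bil_def
  proof (rule chart_lint_eq)
    show "(fst (sgrad d p) * fst (?w p) + complex_of_real ((sin (fst p))\<^sup>2) * snd (sgrad d p) * snd (?w p))
      * complex_of_real (sin (fst p)) = F1 p + (-1) * F2 p" if "p \<in> chart" for p
      unfolding dg F1(2)[OF that, symmetric] F2(2)[OF that, symmetric] by (simp add: vadd_def vscale_def algebra_simps)
  qed (intro chart_alg_rules F1 F2)
  also have "\<dots> = chart_int F1 + (-1) * chart_int F2"
    by (simp only: chart_int_add chart_int_cmult F1 F2 chart_alg_rules)
  also have "chart_int F1 = bil z' ?w"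
    unfolding bil_def by (rule chart_lint_eq[OF F1, symmetric])
  also have "chart_int F2 = bil z ?w"
    unfolding bil_def by (rule chart_lint_eq[OF F2, symmetric])
  also have "bil z' ?w = bil z ?w"
    using z' w eq[OF w] by (auto simp: SVect_eq)
  finally have "bil (sgrad d) ?w = 0" by simp
  from sgrad_eq_0_if_bil_0[OF d this] show "z' = z"
    unfolding dg by (simp add: vadd_def vscale_def fun_eq_iff prod_eq_iff)
qed

section \<open>Functions of a fixed angular frequency\<close>

definition equivariant :: "int \<Rightarrow> (real \<times> real \<Rightarrow> complex) \<Rightarrow> bool" where
  "equivariant m F \<longleftrightarrow> (\<forall>x y. F (x, y) = exp (\<i> * of_int m * of_real y) * F (x, 0))"

lemma equivariantD: "equivariant m F \<Longrightarrow> exp (\<i> * of_int m * of_real y) * F (x, 0) = F (x, y)"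
  unfolding equivariant_def by metis

lemma equivariant_d_theta:
  assumes "F \<in> chart_alg" "equivariant m F"
  shows "equivariant m (d_theta F)"
  unfolding equivariant_def
proof (intro allI)
  fix x y
  have "((\<lambda>t. exp (\<i> * of_int m * of_real y) * F (t, 0)) has_vector_derivative
      exp (\<i> * of_int m * of_real y) * d_theta F (x, 0)) (at x)"
    by (intro has_vector_derivative_mult_right chart_alg_has_d_theta assms)
  moreover have "(\<lambda>t. exp (\<i> * of_int m * of_real y) * F (t, 0)) = (\<lambda>t. F (t, y))"
    by (simp add: equivariantD[OF assms(2)])
  ultimately show "d_theta F (x, y) = exp (\<i> * of_int m * of_real y) * d_theta F (x, 0)"
    by (simp add: d_theta_def vector_derivative_at)
qed

lemma equivariant_d_phi:
  assumes "equivariant m F"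
  shows "d_phi F = (\<lambda>p. \<i> * of_int m * F p)"
proof (rule d_phi_eqI)
  fix a b
  have "((\<lambda>t. exp (\<i> * of_int m * of_real t) * F (a, 0)) has_vector_derivative
      (\<i> * of_int m * exp (\<i> * of_int m * of_real b)) * F (a, 0)) (at b)"
  proof (rule has_vector_derivative_mult_left)
    have "((\<lambda>z. exp (\<i> * of_int m * z)) has_field_derivative
      \<i> * of_int m * exp (\<i> * of_int m * of_real b)) (at (of_real b))"
      by (auto intro!: derivative_eq_intros)
    from has_vector_derivative_real_field[OF this]
    show "((\<lambda>t. exp (\<i> * of_int m * of_real t)) has_vector_derivative
      \<i> * of_int m * exp (\<i> * of_int m * of_real b)) (at b)" .
  qed
  moreover have "(\<lambda>t. exp (\<i> * of_int m * of_real t) * F (a, 0)) = (\<lambda>t. F (a, t))"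
    "F (a, b) = exp (\<i> * of_int m * of_real b) * F (a, 0)"
    by (simp_all add: equivariantD[OF assms])
  ultimately show "((\<lambda>t. F (a, t)) has_vector_derivative \<i> * of_int m * F (a, b)) (at b)"
    by (simp add: mult_ac)
qed

text \<open>\<open>mode m a b\<close>: the function \<open>a\<close> on the sphere has angular frequency \<open>m\<close> in \<open>\<phi>\<close> and
  Laplacian \<open>b\<close>; the Laplace equation is multiplied by \<open>sin\<^sup>2 \<theta>\<close>.\<close>
definition mode :: "int \<Rightarrow> (real \<times> real \<Rightarrow> complex) \<Rightarrow> (real \<times> real \<Rightarrow> complex) \<Rightarrow> bool" where
  "mode m a b \<longleftrightarrow> sphere_fun a \<and> b \<in> chart_alg \<and> equivariant m a \<and>
     (\<forall>p\<in>chart. (sn p)\<^sup>2 * d_theta (d_theta a) p + sn p * cs p * d_theta a p - (of_int m)\<^sup>2 * a p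
        = (sn p)\<^sup>2 * b p)"

lemma mode_add:
  assumes "mode m a b" "mode m a' b'"
  shows "mode m (\<lambda>p. a p + a' p) (\<lambda>p. b p + b' p)"
proof -
  have A: "a \<in> chart_alg" "a' \<in> chart_alg" "b \<in> chart_alg" "b' \<in> chart_alg"
    using assms by (auto simp: mode_def sphere_fun_chart_alg)
  have "equivariant m (\<lambda>p. a p + a' p)"
    using assms unfolding mode_def equivariant_def by (metis distrib_left)
  moreover have "(sn p)\<^sup>2 * (d_theta (d_theta a) p + d_theta (d_theta a') p)
     + sn p * cs p * (d_theta a p + d_theta a' p) - (of_int m)\<^sup>2 * (a p + a' p) = (sn p)\<^sup>2 * (b p + b' p)"
    if "p \<in> chart" for p
  proof -
    have "(sn p)\<^sup>2 * d_theta (d_theta a) p + sn p * cs p * d_theta a p - (of_int m)\<^sup>2 * a p = (sn p)\<^sup>2 * b p"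
     "(sn p)\<^sup>2 * d_theta (d_theta a') p + sn p * cs p * d_theta a' p - (of_int m)\<^sup>2 * a' p = (sn p)\<^sup>2 * b' p"
      using assms that by (auto simp: mode_def)
    then show ?thesis by algebra
  qed
  ultimately show ?thesis
    using assms A by (simp add: mode_def d_theta_simps chart_alg_rules sphere_fun_add)
qed

lemma mode_cmult:
  assumes "mode m a b"
  shows "mode m (\<lambda>p. c * a p) (\<lambda>p. c * b p)"
proof -
  have A: "a \<in> chart_alg" "b \<in> chart_alg"
    using assms by (auto simp: mode_def sphere_fun_chart_alg)
  have "equivariant m (\<lambda>p. c * a p)"
    using assms unfolding mode_def equivariant_def by (metis mult.left_commute)
  moreover have "(sn p)\<^sup>2 * (c * d_theta (d_theta a) p)
     + sn p * cs p * (c * d_theta a p) - (of_int m)\<^sup>2 * (c * a p) = (sn p)\<^sup>2 * (c * b p)"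
    if "p \<in> chart" for p
  proof -
    have "(sn p)\<^sup>2 * d_theta (d_theta a) p + sn p * cs p * d_theta a p - (of_int m)\<^sup>2 * a p = (sn p)\<^sup>2 * b p"
      using assms that by (auto simp: mode_def)
    then show ?thesis by algebra
  qed
  ultimately show ?thesis
    using assms A by (simp add: mode_def d_theta_simps chart_alg_rules sphere_fun_mult sphere_fun_const)
qed

lemma mode_cong: "mode m a b \<Longrightarrow> b' \<in> chart_alg \<Longrightarrow> (\<And>p. p \<in> chart \<Longrightarrow> b p = b' p) \<Longrightarrow> mode m a b'"
  by (simp add: mode_def)

lemma mode_alg: "mode m a b \<Longrightarrow> a \<in> chart_alg" "mode m a b \<Longrightarrow> b \<in> chart_alg"
  by (auto simp: mode_def sphere_fun_chart_alg)

lemma mode_d_phi: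
  assumes "mode m a b"
  shows "d_phi a = (\<lambda>p. \<i> * of_int m * a p)" "d_phi (d_theta a) = (\<lambda>p. \<i> * of_int m * d_theta a p)"
    "d_phi (d_theta (d_theta a)) = (\<lambda>p. \<i> * of_int m * d_theta (d_theta a) p)"
  using assms mode_alg[OF assms]
  by (auto simp: mode_def intro!: equivariant_d_phi equivariant_d_theta chart_alg_d_theta)

text \<open>\<open>A\<close> is the longitude derivative of \<open>a\<close> divided by the sine,
  regular at the poles by \<open>sphere_fun_d_phi\<close>. Its own longitude derivative is computed
  on the chart, where the factor \<open>sn\<close> can be cancelled.\<close>

lemma mode_div_sin:
  assumes "mode m a b"
  obtains A where "A \<in> chart_alg" "\<And>p. \<i> * of_int m * a p = sn p * A p"
    "\<And>p. p \<in> chart \<Longrightarrow> d_phi A p = \<i> * of_int m * A p"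
proof -
  have s: "sphere_fun a" using assms by (simp add: mode_def)
  obtain A where A: "A \<in> chart_alg" "d_phi a = (\<lambda>p. sn p * A p)"
    using sphere_fun_d_phi[OF s] .
  then have eq: "\<i> * of_int m * a p = sn p * A p" for p
    using mode_d_phi(1)[OF assms] by metis
  have "d_phi A p = \<i> * of_int m * A p" if "p \<in> chart" for p
  proof -
    have "chart_eq A (\<lambda>p. (\<i> * of_int m * a p) / sn p)"
      unfolding chart_eq_def eq by (auto dest: sn_nonzero)
    then have "d_phi A p = d_phi (\<lambda>p. (\<i> * of_int m * a p) / sn p) p"
      using that by (rule d_phi_chart_cong)
    also have "\<dots> = \<i> * of_int m * (\<i> * of_int m * a p) / sn p"
      using mode_alg[OF assms] mode_d_phi[OF assms]
      by (subst d_phi_div_sin) (simp_all add: chart_alg_rules d_phi_simps)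
    also have "\<dots> = \<i> * of_int m * A p" unfolding eq using sn_nonzero[OF that] by simp
    finally show ?thesis .
  qed
  then show ?thesis using that A eq by blast
qed

text \<open>Green's formula: the right side is minus the integral of the Laplacian of
  \<open>h\<close> times \<open>g\<close>. The witnesses \<open>P\<close> and \<open>Q\<close> are
  the two components of \<open>g\<close> times the gradient of \<open>h\<close>, weighted by the
  area density.\<close>

lemma bil_sgrad:
  assumes h: "mode m h b" and g: "sphere_fun g"
  shows "bil (sgrad h) (sgrad g) = chart_int (\<lambda>p. - (sn p * b p * g p))"
proof -
  note A = mode_alg[OF h] sphere_fun_chart_alg[OF g]
  obtain H where H: "H \<in> chart_alg" "\<And>p. \<i> * of_int m * h p = sn p * H p"
    "\<And>p. p \<in> chart \<Longrightarrow> d_phi H p = \<i> * of_int m * H p" using mode_div_sin[OF h] by blast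
  show ?thesis
    unfolding bil_def
  proof (rule chart_lint_by_parts[where P = "\<lambda>p. sn p * d_theta h p * g p" and Q = "\<lambda>p. H p * g p"])
    fix p assume p: "p \<in> chart"
    have "(sn p)\<^sup>2 * d_theta (d_theta h) p + sn p * cs p * d_theta h p - (of_int m)\<^sup>2 * h p = (sn p)\<^sup>2 * b p"
      using h p by (simp add: mode_def)
    moreover have "- (of_int m)\<^sup>2 * h p = \<i> * of_int m * (sn p * H p)"
      unfolding H(2)[symmetric] using i_squared by algebra
    ultimately have "sn p * (sn p * d_theta (d_theta h) p + cs p * d_theta h p + \<i> * of_int m * H p) = sn p * (sn p * b p)"
      by algebra
    then have L: "sn p * d_theta (d_theta h) p + cs p * d_theta h p + \<i> * of_int m * H p = sn p * b p"
      using sn_nonzero[OF p] by simp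
    have "(fst (sgrad h p) * fst (sgrad g p) + complex_of_real ((sin (fst p))\<^sup>2) * snd (sgrad h p) * snd (sgrad g p)) * sn p
      = H p * d_phi g p + sn p * d_theta h p * d_theta g p"
      using sn_nonzero[OF p] unfolding sgrad_def mode_d_phi[OF h] H(2)
      by (simp add: field_simps power2_eq_square)
    also have "\<dots> = - (sn p * b p * g p) + d_theta (\<lambda>p. sn p * d_theta h p * g p) p + d_phi (\<lambda>p. H p * g p) p"
      unfolding L[symmetric] using A H p by (simp add: d_theta_simps d_phi_simps chart_alg_rules algebra_simps)
    finally show "(fst (sgrad h p) * fst (sgrad g p) + complex_of_real ((sin (fst p))\<^sup>2) * snd (sgrad h p) * snd (sgrad g p)) * sn p = \<dots>" .
  qed (auto intro!: chart_alg_rules A H)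
qed

section \<open>Brackets and \<open>Bop\<close> for the zonal field\<close>

definition zconst :: complex where
  "zconst = of_real (sqrt (21 / pi) / 8)"

definition zonal :: "real \<times> real \<Rightarrow> complex" where
  "zonal p = zconst * (5 * (cs p * cs p) - 1)"

text \<open>A representative of \<open>ebasis 3 0\<close> without division by the sine, hence
  regular for all coordinate values; \<open>ebasis_3_0\<close> proves that the two agree on the
  chart.\<close>

definition ufield :: vfield where
  "ufield p = (0, zonal p)"

lemma zonal_alg: "zonal \<in> chart_alg"
  unfolding zonal_def by (intro chart_alg_rules)

lemma zonal_deriv:
  "d_theta zonal = (\<lambda>p. - 10 * zconst * cs p * sn p)" "d_phi zonal = (\<lambda>p. 0)"
  unfolding zonal_def by (simp_all add: d_theta_simps d_phi_simps chart_alg_rules algebra_simps)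

lemma lie_ufield:
  assumes "g \<in> chart_alg" "p \<in> chart"
  shows "lie ufield (sgrad g) p = (zonal p * (d_phi (d_phi g) p / sn p),
     - zonal p * (d_phi (d_theta g) p / sn p) - d_phi g p / sn p * (- 10 * zconst * cs p * sn p))"
  using assms unfolding lie_def dir_der_def sgrad_deriv_simps[OF assms]
  by (simp add: ufield_def zonal_deriv d_theta_simps d_phi_simps) (simp add: sgrad_def)

text \<open>The bracket is the field of \<open>zonal p * d_phi g p\<close>. Green's formula produces
  \<open>b\<close>, and moving \<open>d_phi\<close> from \<open>g\<close> to \<open>b\<close> gives
  the factor \<open>\<i> * of_int m\<close>. The witnesses condense both steps into a single
  pointwise identity.\<close>

lemma bil_lie_ufield:
  assumes a: "mode m a b" and g: "sphere_fun g"
  shows "bil (sgrad a) (lie ufield (sgrad g)) = chart_int (\<lambda>p. sn p * (\<i> * of_int m * zonal p * b p) * g p)"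
proof -
  note A = mode_alg[OF a] sphere_fun_chart_alg[OF g] zonal_alg
  obtain H where H: "H \<in> chart_alg" "\<And>p. \<i> * of_int m * a p = sn p * H p"
    "\<And>p. p \<in> chart \<Longrightarrow> d_phi H p = \<i> * of_int m * H p" using mode_div_sin[OF a] by blast
  let ?P = "\<lambda>p. - (\<i> * of_int m * sn p * zonal p * d_theta a p * g p)"
  let ?Q = "\<lambda>p. zonal p * H p * d_phi g p + sn p * zonal p * d_theta a p * d_theta g p
     + sn p * (- 10 * zconst * cs p * sn p) * d_theta a p * g p - \<i> * of_int m * zonal p * H p * g p"
  show ?thesis
    unfolding bil_def
  proof (rule chart_lint_by_parts[where P = ?P and Q = ?Q])
    fix p assume p: "p \<in> chart"
    have "(sn p)\<^sup>2 * d_theta (d_theta a) p + sn p * cs p * d_theta a p - (of_int m)\<^sup>2 * a p = (sn p)\<^sup>2 * b p"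
      using a p by (simp add: mode_def)
    moreover have "- (of_int m)\<^sup>2 * a p = \<i> * of_int m * (sn p * H p)"
      unfolding H(2)[symmetric] using i_squared by algebra
    ultimately have "sn p * (sn p * d_theta (d_theta a) p + cs p * d_theta a p + \<i> * of_int m * H p) = sn p * (sn p * b p)"
      by algebra
    then have L: "sn p * b p = sn p * d_theta (d_theta a) p + cs p * d_theta a p + \<i> * of_int m * H p"
      using sn_nonzero[OF p] by simp
    have L': "sn p * (\<i> * of_int m * zonal p * b p) * g p = \<i> * of_int m * zonal p * (sn p * b p) * g p" by (simp add: mult_ac)
    have "(fst (sgrad a p) * fst (lie ufield (sgrad g) p) + complex_of_real ((sin (fst p))\<^sup>2) * snd (sgrad a p) * snd (lie ufield (sgrad g) p)) * sn p
      = zonal p * H p * d_phi (d_phi g) p + sn p * zonal p * d_theta a p * d_phi (d_theta g) p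
        + sn p * (- 10 * zconst * cs p * sn p) * d_theta a p * d_phi g p"
      using sn_nonzero[OF p] unfolding lie_ufield[OF A(3) p] sgrad_def mode_d_phi[OF a] H(2)
      by (simp add: field_simps power2_eq_square)
    also have "\<dots> = sn p * (\<i> * of_int m * zonal p * b p) * g p + d_theta ?P p + d_phi ?Q p"
      unfolding L' L using A H p
      by (simp add: d_theta_simps d_phi_simps chart_alg_rules zonal_deriv mode_d_phi[OF a] algebra_simps)
    finally show "(fst (sgrad a p) * fst (lie ufield (sgrad g) p) + complex_of_real ((sin (fst p))\<^sup>2) * snd (sgrad a p) * snd (lie ufield (sgrad g) p)) * sn p = \<dots>" .
  qed (auto intro!: chart_alg_rules A H)
qed

lemma lie_sgrad_snd:
  assumes "a \<in> chart_alg" "g \<in> chart_alg" "p \<in> chart"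
  shows "snd (lie (sgrad a) (sgrad g) p) =
    d_phi a p / sn p * (- d_theta (d_theta g) p / sn p + d_theta g p * cs p / (sn p)\<^sup>2)
    + d_theta a p / sn p * (d_phi (d_theta g) p / sn p)
    - d_phi g p / sn p * (- d_theta (d_theta a) p / sn p + d_theta a p * cs p / (sn p)\<^sup>2)
    - d_theta g p / sn p * (d_phi (d_theta a) p / sn p)"
  unfolding lie_def dir_der_def sgrad_deriv_simps[OF assms(1,3)] sgrad_deriv_simps[OF assms(2,3)] snd_conv
  by (simp add: sgrad_def)

text \<open>Integration by parts leaves the colatitude derivative of the vorticity of
  \<open>ufield\<close>, which is \<open>2 * zonal p * cs p + sn p * d_theta zonal p\<close>. That
  derivative equals \<open>- 12 * sn p * zonal p\<close>, the source of the 12. In \<open>?P\<close>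
  the vorticity appears, spread over two summands, as the coefficient of
  \<open>a p * g p\<close>.\<close>

lemma bil_ufield_lie:
  assumes a: "mode m a b" and g: "sphere_fun g"
  shows "bil ufield (lie (sgrad a) (sgrad g)) = chart_int (\<lambda>p. sn p * (12 * \<i> * of_int m * zonal p * a p) * g p)"
proof -
  note A = mode_alg[OF a] sphere_fun_chart_alg[OF g] zonal_alg
  obtain H where H: "H \<in> chart_alg" "\<And>p. \<i> * of_int m * a p = sn p * H p"
    "\<And>p. p \<in> chart \<Longrightarrow> d_phi H p = \<i> * of_int m * H p" using mode_div_sin[OF a] by blast
  let ?i = "\<i> * of_int m"
  let ?P = "\<lambda>p. - (?i * zonal p * sn p * a p * d_theta g p) + (?i * a p) * (2 * zonal p * cs p) * g p
      + ?i * ((- 10 * zconst * cs p * sn p) * sn p * a p - zonal p * sn p * d_theta a p) * g p"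
  let ?Q = "\<lambda>p. zonal p * sn p * d_theta a p * d_theta g p + zonal p * (sn p * d_theta (d_theta a) p - cs p * d_theta a p) * g p"
  \<comment> \<open>The summand of \<open>?P\<close> with \<open>2 * zonal p * cs p\<close> has no
    factor \<open>sn p\<close>; it vanishes at the poles because
    \<open>\<i> * of_int m * a p\<close> does.\<close>
  have i0: "?i * a (x, y) = 0" if "sin x = 0" for x y using H(2)[of "(x, y)"] that by simp
  show ?thesis
    unfolding bil_def
  proof (rule chart_lint_by_parts[where P = ?P and Q = ?Q])
    fix p assume p: "p \<in> chart"
    have one: "sn p * sn p = 1 - cs p * cs p"
      using sin_cos_squared_add3[of "fst p"] by (metis add_diff_cancel_left' of_real_1 of_real_diff of_real_mult)
    have "(fst (ufield p) * fst (lie (sgrad a) (sgrad g) p) + complex_of_real ((sin (fst p))\<^sup>2) * snd (ufield p) * snd (lie (sgrad a) (sgrad g) p)) * sn p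
      = zonal p * (- ?i * sn p * a p * d_theta (d_theta g) p + ?i * cs p * a p * d_theta g p + sn p * d_theta a p * d_phi (d_theta g) p
        + d_phi g p * (sn p * d_theta (d_theta a) p - cs p * d_theta a p) - ?i * sn p * d_theta g p * d_theta a p)"
      using sn_nonzero[OF p] unfolding lie_sgrad_snd[OF A(1,3) p] mode_d_phi[OF a] ufield_def
      by (simp add: field_simps power2_eq_square)
    also have "\<dots> = sn p * (12 * \<i> * of_int m * zonal p * a p) * g p + d_theta ?P p + d_phi ?Q p"
    proof -
      have dP: "d_theta ?P p = - ?i * (zonal p * sn p * a p * d_theta (d_theta g) p + ((- 10 * zconst * cs p * sn p) * sn p * a p + zonal p * cs p * a p + zonal p * sn p * d_theta a p) * d_theta g p)
        + ?i * a p * (2 * zonal p * cs p) * d_theta g p + ?i * (d_theta a p * (2 * zonal p * cs p) + a p * 2 * ((- 10 * zconst * cs p * sn p) * cs p - zonal p * sn p)) * g p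
        + ?i * ((- 10 * zconst * cs p * sn p) * sn p * a p - zonal p * sn p * d_theta a p) * d_theta g p
        + ?i * (- 10 * zconst * (2 * sn p * cs p * cs p - sn p * sn p * sn p) * a p + (- 10 * zconst * cs p * sn p) * sn p * d_theta a p - (- 10 * zconst * cs p * sn p) * sn p * d_theta a p
           - zonal p * cs p * d_theta a p - zonal p * sn p * d_theta (d_theta a) p) * g p"
        using A by (simp add: d_theta_simps chart_alg_rules zonal_deriv algebra_simps)
      have dQ: "d_phi ?Q p = zonal p * sn p * (?i * d_theta a p * d_theta g p + d_theta a p * d_phi (d_theta g) p)
         + zonal p * (sn p * d_theta (d_theta a) p - cs p * d_theta a p) * (d_phi g p + ?i * g p)"
        using A by (simp add: d_phi_simps chart_alg_rules zonal_deriv mode_d_phi[OF a] algebra_simps)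
      show ?thesis
        unfolding dP dQ unfolding zonal_def using one by algebra
    qed
    finally show "(fst (ufield p) * fst (lie (sgrad a) (sgrad g) p) + complex_of_real ((sin (fst p))\<^sup>2) * snd (ufield p) * snd (lie (sgrad a) (sgrad g) p)) * sn p = \<dots>" .
  qed (insert i0[of 0] i0[of pi], auto intro!: chart_alg_rules A H simp del: mult_eq_0_iff)
qed

text \<open>The Poisson equation is not solved here: its solution \<open>h\<close> is supplied
  through the assumption, and later read off from the expansion in harmonics.\<close>

lemma Bop_ufield_sgrad:
  assumes a: "mode m a b" and h: "mode m h (\<lambda>p. - (12 * \<i> * of_int m * zonal p * a p))"
  shows "Bop ufield (sgrad a) = sgrad h"
proof (rule Bop_eqI)
  show "sgrad h \<in> SVect" using h by (auto simp: SVect_eq mode_def)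
  fix g assume g: "sphere_fun g"
  show "bil (sgrad h) (sgrad g) = bil ufield (lie (sgrad a) (sgrad g))"
    unfolding bil_sgrad[OF h g] bil_ufield_lie[OF a g] by simp
qed

lemma Bop_sgrad_ufield:
  assumes a: "mode m a b" and h: "mode m h (\<lambda>p. - (\<i> * of_int m * zonal p * b p))"
  shows "Bop (sgrad a) ufield = sgrad h"
proof (rule Bop_eqI)
  show "sgrad h \<in> SVect" using h by (auto simp: SVect_eq mode_def)
  fix g assume g: "sphere_fun g"
  show "bil (sgrad h) (sgrad g) = bil (sgrad a) (lie ufield (sgrad g))"
    unfolding bil_sgrad[OF h g] bil_lie_ufield[OF a g] by simp
qed

text \<open>\<open>ufield\<close> is itself a symplectic gradient on the chart, so its bracket with
  \<open>sgrad a\<close> is the symplectic gradient of a Poisson bracket, namely of the derivative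
  of \<open>a\<close> along \<open>ufield\<close>.\<close>

lemma lie_ufield_sgrad:
  assumes a: "mode m a b"
  shows "chart_eq (lie ufield (sgrad a)) (sgrad (\<lambda>p. \<i> * of_int m * zonal p * a p))"
  unfolding chart_eq_def
proof
  fix p assume p: "p \<in> chart"
  note A = mode_alg[OF a] zonal_alg
  show "lie ufield (sgrad a) p = sgrad (\<lambda>p. \<i> * of_int m * zonal p * a p) p"
    unfolding lie_ufield[OF A(1) p] mode_d_phi[OF a] using sn_nonzero[OF p] A
    by (simp add: sgrad_def d_theta_simps d_phi_simps chart_alg_rules zonal_deriv mode_d_phi[OF a] field_simps)
qed

lemma lie_swap: "lie Y X = vscale (-1) (lie X Y)"
  by (simp add: lie_def vscale_def fun_eq_iff)

section \<open>Associated Legendre polynomials\<close>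

text \<open>The order \<open>j\<close> of differentiation is kept free: a Legendre function of order
  \<open>m\<close> uses \<open>j = n + m\<close>, which lies below \<open>n\<close> when
  \<open>m\<close> is negative.\<close>

definition rodrigues :: "nat \<Rightarrow> nat \<Rightarrow> real poly" where
  "rodrigues n j = (pderiv ^^ j) ([:-1, 0, 1:] ^ n)"

lemma pderiv_rodrigues: "pderiv (rodrigues n j) = rodrigues n (Suc j)"
  by (simp add: rodrigues_def)

lemma pderiv_base_power:
  "pderiv ([:-1, 0, 1:] ^ Suc n) = smult (2 * real (Suc n)) ([:0, 1:] * [:-1, 0, 1:] ^ n :: real poly)"
  unfolding pderiv_power_Suc by (simp add: pderiv_pCons mult.commute)

lemma higher_pderiv_X_mult:
  fixes p :: "real poly"
  shows "(pderiv ^^ Suc i) ([:0, 1:] * p) = [:0, 1:] * (pderiv ^^ Suc i) p + smult (real (Suc i)) ((pderiv ^^ i) p)"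
proof (induction i)
  case 0
  show ?case by (simp add: pderiv_pCons)
next
  case (Suc i)
  have "(pderiv ^^ Suc (Suc i)) ([:0, 1:] * p) = pderiv ((pderiv ^^ Suc i) ([:0, 1:] * p))" by simp
  also have "\<dots> = [:0, 1:] * (pderiv ^^ Suc (Suc i)) p + smult (real (Suc (Suc i))) ((pderiv ^^ Suc i) p)"
    unfolding Suc by (rule poly_eq_poly_eq_iff[THEN iffD1])
      (simp add: fun_eq_iff pderiv_pCons pderiv_add pderiv_smult algebra_simps)
  finally show ?case .
qed

text \<open>One differentiation of the power leaves \<open>x\<close> times the next lower power; the
  rest is the Leibniz rule with a linear factor.\<close>

lemma poly_rodrigues_step:
  "poly (rodrigues (Suc n) (Suc (Suc i))) x =
     2 * real (Suc n) * (x * poly (rodrigues n (Suc i)) x + real (Suc i) * poly (rodrigues n i) x)"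
proof -
  have "rodrigues (Suc n) (Suc (Suc i)) = (pderiv ^^ Suc i) (pderiv ([:-1, 0, 1:] ^ Suc n))"
    unfolding rodrigues_def by (simp only: funpow_Suc_right o_apply)
  also have "\<dots> = smult (2 * real (Suc n)) ([:0, 1:] * rodrigues n (Suc i) + smult (real (Suc i)) (rodrigues n i))"
    unfolding pderiv_base_power higher_pderiv_smult higher_pderiv_X_mult rodrigues_def ..
  finally show ?thesis by simp
qed

text \<open>Two differentiations of the power produce a factor \<open>x^2\<close>; writing it as
  \<open>(x^2 - 1) + 1\<close> gives a combination of the next two lower powers.\<close>

lemma poly_rodrigues_step2:
  "poly (rodrigues (Suc (Suc n)) (Suc (Suc i))) x = 2 * (real n + 2) *
     ((2 * real n + 3) * poly (rodrigues (Suc n) i) x + 2 * (real n + 1) * poly (rodrigues n i) x)"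
proof -
  have "pderiv (pderiv ([:-1, 0, 1:] ^ Suc (Suc n))) = smult (2 * (real n + 2))
     (smult (2 * real n + 3) ([:-1, 0, 1:] ^ Suc n) + smult (2 * (real n + 1)) ([:-1, 0, 1:] ^ n))"
    unfolding pderiv_base_power[of "Suc n"] pderiv_smult pderiv_mult pderiv_base_power[of n]
    by (rule poly_eq_poly_eq_iff[THEN iffD1]) (simp add: fun_eq_iff pderiv_pCons algebra_simps)
  moreover have "rodrigues (Suc (Suc n)) (Suc (Suc i)) = (pderiv ^^ i) (pderiv (pderiv ([:-1, 0, 1:] ^ Suc (Suc n))))"
    unfolding rodrigues_def by (simp only: funpow_Suc_right o_apply)
  ultimately have "rodrigues (Suc (Suc n)) (Suc (Suc i)) = smult (2 * (real n + 2))
     (smult (2 * real n + 3) (rodrigues (Suc n) i) + smult (2 * (real n + 1)) (rodrigues n i))"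
    by (simp add: rodrigues_def higher_pderiv_smult higher_pderiv_add del: power_Suc)
  then show ?thesis by simp
qed

text \<open>The power \<open>w = (x^2 - 1)^n\<close> satisfies
  \<open>(x^2 - 1) w' = 2 n x w\<close>; the claim is the derivative of order \<open>j + 1\<close>
  of this relation.\<close>

lemma rodrigues_ode:
  "[:-1, 0, 1:] * rodrigues n (Suc (Suc j)) + smult (2 * (real j + 1 - real n)) ([:0, 1:] * rodrigues n (Suc j))
     + smult ((real j + 1) * (real j - 2 * real n)) (rodrigues n j) = 0"
proof (induction j)
  case 0
  have "[:-1, 0, 1:] * rodrigues n 1 = smult (2 * real n) ([:0, 1:] * rodrigues n 0)"
  proof (cases n)
    case 0
    then show ?thesis by (simp add: rodrigues_def pderiv_1)
  next
    case (Suc k)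
    have "rodrigues n 1 = pderiv ([:-1, 0, 1:] ^ Suc k)" by (simp add: rodrigues_def Suc)
    then show ?thesis
      unfolding pderiv_base_power by (simp add: Suc rodrigues_def algebra_simps)
  qed
  then have "pderiv ([:-1, 0, 1:] * rodrigues n 1) = pderiv (smult (2 * real n) ([:0, 1:] * rodrigues n 0))"
    by simp
  then have "poly (pderiv ([:-1, 0, 1:] * rodrigues n 1)) x = poly (pderiv (smult (2 * real n) ([:0, 1:] * rodrigues n 0))) x" for x
    by simp
  then show ?case
    by (intro poly_eq_poly_eq_iff[THEN iffD1])
      (simp add: fun_eq_iff pderiv_mult pderiv_smult pderiv_pCons pderiv_diff pderiv_add pderiv_rodrigues algebra_simps)
next
  case (Suc j)
  then have "poly (pderiv ([:-1, 0, 1:] * rodrigues n (Suc (Suc j)) + smult (2 * (real j + 1 - real n)) ([:0, 1:] * rodrigues n (Suc j))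
     + smult ((real j + 1) * (real j - 2 * real n)) (rodrigues n j))) x = poly 0 x" for x
    by simp
  then show ?case
    by (intro poly_eq_poly_eq_iff[THEN iffD1])
      (simp add: fun_eq_iff pderiv_mult pderiv_add pderiv_smult pderiv_pCons pderiv_diff pderiv_add pderiv_rodrigues algebra_simps)
qed

lemma poly_rodrigues_ode:
  "(x\<^sup>2 - 1) * poly (rodrigues n (Suc (Suc j))) x + 2 * (real j + 1 - real n) * x * poly (rodrigues n (Suc j)) x
     + (real j + 1) * (real j - 2 * real n) * poly (rodrigues n j) x = 0"
  using arg_cong[OF rodrigues_ode[of n j], of "\<lambda>p. poly p x"]
  by (simp add: algebra_simps power2_eq_square)

text \<open>Each differentiation lowers the multiplicity of the root 1 by at most one. This fixes
  the integration constant in \<open>rodrigues_reflect\<close>.\<close>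

lemma rodrigues_at_1:
  assumes "j < n" shows "poly (rodrigues n j) 1 = 0"
proof -
  have "[:-1, 0, 1:] ^ (n - j) dvd rodrigues n j" if "j \<le> n" using that
  proof (induction j)
    case 0
    then show ?case by (simp add: rodrigues_def)
  next
    case (Suc j)
    define a where "a = n - Suc j"
    have "[:-1, 0, 1:] ^ Suc a dvd rodrigues n j"
      using Suc by (simp add: a_def Suc_diff_Suc del: power_Suc)
    then obtain g where "rodrigues n j = [:-1, 0, 1:] ^ Suc a * g" by (auto elim: dvdE)
    then have "rodrigues n (Suc j) = [:-1, 0, 1:] ^ a * ([:-1, 0, 1:] * pderiv g + smult (2 * real (Suc a)) ([:0, 1:] * g))"
      unfolding pderiv_rodrigues[symmetric]
      by (simp only: pderiv_mult pderiv_base_power) (simp add: algebra_simps)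
    then show ?case unfolding a_def[symmetric] by (metis dvd_triv_left)
  qed
  then obtain g where "rodrigues n j = [:-1, 0, 1:] ^ (n - j) * g"
    using assms by (auto elim: dvdE)
  then show ?thesis using assms by simp
qed

text \<open>The relation between the Legendre functions of orders \<open>-k\<close> and
  \<open>k\<close>. In the induction step both sides have the same derivative, by the differential
  equation, and both vanish at 1. The value of the factor is left open, since a nonzero multiple of
  a harmonic gives the same curvature.\<close>

lemma rodrigues_reflect:
  assumes "k \<le> n"
  shows "\<exists>c\<noteq>0. rodrigues n (n - k) = smult c ([:-1, 0, 1:] ^ k * rodrigues n (n + k))"
  using assms
proof (induction k)
  case 0
  show ?case by (rule exI[of _ 1]) simp
next
  case (Suc k)
  then obtain c where c: "c \<noteq> 0" "rodrigues n (n - k) = smult c ([:-1, 0, 1:] ^ k * rodrigues n (n + k))"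
    by auto
  \<comment> \<open>The coefficient of the undifferentiated term in the equation at
    \<open>j = n + k\<close>, up to sign. It is nonzero for \<open>k < n\<close>, so that term can
    be expressed by the other two.\<close>
  define e where "e = (real n - real k) * (real n + real k + 1)"
  have e: "e \<noteq> 0" using Suc.prems by (simp add: e_def)
  define f where "f = smult (c / e) ([:-1, 0, 1:] ^ Suc k * rodrigues n (n + Suc k))"
  have ode: "[:-1, 0, 1:] * rodrigues n (Suc (Suc (n + k))) + smult (2 * (real k + 1)) ([:0, 1:] * rodrigues n (Suc (n + k)))
      = smult e (rodrigues n (n + k))"
  proof -
    have co: "2 * (real (n + k) + 1 - real n) = 2 * (real k + 1)"
      "(real (n + k) + 1) * (real (n + k) - 2 * real n) = - e" by (auto simp: e_def algebra_simps)
    show ?thesis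
      using rodrigues_ode[of n "n + k"] unfolding co smult_minus_left diff_conv_add_uminus[symmetric] right_minus_eq .
  qed
  have "pderiv f = smult (c / e) ([:-1, 0, 1:] ^ k * ([:-1, 0, 1:] * rodrigues n (Suc (Suc (n + k))) + smult (2 * (real k + 1)) ([:0, 1:] * rodrigues n (Suc (n + k)))))"
    unfolding f_def pderiv_smult pderiv_mult pderiv_base_power pderiv_rodrigues
    by (simp add: algebra_simps)
  also have "\<dots> = rodrigues n (n - k)"
    unfolding ode c(2) using e by simp
  also have "\<dots> = pderiv (rodrigues n (n - Suc k))"
    using Suc.prems by (simp add: pderiv_rodrigues Suc_diff_Suc)
  finally have "pderiv (rodrigues n (n - Suc k) - f) = 0" by (simp add: pderiv_diff)
  then have "degree (rodrigues n (n - Suc k) - f) = 0" by (simp add: pderiv_eq_0_iff)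
  then obtain d where d: "rodrigues n (n - Suc k) - f = [:d:]" by (metis degree_eq_zeroE)
  have "poly (rodrigues n (n - Suc k) - f) 1 = 0"
    using Suc.prems by (simp add: f_def rodrigues_at_1)
  then have "d = 0" unfolding d by simp
  then have "rodrigues n (n - Suc k) = f" using d by simp
  then show ?case using c e unfolding f_def by (intro exI[of _ "c / e"]) simp
qed

lemma rodrigues_nonzero: "j \<le> 2 * n \<Longrightarrow> rodrigues n j \<noteq> 0"
proof (induction j)
  case 0
  then show ?case by (simp add: rodrigues_def)
next
  case (Suc j)
  have "degree (rodrigues n j) = 2 * n - j"
    unfolding rodrigues_def degree_higher_pderiv by (simp add: degree_power_eq)
  then show ?case using Suc by (simp add: pderiv_eq_0_iff flip: pderiv_rodrigues)
qed

lemma higher_deriv_base: "(deriv ^^ j) (\<lambda>x. (x\<^sup>2 - 1) ^ n) = poly (rodrigues n j)"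
proof (induction j)
  case 0
  show ?case by (simp add: rodrigues_def fun_eq_iff power2_eq_square algebra_simps)
next
  case (Suc j)
  show ?case
    unfolding funpow.simps o_apply Suc pderiv_rodrigues[symmetric]
    by (intro ext DERIV_imp_deriv poly_DERIV)
qed

text \<open>The derivative of order \<open>k\<close> of the Legendre polynomial of degree
  \<open>n\<close>, that is the associated Legendre function without its factor
  \<open>(1 - x^2)^(k/2)\<close>. It is 0 for \<open>k > n\<close>, so the recurrence may pass
  through degrees below \<open>k\<close>.\<close>

definition leg :: "nat \<Rightarrow> nat \<Rightarrow> real poly" where
  "leg k n = smult (1 / (2 ^ n * fact n)) (rodrigues n (n + k))"

text \<open>\<open>R\<close>, the derivative of order \<open>n + k - 1\<close> of
  \<open>(x^2 - 1)^n\<close>, is foreign to the recurrence. The two expansions \<open>A\<close> and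
  \<open>B\<close> of the same derivative \<open>P2\<close> both contain it, and eliminating it
  gives the three-term relation.\<close>

lemma leg_rec:
  assumes "n \<ge> 1"
  shows "(2 * real n + 1) * (x * poly (leg k n) x) =
     (real n + 1 - real k) * poly (leg k (n + 1)) x + (real n + real k) * poly (leg k (n - 1)) x"
proof -
  obtain i where n: "n = Suc i" using assms not0_implies_Suc by force
  define N :: real where "N = 2 ^ i * fact i"
  define R where "R = poly (rodrigues (Suc i) (i + k)) x"
  have N: "N \<noteq> 0" by (simp add: N_def)
  have f: "2 ^ n * fact n = 2 * (real i + 1) * N" "2 ^ (n + 1) * fact (n + 1) = 4 * (real i + 1) * (real i + 2) * N"
    "2 ^ (n - 1) * fact (n - 1) = N"
    by (simp_all add: N_def n algebra_simps)
  define P0 P1 P2 where "P0 = poly (rodrigues i (i + k)) x" and "P1 = poly (rodrigues (Suc i) (Suc (i + k))) x"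
    and "P2 = poly (rodrigues (Suc (Suc i)) (Suc (Suc (i + k)))) x"
  have A: "P2 = 2 * (real i + 2) * ((2 * real i + 3) * R + 2 * (real i + 1) * P0)"
    unfolding P2_def R_def P0_def by (rule poly_rodrigues_step2)
  have B: "P2 = 2 * (real i + 2) * (x * P1 + (real i + real k + 1) * R)"
    unfolding P2_def R_def P1_def poly_rodrigues_step by (simp add: algebra_simps)
  have C: "x * P1 + (real i + real k + 1) * R = (2 * real i + 3) * R + 2 * (real i + 1) * P0"
    using A B by (simp add: add_eq_0_iff)
  have eq: "(2 * real i + 3) * (x * P1) * (2 * (real i + 2)) = (real i + 2 - real k) * P2 + (real i + 1 + real k) * P0 * (4 * (real i + 1) * (real i + 2))"
    using A C by algebra
  have p: "poly (leg k n) x = P1 / (2 * (real i + 1) * N)"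
    "poly (leg k (n + 1)) x = P2 / (4 * (real i + 1) * (real i + 2) * N)" "poly (leg k (n - 1)) x = P0 / N"
    unfolding leg_def poly_smult f by (simp_all add: n P0_def P1_def P2_def)
  have "(2 * real n + 1) * (x * poly (leg k n) x) = (2 * real i + 3) * (x * P1) * (2 * (real i + 2)) / (4 * (real i + 1) * (real i + 2) * N)"
    unfolding p using N by (simp add: n divide_simps) (simp add: algebra_simps)
  also have "\<dots> = (real i + 2 - real k) * (P2 / (4 * (real i + 1) * (real i + 2) * N)) + (real i + 1 + real k) * (P0 / N)"
    unfolding eq add_divide_distrib using N by (simp add: divide_simps)
  finally show ?thesis unfolding p by (simp add: n add_ac)
qed

lemma leg_ode:
  "(1 - x\<^sup>2) * poly (pderiv (pderiv (leg k n))) x - 2 * (real k + 1) * x * poly (pderiv (leg k n)) x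
     + (real n * (real n + 1) - real k * (real k + 1)) * poly (leg k n) x = 0"
proof -
  define c where "c = 1 / (2 ^ n * fact n :: real)"
  have "c * ((x\<^sup>2 - 1) * poly (rodrigues n (Suc (Suc (n + k)))) x + 2 * (real (n + k) + 1 - real n) * x * poly (rodrigues n (Suc (n + k))) x
     + (real (n + k) + 1) * (real (n + k) - 2 * real n) * poly (rodrigues n (n + k)) x) = 0"
    unfolding poly_rodrigues_ode by simp
  then show ?thesis
    unfolding leg_def c_def[symmetric] pderiv_smult pderiv_rodrigues poly_smult of_nat_add by algebra
qed

lemma leg_nonzero: "k \<le> n \<Longrightarrow> leg k n \<noteq> 0"
  by (simp add: leg_def rodrigues_nonzero)

section \<open>Spherical harmonics\<close>

definition harm_fun :: "int \<Rightarrow> real poly \<Rightarrow> real \<times> real \<Rightarrow> complex" where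
  "harm_fun m q p = exp (\<i> * of_int m * of_real (snd p)) * (sn p ^ nat \<bar>m\<bar> * of_real (poly q (cos (fst p))))"

lemma sphere_fun_poly_cos: "sphere_fun (\<lambda>p. of_real (poly q (cos (fst p))))"
  by (induction q) (auto intro!: sphere_fun_const sphere_fun_add sphere_fun_mult sphere_fun_cos)

text \<open>The issue is smoothness at the poles. The product of the sine with
  \<open>exp (\<i> * \<phi>)\<close> or \<open>exp (- \<i> * \<phi>)\<close> is the restriction of
  the linear function \<open>x + \<i> * y\<close> or \<open>x - \<i> * y\<close>, so the function is
  a polynomial in the ambient coordinates. The sign is that of \<open>m\<close>.\<close>

lemma sphere_fun_harm_fun: "sphere_fun (harm_fun m q)"
proof -
  define e :: real where "e = of_int (sgn m)"
  let ?L = "\<lambda>x::real \<times> real \<times> real. complex_of_real (fst x) + (\<i> * of_real e) * of_real (fst (snd x))"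
  have "smoothC ?L"
    by (intro smoothC_add smoothC_mult smoothC_const smoothC_bounded_linear
        bounded_linear_compose[OF bounded_linear_of_real] bounded_linear_fst
        bounded_linear_compose[OF bounded_linear_fst] bounded_linear_snd)
  then have L: "sphere_fun (\<lambda>p. ?L (sph p))"
    unfolding sphere_fun_def by blast
  have "?L (sph p) ^ nat \<bar>m\<bar> = exp (\<i> * of_int m * of_real (snd p)) * sn p ^ nat \<bar>m\<bar>" for p
  proof (cases "m = 0")
    case False
    then have e: "e = 1 \<or> e = -1" by (auto simp: e_def sgn_if)
    then have "?L (sph p) = sn p * exp (\<i> * of_real (e * snd p))"
      unfolding exp_Euler by (auto simp: sph_def algebra_simps cos_of_real sin_of_real)
    moreover have "exp (\<i> * of_real (e * snd p)) ^ nat \<bar>m\<bar> = exp (\<i> * of_int m * of_real (snd p))"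
    proof -
      have "of_nat (nat \<bar>m\<bar>) * e = of_int m"
        using False by (auto simp: e_def sgn_if)
      then have "complex_of_nat (nat \<bar>m\<bar>) * of_real e = of_int m"
        by (metis of_real_mult of_real_of_int_eq of_real_of_nat_eq)
      then have "complex_of_nat (nat \<bar>m\<bar>) * (\<i> * of_real (e * snd p)) = \<i> * of_int m * of_real (snd p)"
        by (metis (no_types, lifting) mult.assoc mult.left_commute of_real_mult)
      then show ?thesis unfolding exp_of_nat_mult[symmetric] by (rule arg_cong)
    qed
    ultimately show ?thesis by (simp add: power_mult_distrib)
  qed simp
  then have "harm_fun m q = (\<lambda>p. ?L (sph p) ^ nat \<bar>m\<bar> * of_real (poly q (cos (fst p))))"
    by (simp add: harm_fun_def fun_eq_iff)
  then show ?thesis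
    by (simp only:) (intro sphere_fun_mult sphere_fun_power L sphere_fun_poly_cos)
qed

lemma harm_fun_alg: "harm_fun m q \<in> chart_alg"
  by (rule sphere_fun_chart_alg[OF sphere_fun_harm_fun])

lemma equivariant_harm_fun: "equivariant m (harm_fun m q)"
  by (simp add: equivariant_def harm_fun_def)

lemma d_theta_harm_fun:
  assumes "p \<in> chart"
  shows "d_theta (harm_fun m q) p = of_nat (nat \<bar>m\<bar>) * cs p * harm_fun m q p / sn p - sn p * harm_fun m (pderiv q) p"
proof -
  obtain a b where p: "p = (a, b)" by fastforce
  define k where "k = nat \<bar>m\<bar>"
  have s: "sin a \<noteq> 0" using sn_nonzero[OF assms] p by simp
  have "((\<lambda>t. sin t ^ k * poly q (cos t)) has_real_derivative
     real k * cos a * (sin a ^ k * poly q (cos a)) / sin a - sin a * (sin a ^ k * poly (pderiv q) (cos a))) (at a)"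
  proof -
    have "((\<lambda>t. sin t ^ k) has_real_derivative real k * cos a * sin a ^ k / sin a) (at a)"
      using DERIV_power[OF DERIV_sin, of k a] s by (cases k) auto
    from DERIV_mult[OF this DERIV_chain2[OF poly_DERIV[of q] DERIV_cos]] show ?thesis
      by (simp add: algebra_simps)
  qed
  then have "((\<lambda>t. exp (\<i> * of_int m * of_real b) * complex_of_real (sin t ^ k * poly q (cos t))) has_vector_derivative
     exp (\<i> * of_int m * of_real b) * complex_of_real (real k * cos a * (sin a ^ k * poly q (cos a)) / sin a - sin a * (sin a ^ k * poly (pderiv q) (cos a)))) (at a)"
    by (intro has_vector_derivative_mult_right has_vector_derivative_of_real)
  from vector_derivative_at[OF this] show ?thesis
    by (simp add: p d_theta_def harm_fun_def algebra_simps flip: k_def)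
qed

text \<open>The assumption is the associated Legendre equation after splitting off the power of the
  sine. It is stated for a general polynomial because it serves both \<open>leg\<close> and the
  stream function of \<open>ufield\<close>.\<close>

lemma mode_harm_fun:
  assumes ode: "\<And>x. (1 - x\<^sup>2) * poly (pderiv (pderiv q)) x - 2 * (real (nat \<bar>m\<bar>) + 1) * x * poly (pderiv q) x
     + (L - real (nat \<bar>m\<bar>) * (real (nat \<bar>m\<bar>) + 1)) * poly q x = 0"
  shows "mode m (harm_fun m q) (\<lambda>p. of_real (- L) * harm_fun m q p)"
  unfolding mode_def
proof (intro conjI ballI)
  fix p assume p: "p \<in> chart"
  let ?k = "of_nat (nat \<bar>m\<bar>) :: complex"
  have s: "sn p \<noteq> 0" by (rule sn_nonzero[OF p])
  have one: "sn p * sn p = 1 - cs p * cs p"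
    using sin_cos_squared_add3[of "fst p"] by (metis add_diff_cancel_left' of_real_1 of_real_diff of_real_mult)
  have k2: "(of_int m)\<^sup>2 = ?k\<^sup>2"
  proof -
    have "of_nat (nat \<bar>m\<bar>) = (of_int \<bar>m\<bar> :: complex)" by simp
    then show ?thesis by (simp add: abs_if)
  qed
  have "chart_eq (d_theta (harm_fun m q)) (\<lambda>p. ?k * cs p * harm_fun m q p / sn p - sn p * harm_fun m (pderiv q) p)"
    by (simp add: chart_eq_def d_theta_harm_fun)
  then have "d_theta (d_theta (harm_fun m q)) p = d_theta (\<lambda>p. ?k * cs p * harm_fun m q p / sn p - sn p * harm_fun m (pderiv q) p) p"
    using p by (rule d_theta_chart_cong)
  also have "\<dots> = d_theta (\<lambda>p. (?k * cs p * harm_fun m q p - sn p * (sn p * harm_fun m (pderiv q) p)) / sn p) p"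
    by (rule d_theta_chart_cong[OF _ p]) (auto simp: chart_eq_def diff_divide_distrib dest: sn_nonzero)
  also have "\<dots> = (- ?k * sn p * harm_fun m q p + ?k * cs p * d_theta (harm_fun m q) p - 2 * sn p * cs p * harm_fun m (pderiv q) p
      - sn p * sn p * d_theta (harm_fun m (pderiv q)) p) / sn p
      - (?k * cs p * harm_fun m q p - sn p * (sn p * harm_fun m (pderiv q) p)) * cs p / (sn p)\<^sup>2"
    by (subst d_theta_div_sin[OF _ p])
      (simp_all add: chart_alg_rules harm_fun_alg d_theta_simps algebra_simps)
  finally have dd: "d_theta (d_theta (harm_fun m q)) p = \<dots>" .
  define z0 z1 z2 where "z0 = harm_fun m q p" and "z1 = harm_fun m (pderiv q) p" and "z2 = harm_fun m (pderiv (pderiv q)) p"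
  have ode': "(1 - cs p * cs p) * z2 - 2 * (?k + 1) * cs p * z1 + (of_real L - ?k * (?k + 1)) * z0 = 0"
  proof -
    define E where "E = exp (\<i> * of_int m * of_real (snd p)) * sn p ^ nat \<bar>m\<bar>"
    have harm_fun: "harm_fun m r p = E * of_real (poly r (cos (fst p)))" for r by (simp add: harm_fun_def E_def)
    have "E * of_real ((1 - (cos (fst p))\<^sup>2) * poly (pderiv (pderiv q)) (cos (fst p)) - 2 * (real (nat \<bar>m\<bar>) + 1) * cos (fst p) * poly (pderiv q) (cos (fst p))
     + (L - real (nat \<bar>m\<bar>) * (real (nat \<bar>m\<bar>) + 1)) * poly q (cos (fst p))) = 0"
      unfolding ode by simp
    then show ?thesis
      unfolding z0_def z1_def z2_def harm_fun of_real_add of_real_diff of_real_mult of_real_power of_real_1 of_real_of_nat_eq of_real_numeral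
      by algebra
  qed
  have "(sn p)\<^sup>2 * d_theta (d_theta (harm_fun m q)) p + sn p * cs p * d_theta (harm_fun m q) p - ?k\<^sup>2 * harm_fun m q p
     = (sn p)\<^sup>2 * (- ?k * (?k + 1) * z0 - 2 * (?k + 1) * cs p * z1 + sn p * sn p * z2)"
  proof -
    have "(sn p)\<^sup>2 * d_theta (d_theta (harm_fun m q)) p = sn p * (- ?k * sn p * z0 - 2 * sn p * cs p * z1) + ?k * cs p * (?k * cs p * z0 - sn p * sn p * z1)
       - sn p * sn p * (?k * cs p * z1 - sn p * sn p * z2) - (?k * cs p * z0 - sn p * (sn p * z1)) * cs p"
      unfolding dd d_theta_harm_fun[OF p] z0_def[symmetric] z1_def[symmetric] z2_def[symmetric]
      using s by (simp add: field_simps power2_eq_square)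
    moreover have "sn p * cs p * d_theta (harm_fun m q) p = cs p * (?k * cs p * z0 - sn p * sn p * z1)"
      unfolding d_theta_harm_fun[OF p] z0_def[symmetric] z1_def[symmetric] using s by (simp add: field_simps)
    ultimately show ?thesis
      unfolding z0_def[symmetric] using one by algebra
  qed
  also have "\<dots> = (sn p)\<^sup>2 * (of_real (- L) * harm_fun m q p)"
    unfolding z0_def[symmetric] of_real_minus using ode' one by algebra
  finally show "(sn p)\<^sup>2 * d_theta (d_theta (harm_fun m q)) p + sn p * cs p * d_theta (harm_fun m q) p - (of_int m)\<^sup>2 * harm_fun m q p
     = (sn p)\<^sup>2 * (of_real (- L) * harm_fun m q p)" unfolding k2 .
qed (intro sphere_fun_harm_fun equivariant_harm_fun chart_alg_rules harm_fun_alg)+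

definition sph_harm :: "int \<Rightarrow> nat \<Rightarrow> real \<times> real \<Rightarrow> complex" where
  "sph_harm m n = harm_fun m (leg (nat \<bar>m\<bar>) n)"

definition eigval :: "nat \<Rightarrow> real" where
  "eigval n = real n * (real n + 1)"

lemma mode_sph_harm: "mode m (sph_harm m n) (\<lambda>p. of_real (- eigval n) * sph_harm m n p)"
  unfolding sph_harm_def eigval_def by (rule mode_harm_fun, rule leg_ode)

lemma mode_cnj:
  assumes "mode m a b"
  shows "mode (- m) (\<lambda>p. cnj (a p)) (\<lambda>p. cnj (b p))"
proof -
  note A = mode_alg[OF assms]
  have "equivariant (- m) (\<lambda>p. cnj (a p))"
    unfolding equivariant_def
  proof (intro allI)
    fix x y
    have "a (x, y) = exp (\<i> * of_int m * of_real y) * a (x, 0)"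
      using assms unfolding mode_def equivariant_def by blast
    from arg_cong[OF this, of cnj]
    show "cnj (a (x, y)) = exp (\<i> * of_int (- m) * of_real y) * cnj (a (x, 0))"
      by (simp add: exp_cnj)
  qed
  moreover have "(sn p)\<^sup>2 * cnj (d_theta (d_theta a) p) + sn p * cs p * cnj (d_theta a p) - (of_int m)\<^sup>2 * cnj (a p)
        = (sn p)\<^sup>2 * cnj (b p)" if "p \<in> chart" for p
  proof -
    have "(sn p)\<^sup>2 * d_theta (d_theta a) p + sn p * cs p * d_theta a p - (of_int m)\<^sup>2 * a p = (sn p)\<^sup>2 * b p"
      using assms that by (simp add: mode_def)
    from arg_cong[OF this, of cnj] show ?thesis by simp
  qed
  ultimately show ?thesis
    using assms A by (simp add: mode_def sphere_fun_cnj chart_alg_cnj cnj_d_theta chart_alg_rules)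
qed

lemma bil_commute: "bil X Y = bil Y X"
  unfolding bil_def by (simp add: mult_ac)

lemma herm_sgrad_eigen:
  assumes a: "mode m a (\<lambda>p. of_real (- L) * a p)" and g: "sphere_fun g"
  shows "herm (sgrad g) (sgrad a) = of_real L * chart_int (\<lambda>p. sn p * g p * cnj (a p))"
proof -
  have "herm (sgrad g) (sgrad a) = bil (sgrad (\<lambda>p. cnj (a p))) (sgrad g)"
    unfolding herm_sgrad[OF mode_alg(1)[OF a]] by (rule bil_commute)
  also have "\<dots> = chart_int (\<lambda>p. of_real L * (sn p * g p * cnj (a p)))"
    unfolding bil_sgrad[OF mode_cnj[OF a] g] by (simp add: mult_ac)
  finally show ?thesis by (simp only: chart_int_cmult)
qed

text \<open>Green's formula, applied to one factor or to the other, gives the same product once with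
  the factor \<open>L\<close> and once with \<open>L'\<close>.\<close>

lemma eigen_orthogonal:
  assumes a: "mode m a (\<lambda>p. of_real (- L) * a p)" and b: "mode m' b (\<lambda>p. of_real (- L') * b p)" and "L \<noteq> L'"
  shows "chart_int (\<lambda>p. sn p * a p * cnj (b p)) = 0"
proof -
  have sa: "sphere_fun a" and sb: "sphere_fun b" using a b by (auto simp: mode_def)
  have "herm (sgrad a) (sgrad b) = of_real L' * chart_int (\<lambda>p. sn p * a p * cnj (b p))"
    by (rule herm_sgrad_eigen[OF b sa])
  moreover have "herm (sgrad a) (sgrad b) = chart_int (\<lambda>p. of_real L * (sn p * a p * cnj (b p)))"
    unfolding herm_sgrad[OF mode_alg(1)[OF b]] bil_sgrad[OF a sphere_fun_cnj[OF sb]] by (simp add: mult_ac)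
  ultimately have "(of_real L - of_real L') * chart_int (\<lambda>p. sn p * a p * cnj (b p)) = 0"
    by (simp add: chart_int_cmult algebra_simps)
  then show ?thesis using \<open>L \<noteq> L'\<close> by simp
qed

text \<open>Otherwise the nonzero polynomial \<open>leg\<close> would vanish at the cosines of all
  angles between 0 and pi. The norm itself cancels in the curvature, so knowing that it is nonzero
  is enough.\<close>

lemma sph_harm_norm_pos:
  assumes "nat \<bar>m\<bar> \<le> n"
  shows "chart_int (\<lambda>p. sn p * sph_harm m n p * cnj (sph_harm m n p)) \<noteq> 0"
proof
  let ?F = "\<lambda>p. sn p * sph_harm m n p * cnj (sph_harm m n p)"
  assume 0: "chart_int ?F = 0"
  have F: "?F \<in> chart_alg"
    unfolding sph_harm_def by (intro chart_alg_rules chart_alg_cnj harm_fun_alg)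
  have F0: "?F p = 0" if "p \<in> chart" for p
  proof (rule chart_int_nonneg_eq_0[OF F _ _ 0 that])
    show "?F p = of_real (sin (fst p) * (cmod (sph_harm m n p))\<^sup>2)" for p
      by (simp add: complex_norm_square mult.assoc del: of_real_power)
    show "0 \<le> sin (fst p) * (cmod (sph_harm m n p))\<^sup>2" if "p \<in> chart" for p
      using that sin_gt_zero[of "fst p"] by (auto simp: chart_def)
  qed
  have "poly (leg (nat \<bar>m\<bar>) n) (cos t) = 0" if "0 < t" "t < pi" for t
  proof -
    have c: "(t, pi) \<in> chart" using that by (simp add: chart_def)
    have "sph_harm m n (t, pi) = 0" using F0[OF c] sn_nonzero[OF c] by simp
    then show ?thesis using sn_nonzero[OF c] by (simp add: sph_harm_def harm_fun_def)
  qed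
  then have "cos ` {0<..<pi} \<subseteq> {x. poly (leg (nat \<bar>m\<bar>) n) x = 0}" by auto
  then have "finite (cos ` {0<..<pi})"
    using poly_roots_finite[OF leg_nonzero[OF assms]] finite_subset by blast
  moreover have "inj_on cos {0<..<pi}"
    by (rule inj_onI) (rule cos_inj_pi, auto)
  ultimately have "finite {0<..<pi}" using finite_imageD by blast
  then show False using infinite_Ioo[OF pi_gt_zero] by simp
qed

text \<open>These coefficients belong to unnormalised harmonics, so the matrix is not symmetric. A
  diagonal entry of a product contains only closed paths, where each step up is matched by a step
  down, and such products do not depend on the normalisation.\<close>

definition rec_up :: "nat \<Rightarrow> nat \<Rightarrow> real" where
  "rec_up k n = (real n + 1 - real k) / (2 * real n + 1)"

definition rec_down :: "nat \<Rightarrow> nat \<Rightarrow> real" where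
  "rec_down k n = (real n + real k) / (2 * real n + 1)"

lemma sph_harm_rec:
  assumes "n \<ge> 1"
  shows "cs p * sph_harm m n p = of_real (rec_up (nat \<bar>m\<bar>) n) * sph_harm m (n + 1) p + of_real (rec_down (nat \<bar>m\<bar>) n) * sph_harm m (n - 1) p"
proof -
  let ?k = "nat \<bar>m\<bar>" and ?x = "cos (fst p)"
  have nz: "2 * real n + 1 \<noteq> 0" using of_nat_0_le_iff[of n] by linarith
  have "(2 * real n + 1) * rec_up ?k n = real n + 1 - real ?k" "(2 * real n + 1) * rec_down ?k n = real n + real ?k"
    using nz by (simp_all add: rec_up_def rec_down_def)
  then have "(2 * real n + 1) * (?x * poly (leg ?k n) ?x) = (2 * real n + 1) * (rec_up ?k n * poly (leg ?k (n + 1)) ?x + rec_down ?k n * poly (leg ?k (n - 1)) ?x)"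
    unfolding leg_rec[OF assms] by algebra
  then have "?x * poly (leg ?k n) ?x = rec_up ?k n * poly (leg ?k (n + 1)) ?x + rec_down ?k n * poly (leg ?k (n - 1)) ?x"
    using nz by (simp only: mult_cancel_left) simp
  from arg_cong[OF this, of complex_of_real]
  have "E * (cs p * of_real (poly (leg ?k n) ?x)) = E * (of_real (rec_up ?k n) * of_real (poly (leg ?k (n + 1)) ?x)
     + of_real (rec_down ?k n) * of_real (poly (leg ?k (n - 1)) ?x))" for E by simp
  from this[of "exp (\<i> * of_int m * of_real (snd p)) * sn p ^ ?k"] show ?thesis
    unfolding sph_harm_def harm_fun_def by (simp add: algebra_simps)
qed

definition zon_up :: "nat \<Rightarrow> nat \<Rightarrow> real" where "zon_up k n = 5 * (rec_up k n * rec_up k (n + 1))"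
definition zon_diag :: "nat \<Rightarrow> nat \<Rightarrow> real" where "zon_diag k n = 5 * (rec_up k n * rec_down k (n + 1) + rec_down k n * rec_up k (n - 1)) - 1"
definition zon_down :: "nat \<Rightarrow> nat \<Rightarrow> real" where "zon_down k n = 5 * (rec_down k n * rec_down k (n - 1))"

lemma zonal_sph_harm:
  assumes "n \<ge> 2"
  shows "zonal p * sph_harm m n p = zconst * (of_real (zon_up (nat \<bar>m\<bar>) n) * sph_harm m (n + 2) p
     + of_real (zon_diag (nat \<bar>m\<bar>) n) * sph_harm m n p + of_real (zon_down (nat \<bar>m\<bar>) n) * sph_harm m (n - 2) p)"
proof -
  have n: "n \<ge> 1" "n + 1 \<ge> 1" "n - 1 \<ge> 1" "n - 1 + 1 = n" "n - 1 - 1 = n - 2" "n + 1 + 1 = n + 2" "n + 1 - 1 = n" using assms by auto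
  note r = sph_harm_rec[OF n(1), of p m] sph_harm_rec[OF n(2), of p m] sph_harm_rec[OF n(3), of p m]
  show ?thesis
    unfolding zonal_def zon_up_def zon_diag_def zon_down_def of_real_add of_real_diff of_real_mult of_real_1 of_real_numeral
    using r unfolding n by algebra
qed

section \<open>The curvature coefficient\<close>

text \<open>The stream functions \<open>h1\<close> and \<open>h2\<close> generate the fields \<open>B(u, w)\<close> and \<open>B(w, u)\<close> for
  the field \<open>w\<close> generated by \<open>a\<close> and the zonal field \<open>u\<close>.\<close>
definition response :: "int \<Rightarrow> (real \<times> real \<Rightarrow> complex) \<Rightarrow> (real \<times> real \<Rightarrow> complex) \<Rightarrow>
    (real \<times> real \<Rightarrow> complex) \<Rightarrow> (real \<times> real \<Rightarrow> complex) \<Rightarrow> bool" where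
  "response m a b h1 h2 \<longleftrightarrow> mode m a b \<and> mode m h1 (\<lambda>p. - (12 * \<i> * of_int m * zonal p * a p))
     \<and> mode m h2 (\<lambda>p. - (\<i> * of_int m * zonal p * b p))"

lemma response_add:
  assumes "response m a b h1 h2" "response m a' b' h1' h2'"
  shows "response m (\<lambda>p. a p + a' p) (\<lambda>p. b p + b' p) (\<lambda>p. h1 p + h1' p) (\<lambda>p. h2 p + h2' p)"
proof -
  have *: "(\<lambda>p. - (12 * \<i> * of_int m * zonal p * (a p + a' p))) =
      (\<lambda>p. - (12 * \<i> * of_int m * zonal p * a p) + - (12 * \<i> * of_int m * zonal p * a' p))"
    "(\<lambda>p. - (\<i> * of_int m * zonal p * (b p + b' p))) =
      (\<lambda>p. - (\<i> * of_int m * zonal p * b p) + - (\<i> * of_int m * zonal p * b' p))"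
    by (auto simp: algebra_simps)
  show ?thesis
    using assms unfolding response_def * by (elim conjE) (intro conjI mode_add; assumption)
qed

lemma response_cmult:
  assumes "response m a b h1 h2"
  shows "response m (\<lambda>p. c * a p) (\<lambda>p. c * b p) (\<lambda>p. c * h1 p) (\<lambda>p. c * h2 p)"
proof -
  have *: "(\<lambda>p. - (12 * \<i> * of_int m * zonal p * (c * a p))) = (\<lambda>p. c * - (12 * \<i> * of_int m * zonal p * a p))"
    "(\<lambda>p. - (\<i> * of_int m * zonal p * (c * b p))) = (\<lambda>p. c * - (\<i> * of_int m * zonal p * b p))"
    by (auto simp: algebra_simps)
  show ?thesis
    using assms unfolding response_def * by (elim conjE) (intro conjI mode_cmult; assumption)
qed

lemma sgrad_combine:
  assumes "F \<in> chart_alg" "G \<in> chart_alg" "H \<in> chart_alg"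
  shows "vscale (1/2) (vsub (vsub (sgrad F) (sgrad G)) (sgrad H)) = sgrad (\<lambda>p. (1/2) * (F p + - G p + - H p))"
proof -
  have "sgrad (\<lambda>p. - K p) = vscale (-1) (sgrad K)" if "K \<in> chart_alg" for K
    using sgrad_cmult[OF that, of "-1"] by simp
  then show ?thesis
    using assms by (simp only: sgrad_add sgrad_cmult chart_alg_rules vsub_def)
qed

lemma nabla_ufield_sgrad:
  assumes "response m a b h1 h2"
  shows "chart_eq (nabla ufield (sgrad a)) (sgrad (\<lambda>p. (1/2) * (\<i> * of_int m * zonal p * a p + - h1 p + - h2 p)))"
    and "chart_eq (nabla (sgrad a) ufield) (sgrad (\<lambda>p. (1/2) * (- (\<i> * of_int m * zonal p * a p) + - h1 p + - h2 p)))"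
proof -
  have m: "mode m a b" "mode m h1 (\<lambda>p. - (12 * \<i> * of_int m * zonal p * a p))" "mode m h2 (\<lambda>p. - (\<i> * of_int m * zonal p * b p))"
    using assms by (auto simp: response_def)
  note A = m[THEN mode_alg(1)] zonal_alg
  let ?T = "\<lambda>p. \<i> * of_int m * zonal p * a p"
  have T: "?T \<in> chart_alg" by (intro chart_alg_rules A)
  have B: "Bop ufield (sgrad a) = sgrad h1" "Bop (sgrad a) ufield = sgrad h2"
    by (rule Bop_ufield_sgrad[OF m(1,2)], rule Bop_sgrad_ufield[OF m(1,3)])
  have l: "chart_eq (lie ufield (sgrad a)) (sgrad ?T)" by (rule lie_ufield_sgrad[OF m(1)])
  have "chart_eq (nabla ufield (sgrad a)) (vscale (1/2) (vsub (vsub (sgrad ?T) (sgrad h1)) (sgrad h2)))"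
    unfolding nabla_def B by (intro vscale_chart_cong vsub_chart_cong l chart_eq_refl)
  then show "chart_eq (nabla ufield (sgrad a)) (sgrad (\<lambda>p. (1/2) * (?T p + - h1 p + - h2 p)))"
    unfolding sgrad_combine[OF T A(2,3)] .
  have "vscale (-1) (sgrad ?T) = sgrad (\<lambda>p. - ?T p)"
    using sgrad_cmult[OF T, of "-1"] by simp
  then have l': "chart_eq (lie (sgrad a) ufield) (sgrad (\<lambda>p. - ?T p))"
    using vscale_chart_cong[OF l, of "-1"] by (metis lie_swap)
  have "chart_eq (nabla (sgrad a) ufield) (vscale (1/2) (vsub (vsub (sgrad (\<lambda>p. - ?T p)) (sgrad h2)) (sgrad h1)))"
    unfolding nabla_def B by (intro vscale_chart_cong vsub_chart_cong l' chart_eq_refl)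
  also have "vscale (1/2) (vsub (vsub (sgrad (\<lambda>p. - ?T p)) (sgrad h2)) (sgrad h1)) = sgrad (\<lambda>p. (1/2) * (- ?T p + - h2 p + - h1 p))"
    by (rule sgrad_combine[OF chart_alg_uminus[OF T] A(3,2)])
  finally show "chart_eq (nabla (sgrad a) ufield) (sgrad (\<lambda>p. (1/2) * (- ?T p + - h1 p + - h2 p)))"
    by (simp add: algebra_simps)
qed

section \<open>The steady zonal flow\<close>

lemma zero_SVect: "(\<lambda>p. (0, 0)) \<in> SVect"
  unfolding SVect_eq mem_Collect_eq using sgrad_const[of 0] sphere_fun_const[of 0] by metis

lemma vadd_zero: "vadd X (\<lambda>p. (0, 0)) = X"
  by (simp add: vadd_def fun_eq_iff)

lemma bil_zero: "bil (\<lambda>p. (0, 0)) Y = 0" "bil Y (\<lambda>p. (0, 0)) = 0"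
  by (simp_all add: bil_def)

lemma lie_zero: "lie (\<lambda>p. (0, 0)) Y = (\<lambda>p. (0, 0))" "lie Y (\<lambda>p. (0, 0)) = (\<lambda>p. (0, 0))"
  by (simp_all add: lie_def dir_der_def d_theta_simps d_phi_simps fun_eq_iff)

lemma nabla_zero: "nabla Y (\<lambda>p. (0, 0)) = (\<lambda>p. (0, 0))"
proof -
  have "Bop Y (\<lambda>p. (0, 0)) = (\<lambda>p. (0, 0))" "Bop (\<lambda>p. (0, 0)) Y = (\<lambda>p. (0, 0))"
    by (rule Bop_eqI; simp add: zero_SVect bil_zero lie_zero)+
  then show ?thesis
    by (simp add: nabla_def lie_zero vscale_def vsub_def vadd_def fun_eq_iff)
qed

text \<open>Since \<open>ufield\<close> does not depend on the longitude, the integrand that defines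
  \<open>Bop ufield ufield\<close> is a pure longitude derivative, with the witness
  \<open>?Q\<close>; so the flow is a stationary geodesic.\<close>

lemma nabla_ufield_ufield: "nabla ufield ufield = (\<lambda>p. (0, 0))"
proof -
  have "bil ufield (lie ufield (sgrad g)) = 0" if g: "sphere_fun g" for g
  proof -
    note A = sphere_fun_chart_alg[OF g] zonal_alg
    let ?Q = "\<lambda>p. - (sn p * sn p * zonal p * zonal p * d_theta g p) + 10 * zconst * sn p * sn p * sn p * cs p * zonal p * g p"
    have "bil ufield (lie ufield (sgrad g)) = chart_int (\<lambda>p. 0)"
      unfolding bil_def
    proof (rule chart_lint_by_parts[where P = "\<lambda>p. 0" and Q = ?Q])
      fix p assume p: "p \<in> chart"
      have dQ: "d_phi ?Q p = - (sn p * sn p * zonal p * zonal p * d_phi (d_theta g) p) + 10 * zconst * sn p * sn p * sn p * cs p * zonal p * d_phi g p"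
        using A by (simp add: d_phi_simps chart_alg_rules zonal_deriv)
      show "(fst (ufield p) * fst (lie ufield (sgrad g) p) + complex_of_real ((sin (fst p))\<^sup>2) * snd (ufield p) * snd (lie ufield (sgrad g) p)) * sn p
         = 0 + d_theta (\<lambda>p. 0) p + d_phi ?Q p"
        using sn_nonzero[OF p] unfolding lie_ufield[OF A(1) p] dQ
        by (simp add: ufield_def d_theta_simps field_simps power2_eq_square)
    qed (intro chart_alg_rules A | simp)+
    then show ?thesis by (simp add: chart_int_def)
  qed
  then have "Bop ufield ufield = (\<lambda>p. (0, 0))"
    by (intro Bop_eqI zero_SVect) (simp add: bil_zero)
  moreover have "lie ufield ufield = (\<lambda>p. (0, 0))"
    by (simp add: lie_def fun_eq_iff)
  ultimately show ?thesis
    by (simp add: nabla_def vscale_def vsub_def vadd_def fun_eq_iff)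
qed

definition inv_lap_fun :: "int \<Rightarrow> nat \<Rightarrow> real \<times> real \<Rightarrow> complex" where
  "inv_lap_fun m n p = of_real (zon_up (nat \<bar>m\<bar>) n / eigval (n + 2)) * sph_harm m (n + 2) p
     + of_real (zon_diag (nat \<bar>m\<bar>) n / eigval n) * sph_harm m n p + of_real (zon_down (nat \<bar>m\<bar>) n / eigval (n - 2)) * sph_harm m (n - 2) p"

lemma eigval_nonzero: "n \<ge> 1 \<Longrightarrow> eigval n \<noteq> 0"
  by (auto simp: eigval_def)

lemma sph_harm_alg: "sph_harm m n \<in> chart_alg"
  unfolding sph_harm_def by (rule harm_fun_alg)

text \<open>Thus \<open>zconst * inv_lap_fun\<close> is minus the inverse Laplacian of
  \<open>zonal * sph_harm\<close>. The bound \<open>n \<ge> 3\<close> keeps the divisor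
  \<open>eigval (n - 2)\<close> away from 0.\<close>

lemma mode_inv_lap_fun:
  assumes "n \<ge> 3"
  shows "mode m (\<lambda>p. zconst * inv_lap_fun m n p) (\<lambda>p. - (zonal p * sph_harm m n p))"
proof (rule mode_cong)
  show "mode m (\<lambda>p. zconst * inv_lap_fun m n p) (\<lambda>p. zconst * (of_real (zon_up (nat \<bar>m\<bar>) n / eigval (n + 2)) * (of_real (- eigval (n + 2)) * sph_harm m (n + 2) p)
     + of_real (zon_diag (nat \<bar>m\<bar>) n / eigval n) * (of_real (- eigval n) * sph_harm m n p) + of_real (zon_down (nat \<bar>m\<bar>) n / eigval (n - 2)) * (of_real (- eigval (n - 2)) * sph_harm m (n - 2) p)))"
    unfolding inv_lap_fun_def by (intro mode_cmult mode_add mode_sph_harm)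
  show "(\<lambda>p. - (zonal p * sph_harm m n p)) \<in> chart_alg"
    by (intro chart_alg_rules zonal_alg sph_harm_alg)
  have "eigval (n + 2) \<noteq> 0" "eigval n \<noteq> 0" "eigval (n - 2) \<noteq> 0" using assms by (auto intro!: eigval_nonzero)
  then show "zconst * (of_real (zon_up (nat \<bar>m\<bar>) n / eigval (n + 2)) * (of_real (- eigval (n + 2)) * sph_harm m (n + 2) p)
     + of_real (zon_diag (nat \<bar>m\<bar>) n / eigval n) * (of_real (- eigval n) * sph_harm m n p) + of_real (zon_down (nat \<bar>m\<bar>) n / eigval (n - 2)) * (of_real (- eigval (n - 2)) * sph_harm m (n - 2) p))
     = - (zonal p * sph_harm m n p)" for p
    using assms by (subst zonal_sph_harm) (simp_all add: algebra_simps)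
qed

lemma response_sph_harm:
  assumes "n \<ge> 3"
  shows "response m (sph_harm m n) (\<lambda>p. of_real (- eigval n) * sph_harm m n p)
     (\<lambda>p. (12 * \<i> * of_int m) * (zconst * inv_lap_fun m n p)) (\<lambda>p. (- (\<i> * of_int m * of_real (eigval n))) * (zconst * inv_lap_fun m n p))"
proof -
  have *: "(\<lambda>p. - (12 * \<i> * of_int m * zonal p * sph_harm m n p)) = (\<lambda>p. (12 * \<i> * of_int m) * - (zonal p * sph_harm m n p))"
    "(\<lambda>p. - (\<i> * of_int m * zonal p * (of_real (- eigval n) * sph_harm m n p))) = (\<lambda>p. (- (\<i> * of_int m * of_real (eigval n))) * - (zonal p * sph_harm m n p))"
    by (auto simp: algebra_simps)
  show ?thesis
    unfolding response_def *
    by (intro conjI mode_sph_harm mode_cmult[OF mode_inv_lap_fun[OF assms]])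
qed

text \<open>\<open>nabla_fun s m n\<close> is twice the stream function of the covariant derivative of the field of
  \<open>sph_harm m n\<close> along the zonal field (\<open>s = 1\<close>), or of the zonal field along it (\<open>s = -1\<close>).\<close>
definition nabla_fun :: "real \<Rightarrow> int \<Rightarrow> nat \<Rightarrow> real \<times> real \<Rightarrow> complex" where
  "nabla_fun s m n p = \<i> * of_int m * zconst * (of_real (zon_up (nat \<bar>m\<bar>) n * (s + (eigval n - 12) / eigval (n + 2))) * sph_harm m (n + 2) p
     + of_real (zon_diag (nat \<bar>m\<bar>) n * (s + (eigval n - 12) / eigval n)) * sph_harm m n p
     + of_real (zon_down (nat \<bar>m\<bar>) n * (s + (eigval n - 12) / eigval (n - 2))) * sph_harm m (n - 2) p)"

text \<open>Both values of \<open>Bop\<close> are multiples of the same \<open>inv_lap_fun\<close>,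
  with factors proportional to 12 and to \<open>- eigval n\<close>. This is why each entry carries
  \<open>eigval n - 12\<close> over the eigenvalue of the target degree.\<close>

lemma nabla_fun_eq:
  assumes "n \<ge> 3"
  shows "nabla_fun s m n p = of_real s * (\<i> * of_int m * zonal p * sph_harm m n p) + - ((12 * \<i> * of_int m) * (zconst * inv_lap_fun m n p))
      + - ((- (\<i> * of_int m * of_real (eigval n))) * (zconst * inv_lap_fun m n p))"
proof -
  have *: "zonal p * sph_harm m n p = zconst * (of_real (zon_up (nat \<bar>m\<bar>) n) * sph_harm m (n + 2) p
     + of_real (zon_diag (nat \<bar>m\<bar>) n) * sph_harm m n p + of_real (zon_down (nat \<bar>m\<bar>) n) * sph_harm m (n - 2) p)"
    using assms by (intro zonal_sph_harm) simp
  have "of_real s * (\<i> * of_int m * zonal p * sph_harm m n p) = of_real s * (\<i> * of_int m * (zonal p * sph_harm m n p))"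
    by (simp add: mult_ac)
  then show ?thesis
    unfolding nabla_fun_def inv_lap_fun_def * by (simp add: algebra_simps diff_divide_distrib)
qed

text \<open>One covariant derivative spreads a harmonic over three degrees, so the second one has to
  be available for such combinations. All three degrees must be at least 3, which is
  \<open>l \<ge> 5\<close>.\<close>

lemma nabla_three:
  fixes x y z :: complex and m :: int
  assumes l: "l \<ge> 5"
  defines "a \<equiv> \<lambda>p. x * sph_harm m (l + 2) p + y * sph_harm m l p + z * sph_harm m (l - 2) p"
  shows "chart_eq (nabla ufield (sgrad a)) (sgrad (\<lambda>p. (1/2) * (x * nabla_fun 1 m (l + 2) p + y * nabla_fun 1 m l p + z * nabla_fun 1 m (l - 2) p)))"
    and "chart_eq (nabla (sgrad a) ufield) (sgrad (\<lambda>p. (1/2) * (x * nabla_fun (-1) m (l + 2) p + y * nabla_fun (-1) m l p + z * nabla_fun (-1) m (l - 2) p)))"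
proof -
  have n: "l + 2 \<ge> 3" "l \<ge> 3" "l - 2 \<ge> 3" using l by auto
  note r = response_add[OF response_add[OF response_cmult[OF response_sph_harm[OF n(1)], of m x] response_cmult[OF response_sph_harm[OF n(2)], of m y]]
      response_cmult[OF response_sph_harm[OF n(3)], of m z], folded a_def]
  show "chart_eq (nabla ufield (sgrad a)) (sgrad (\<lambda>p. (1/2) * (x * nabla_fun 1 m (l + 2) p + y * nabla_fun 1 m l p + z * nabla_fun 1 m (l - 2) p)))"
    using nabla_ufield_sgrad(1)[OF r] unfolding nabla_fun_eq[OF n(1)] nabla_fun_eq[OF n(2)] nabla_fun_eq[OF n(3)] a_def by (simp add: algebra_simps)
  show "chart_eq (nabla (sgrad a) ufield) (sgrad (\<lambda>p. (1/2) * (x * nabla_fun (-1) m (l + 2) p + y * nabla_fun (-1) m l p + z * nabla_fun (-1) m (l - 2) p)))"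
    using nabla_ufield_sgrad(2)[OF r] unfolding nabla_fun_eq[OF n(1)] nabla_fun_eq[OF n(2)] nabla_fun_eq[OF n(3)] a_def by (simp add: algebra_simps)
qed

text \<open>The quarter stems from the halves of two nested \<open>nabla\<close>, with the minus
  sign of the first term of \<open>Rcurv\<close>; the term of the bracket contains one
  \<open>nabla\<close> and hence one half.\<close>

definition curv_fun :: "int \<Rightarrow> nat \<Rightarrow> real \<times> real \<Rightarrow> complex" where
  "curv_fun m l p = (let k = nat \<bar>m\<bar>; c = \<i> * of_int m * zconst in
     - (1/4) * c * (of_real (zon_up k l * (-1 + (eigval l - 12) / eigval (l + 2))) * nabla_fun 1 m (l + 2) p
        + of_real (zon_diag k l * (-1 + (eigval l - 12) / eigval l)) * nabla_fun 1 m l p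
        + of_real (zon_down k l * (-1 + (eigval l - 12) / eigval (l - 2))) * nabla_fun 1 m (l - 2) p)
     + (1/2) * c * (of_real (zon_up k l) * nabla_fun (-1) m (l + 2) p + of_real (zon_diag k l) * nabla_fun (-1) m l p
        + of_real (zon_down k l) * nabla_fun (-1) m (l - 2) p))"

lemma nabla_fun_alg: "nabla_fun s m n \<in> chart_alg"
  unfolding nabla_fun_def by (intro chart_alg_rules sph_harm_alg)

lemma sphere_fun_sph_harm: "sphere_fun (sph_harm m n)"
  unfolding sph_harm_def by (rule sphere_fun_harm_fun)

lemma sphere_fun_nabla_fun: "sphere_fun (nabla_fun s m n)"
  unfolding nabla_fun_def by (intro sphere_fun_mult sphere_fun_add sphere_fun_const sphere_fun_sph_harm)

lemma sphere_fun_curv_fun: "sphere_fun (curv_fun m n)"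
  unfolding curv_fun_def Let_def by (intro sphere_fun_mult sphere_fun_add sphere_fun_const sphere_fun_nabla_fun)

lemma Rcurv_sph_harm:
  fixes d :: complex and m :: int
  assumes l: "l \<ge> 5"
  defines "v \<equiv> sgrad (\<lambda>p. d * sph_harm m l p)"
  shows "chart_eq (Rcurv ufield v ufield) (sgrad (\<lambda>p. d * curv_fun m l p))"
proof -
  let ?k = "nat \<bar>m\<bar>" and ?c = "\<i> * of_int m * zconst"
  let ?x = "of_real (zon_up ?k l * (-1 + (eigval l - 12) / eigval (l + 2))) :: complex"
    and ?y = "of_real (zon_diag ?k l * (-1 + (eigval l - 12) / eigval l)) :: complex"
    and ?z = "of_real (zon_down ?k l * (-1 + (eigval l - 12) / eigval (l - 2))) :: complex"
  have "chart_eq (nabla v ufield) (sgrad (\<lambda>p. (1/2) * (0 * nabla_fun (-1) m (l + 2) p + d * nabla_fun (-1) m l p + 0 * nabla_fun (-1) m (l - 2) p)))"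
    unfolding v_def using nabla_three(2)[OF l, of 0 m d 0] by simp
  also have "(\<lambda>p. (1/2) * (0 * nabla_fun (-1) m (l + 2) p + d * nabla_fun (-1) m l p + 0 * nabla_fun (-1) m (l - 2) p)) =
      (\<lambda>p. (1/2 * d * ?c * ?x) * sph_harm m (l + 2) p + (1/2 * d * ?c * ?y) * sph_harm m l p + (1/2 * d * ?c * ?z) * sph_harm m (l - 2) p)"
    by (auto simp: nabla_fun_def algebra_simps)
  finally have "chart_eq (nabla ufield (nabla v ufield)) (nabla ufield (sgrad \<dots>))"
    by (rule nabla_chart_cong[OF chart_eq_refl])
  also note nabla_three(1)[OF l]
  finally have 1: "chart_eq (nabla ufield (nabla v ufield)) (sgrad (\<lambda>p. 1/2 * ((1/2 * d * ?c * ?x) * nabla_fun 1 m (l + 2) p + (1/2 * d * ?c * ?y) * nabla_fun 1 m l p + (1/2 * d * ?c * ?z) * nabla_fun 1 m (l - 2) p)))" .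
  have "chart_eq (lie ufield v) (sgrad (\<lambda>p. \<i> * of_int m * zonal p * (d * sph_harm m l p)))"
    unfolding v_def by (rule lie_ufield_sgrad[OF mode_cmult[OF mode_sph_harm]])
  also have "(\<lambda>p. \<i> * of_int m * zonal p * (d * sph_harm m l p)) =
      (\<lambda>p. (d * ?c * of_real (zon_up ?k l)) * sph_harm m (l + 2) p + (d * ?c * of_real (zon_diag ?k l)) * sph_harm m l p + (d * ?c * of_real (zon_down ?k l)) * sph_harm m (l - 2) p)"
  proof
    fix p
    have z: "zonal p * sph_harm m l p = zconst * (of_real (zon_up ?k l) * sph_harm m (l + 2) p
     + of_real (zon_diag ?k l) * sph_harm m l p + of_real (zon_down ?k l) * sph_harm m (l - 2) p)"
      using l by (intro zonal_sph_harm) simp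
    have "\<i> * of_int m * zonal p * (d * sph_harm m l p) = d * (\<i> * of_int m) * (zonal p * sph_harm m l p)" by (simp add: mult_ac)
    then show "\<i> * of_int m * zonal p * (d * sph_harm m l p) = (d * ?c * of_real (zon_up ?k l)) * sph_harm m (l + 2) p + (d * ?c * of_real (zon_diag ?k l)) * sph_harm m l p + (d * ?c * of_real (zon_down ?k l)) * sph_harm m (l - 2) p"
      unfolding z by (simp add: algebra_simps)
  qed
  finally have "chart_eq (nabla (lie ufield v) ufield) (nabla (sgrad \<dots>) ufield)"
    by (rule nabla_chart_cong[OF _ chart_eq_refl])
  also note nabla_three(2)[OF l]
  finally have 2: "chart_eq (nabla (lie ufield v) ufield) (sgrad (\<lambda>p. 1/2 * ((d * ?c * of_real (zon_up ?k l)) * nabla_fun (-1) m (l + 2) p + (d * ?c * of_real (zon_diag ?k l)) * nabla_fun (-1) m l p + (d * ?c * of_real (zon_down ?k l)) * nabla_fun (-1) m (l - 2) p)))" .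
  let ?F1 = "\<lambda>p. 1/2 * ((1/2 * d * ?c * ?x) * nabla_fun 1 m (l + 2) p + (1/2 * d * ?c * ?y) * nabla_fun 1 m l p + (1/2 * d * ?c * ?z) * nabla_fun 1 m (l - 2) p)"
  let ?F2 = "\<lambda>p. 1/2 * ((d * ?c * of_real (zon_up ?k l)) * nabla_fun (-1) m (l + 2) p + (d * ?c * of_real (zon_diag ?k l)) * nabla_fun (-1) m l p + (d * ?c * of_real (zon_down ?k l)) * nabla_fun (-1) m (l - 2) p)"
  have F: "?F1 \<in> chart_alg" "?F2 \<in> chart_alg" by (intro chart_alg_rules nabla_fun_alg)+
  have "chart_eq (Rcurv ufield v ufield) (vadd (vadd (vscale (-1) (sgrad ?F1)) (\<lambda>p. (0, 0))) (sgrad ?F2))"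
    unfolding Rcurv_def nabla_ufield_ufield nabla_zero
    by (intro vadd_chart_cong vscale_chart_cong 1 2 chart_eq_refl)
  also have "vadd (vadd (vscale (-1) (sgrad ?F1)) (\<lambda>p. (0, 0))) (sgrad ?F2) = vadd (sgrad (\<lambda>p. (-1) * ?F1 p)) (sgrad ?F2)"
    unfolding sgrad_cmult[OF F(1)] vadd_zero ..
  also have "\<dots> = sgrad (\<lambda>p. (-1) * ?F1 p + ?F2 p)"
    by (rule sgrad_add[symmetric]) (intro chart_alg_rules F)+
  also have "(\<lambda>p. (-1) * ?F1 p + ?F2 p) = (\<lambda>p. d * curv_fun m l p)"
    by (simp add: curv_fun_def Let_def algebra_simps)
  finally show ?thesis .
qed

text \<open>Each line belongs to a path from degree \<open>l\<close> to \<open>l + 2\<close>,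
  \<open>l\<close> or \<open>l - 2\<close> and back. Its bracket is half the return weight with sign
  -1, from the term of the Lie bracket, minus a quarter of the outward weight with sign -1 times the
  return weight with sign 1, from the nested derivative. The prefactor is the square of
  \<open>\<i> * of_int m * zconst\<close>.\<close>

definition curv_coeff :: "nat \<Rightarrow> nat \<Rightarrow> real" where
  "curv_coeff k l = - (real k)\<^sup>2 * (21 / (64 * pi)) *
    (zon_up k l * zon_down k (l + 2) * ((-1 + (eigval (l + 2) - 12) / eigval l) / 2 - (-1 + (eigval l - 12) / eigval (l + 2)) * (1 + (eigval (l + 2) - 12) / eigval l) / 4)
   + zon_diag k l * zon_diag k l * ((-1 + (eigval l - 12) / eigval l) / 2 - (-1 + (eigval l - 12) / eigval l) * (1 + (eigval l - 12) / eigval l) / 4)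
   + zon_down k l * zon_up k (l - 2) * ((-1 + (eigval (l - 2) - 12) / eigval l) / 2 - (-1 + (eigval l - 12) / eigval (l - 2)) * (1 + (eigval (l - 2) - 12) / eigval l) / 4))"

definition pairing :: "int \<Rightarrow> nat \<Rightarrow> (real \<times> real \<Rightarrow> complex) \<Rightarrow> complex" where
  "pairing m l F = chart_int (\<lambda>p. sn p * F p * cnj (sph_harm m l p))"

lemma pairing_add: "F \<in> chart_alg \<Longrightarrow> G \<in> chart_alg \<Longrightarrow> pairing m l (\<lambda>p. F p + G p) = pairing m l F + pairing m l G"
  unfolding pairing_def
  by (subst chart_int_add[symmetric]) (auto simp: algebra_simps intro!: chart_alg_rules chart_alg_cnj sph_harm_alg)

lemma pairing_cmult: "pairing m l (\<lambda>p. c * F p) = c * pairing m l F"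
  unfolding pairing_def by (subst chart_int_cmult[symmetric]) (simp add: mult_ac)

lemma eigval_inj: "eigval n = eigval l \<Longrightarrow> n = l"
proof -
  assume "eigval n = eigval l"
  then have "(real n - real l) * (real n + real l + 1) = 0" by (simp add: eigval_def algebra_simps)
  moreover have "real n + real l + 1 \<noteq> 0" by (simp add: add_nonneg_eq_0_iff)
  ultimately show ?thesis by simp
qed

lemma pairing_sph_harm: "n \<noteq> l \<Longrightarrow> pairing m l (sph_harm m n) = 0"
  unfolding pairing_def by (rule eigen_orthogonal[OF mode_sph_harm mode_sph_harm]) (use eigval_inj in blast)

lemma pairing_nabla_fun:
  "pairing m l (nabla_fun s m n) = \<i> * of_int m * zconst * (of_real (zon_up (nat \<bar>m\<bar>) n * (s + (eigval n - 12) / eigval (n + 2))) * pairing m l (sph_harm m (n + 2))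
     + of_real (zon_diag (nat \<bar>m\<bar>) n * (s + (eigval n - 12) / eigval n)) * pairing m l (sph_harm m n)
     + of_real (zon_down (nat \<bar>m\<bar>) n * (s + (eigval n - 12) / eigval (n - 2))) * pairing m l (sph_harm m (n - 2)))"
  unfolding nabla_fun_def by (simp only: pairing_add pairing_cmult chart_alg_rules sph_harm_alg)

lemma zconst_sq: "zconst * zconst = of_real (21 / (64 * pi))"
proof -
  have "sqrt (21 / pi) / 8 * (sqrt (21 / pi) / 8) = 21 / (64 * pi)"
    by (simp add: real_sqrt_mult_self)
  then show ?thesis unfolding zconst_def of_real_mult[symmetric] by simp
qed

lemma pairing_curv_fun:
  assumes l: "l \<ge> 5"
  shows "pairing m l (curv_fun m l) = of_real (curv_coeff (nat \<bar>m\<bar>) l) * pairing m l (sph_harm m l)"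
proof -
  let ?k = "nat \<bar>m\<bar>" and ?c = "\<i> * of_int m * zconst"
  have m2: "?c * ?c = of_real (- (real ?k)\<^sup>2 * (21 / (64 * pi)))"
  proof -
    have "?c * ?c = - (of_int m * of_int m) * (zconst * zconst)" using i_squared by algebra
    also have "of_int m * of_int m = complex_of_real ((real ?k)\<^sup>2)" by (simp add: power2_eq_square)
    finally show ?thesis by (simp add: zconst_sq)
  qed
  have e: "l + 2 - 2 = l" "l - 2 + 2 = l" using l by auto
  have p: "pairing m l (nabla_fun s m (l + 2)) = ?c * (of_real (zon_down ?k (l + 2) * (s + (eigval (l + 2) - 12) / eigval l)) * pairing m l (sph_harm m l))"
    "pairing m l (nabla_fun s m l) = ?c * (of_real (zon_diag ?k l * (s + (eigval l - 12) / eigval l)) * pairing m l (sph_harm m l))"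
    "pairing m l (nabla_fun s m (l - 2)) = ?c * (of_real (zon_up ?k (l - 2) * (s + (eigval (l - 2) - 12) / eigval l)) * pairing m l (sph_harm m l))" for s
    unfolding pairing_nabla_fun e using l by (simp_all add: pairing_sph_harm)
  define W where "W = pairing m l (sph_harm m l)"
  have "pairing m l (curv_fun m l) = (?c * ?c) * (
     - (1/4) * (of_real (zon_up ?k l * (-1 + (eigval l - 12) / eigval (l + 2))) * of_real (zon_down ?k (l + 2) * (1 + (eigval (l + 2) - 12) / eigval l))
        + of_real (zon_diag ?k l * (-1 + (eigval l - 12) / eigval l)) * of_real (zon_diag ?k l * (1 + (eigval l - 12) / eigval l))
        + of_real (zon_down ?k l * (-1 + (eigval l - 12) / eigval (l - 2))) * of_real (zon_up ?k (l - 2) * (1 + (eigval (l - 2) - 12) / eigval l)))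
     + (1/2) * (of_real (zon_up ?k l) * of_real (zon_down ?k (l + 2) * (-1 + (eigval (l + 2) - 12) / eigval l)) + of_real (zon_diag ?k l) * of_real (zon_diag ?k l * (-1 + (eigval l - 12) / eigval l))
        + of_real (zon_down ?k l) * of_real (zon_up ?k (l - 2) * (-1 + (eigval (l - 2) - 12) / eigval l)))) * W"
    unfolding curv_fun_def Let_def W_def
    by (simp only: pairing_add pairing_cmult chart_alg_rules nabla_fun_alg p) (simp only: algebra_simps)
  also have "\<dots> = of_real (- (real ?k)\<^sup>2 * (21 / (64 * pi)) * (
     - (1/4) * ((zon_up ?k l * (-1 + (eigval l - 12) / eigval (l + 2))) * (zon_down ?k (l + 2) * (1 + (eigval (l + 2) - 12) / eigval l))
        + (zon_diag ?k l * (-1 + (eigval l - 12) / eigval l)) * (zon_diag ?k l * (1 + (eigval l - 12) / eigval l))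
        + (zon_down ?k l * (-1 + (eigval l - 12) / eigval (l - 2))) * (zon_up ?k (l - 2) * (1 + (eigval (l - 2) - 12) / eigval l)))
     + (1/2) * ((zon_up ?k l) * (zon_down ?k (l + 2) * (-1 + (eigval (l + 2) - 12) / eigval l)) + (zon_diag ?k l) * (zon_diag ?k l * (-1 + (eigval l - 12) / eigval l))
        + (zon_down ?k l) * (zon_up ?k (l - 2) * (-1 + (eigval (l - 2) - 12) / eigval l))))) * W"
    unfolding m2 by simp
  also have "- (real ?k)\<^sup>2 * (21 / (64 * pi)) * (
     - (1/4) * ((zon_up ?k l * (-1 + (eigval l - 12) / eigval (l + 2))) * (zon_down ?k (l + 2) * (1 + (eigval (l + 2) - 12) / eigval l))
        + (zon_diag ?k l * (-1 + (eigval l - 12) / eigval l)) * (zon_diag ?k l * (1 + (eigval l - 12) / eigval l))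
        + (zon_down ?k l * (-1 + (eigval l - 12) / eigval (l - 2))) * (zon_up ?k (l - 2) * (1 + (eigval (l - 2) - 12) / eigval l)))
     + (1/2) * ((zon_up ?k l) * (zon_down ?k (l + 2) * (-1 + (eigval (l + 2) - 12) / eigval l)) + (zon_diag ?k l) * (zon_diag ?k l * (-1 + (eigval l - 12) / eigval l))
        + (zon_down ?k l) * (zon_up ?k (l - 2) * (-1 + (eigval (l - 2) - 12) / eigval l)))) = curv_coeff ?k l"
  proof -
    have "- (1/4) * (a * x1 * (d * y1) + b * x2 * (e * y2) + c * x3 * (f * y3)) + (1/2) * (a * (d * z1) + b * (e * z2) + c * (f * z3))
      = a * d * (z1 / 2 - x1 * y1 / 4) + b * e * (z2 / 2 - x2 * y2 / 4) + c * f * (z3 / 2 - x3 * y3 / 4)" for a b c d e f x1 x2 x3 y1 y2 y3 z1 z2 z3 :: real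
      by (simp add: field_simps)
    then show ?thesis unfolding curv_coeff_def by (rule arg_cong)
  qed
  finally show ?thesis unfolding W_def .
qed

section \<open>Asymptotics\<close>

definition den_up :: "real \<Rightarrow> real" where "den_up x = (2 * x + 1) * (2 * x + 3)\<^sup>2 * (2 * x + 5)"
definition den_down :: "real \<Rightarrow> real" where "den_down x = (2 * x + 1) * (2 * x - 1)\<^sup>2 * (2 * x - 3)"

lemma zon_up_zon_down:
  assumes "l \<ge> 5"
  shows "zon_up k l * zon_down k (l + 2) = 25 * (((real l + 1)\<^sup>2 - (real k)\<^sup>2) * ((real l + 2)\<^sup>2 - (real k)\<^sup>2)) / den_up (real l)" (is ?P)
    and "zon_down k l * zon_up k (l - 2) = 25 * (((real l)\<^sup>2 - (real k)\<^sup>2) * ((real l - 1)\<^sup>2 - (real k)\<^sup>2)) / den_down (real l)" (is ?M)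
    and "zon_diag k l = 5 * (((real l + 1)\<^sup>2 - (real k)\<^sup>2) / ((2 * real l + 1) * (2 * real l + 3)) + ((real l)\<^sup>2 - (real k)\<^sup>2) / ((2 * real l + 1) * (2 * real l - 1))) - 1" (is ?Z)
proof -
  define x y where "x = real l" and "y = real k"
  have x: "x \<ge> 5" using assms by (simp add: x_def)
  have r: "real (l + 1) = x + 1" "real (l + 2) = x + 2" "real (l - 1) = x - 1" "real (l - 2) = x - 2" "real (l + 2 - 1) = x + 1" "real (l - 2 + 1) = x - 1"
    using assms by (auto simp: x_def of_nat_diff)
  show ?P
    unfolding zon_up_def zon_down_def rec_up_def rec_down_def r x_def[symmetric] y_def[symmetric] den_up_def
    by (simp add: power2_eq_square algebra_simps)
  show ?M
    unfolding zon_up_def zon_down_def rec_up_def rec_down_def r x_def[symmetric] y_def[symmetric] den_down_def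
    by (simp add: power2_eq_square algebra_simps)
  show ?Z
    unfolding zon_diag_def rec_up_def rec_down_def r x_def[symmetric] y_def[symmetric]
    by (simp add: power2_eq_square algebra_simps)
qed

definition curv_bracket :: "real \<Rightarrow> real \<Rightarrow> real" where
  "curv_bracket L L' = (-1 + (L' - 12) / L) / 2 - (-1 + (L - 12) / L') * (1 + (L' - 12) / L) / 4"

text \<open>Let \<open>tP\<close> and \<open>tM\<close> be the products of entries along the paths
  through \<open>l + 2\<close> and \<open>l - 2\<close>. Their brackets behave like
  \<open>4 / l\<close> and \<open>- 4 / l\<close>, while the prefactor grows like
  \<open>l^2\<close>. The split \<open>bP * tP + bM * tM = (bP + bM) * tM + bP * (tP - tM)\<close>
  isolates the cancellation: \<open>bP + bM\<close> is \<open>o(l^-2)\<close>, and the limit is 4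
  times that of \<open>l * (tP - tM)\<close>, up to the prefactor.\<close>

lemma curv_coeff_limit:
  fixes k :: "nat \<Rightarrow> nat" and r :: real
  assumes rho: "(\<lambda>l. real (k l) / real l) \<longlonglongrightarrow> r"
  shows "(\<lambda>l. curv_coeff (k l) l) \<longlonglongrightarrow> - 525 / (32 * pi) * r ^ 4 * (1 - r\<^sup>2)"
proof -
  let ?L = "\<lambda>x::real. x * (x + 1)"
  define bP where "bP x = curv_bracket (?L x) (?L (x + 2))" for x
  define bM where "bM x = curv_bracket (?L x) (?L (x - 2))" for x
  define b0 where "b0 x = curv_bracket (?L x) (?L x)" for x
  define \<rho> where "\<rho> l = real (k l) / real l" for l
  have rho: "\<rho> \<longlonglongrightarrow> r" using rho unfolding \<rho>_def[abs_def] .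
  \<comment> \<open>\<open>A x + B x * y^2 + C x * y^4\<close> is \<open>tP - tM\<close> expanded in
    \<open>y = real (k l)\<close>. With \<open>y = \<rho> l * x\<close> and the extra factor
    \<open>x\<close>, the three coefficients acquire the weights \<open>x\<close>,
    \<open>x^3\<close> and \<open>x^5\<close> that appear in the limits below.\<close>
  define A where "A x = 25 * ((x + 1)\<^sup>2 * (x + 2)\<^sup>2 / den_up x - x\<^sup>2 * (x - 1)\<^sup>2 / den_down x)" for x
  define B where "B x = - 25 * (((x + 1)\<^sup>2 + (x + 2)\<^sup>2) / den_up x - (x\<^sup>2 + (x - 1)\<^sup>2) / den_down x)" for x
  define C where "C x = 25 * (1 / den_up x - 1 / den_down x)" for x
  have l0: "(\<lambda>l. (real l)\<^sup>2 * (bP (real l) + bM (real l))) \<longlonglongrightarrow> 0"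
    unfolding bP_def bM_def curv_bracket_def by real_asymp
  have l1: "(\<lambda>l. real l * bP (real l)) \<longlonglongrightarrow> 4"
    unfolding bP_def curv_bracket_def by real_asymp
  have l2: "(\<lambda>l. (real l)\<^sup>2 * b0 (real l)) \<longlonglongrightarrow> 0"
    unfolding b0_def curv_bracket_def by real_asymp
  have lA: "(\<lambda>l. real l * A (real l)) \<longlonglongrightarrow> 0"
    unfolding A_def den_up_def den_down_def by real_asymp
  have lB: "(\<lambda>l. real l ^ 3 * B (real l)) \<longlonglongrightarrow> 25 / 2"
    unfolding B_def den_up_def den_down_def by real_asymp
  have lC: "(\<lambda>l. real l ^ 5 * C (real l)) \<longlonglongrightarrow> - 25 / 2"
    unfolding C_def den_up_def den_down_def by real_asymp
  have m1: "(\<lambda>l. 25 * (real l)\<^sup>2 * (real l)\<^sup>2 / den_down (real l)) \<longlonglongrightarrow> 25 / 16"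
    unfolding den_down_def by real_asymp
  have m2: "(\<lambda>l. (real l - 1) / real l) \<longlonglongrightarrow> 1" by real_asymp
  have z1: "(\<lambda>l. (real l)\<^sup>2 / ((2 * real l + 1) * (2 * real l + 3))) \<longlonglongrightarrow> 1 / 4" by real_asymp
  have z2: "(\<lambda>l. (real l)\<^sup>2 / ((2 * real l + 1) * (2 * real l - 1))) \<longlonglongrightarrow> 1 / 4" by real_asymp
  have z3: "(\<lambda>l. (real l + 1) / real l) \<longlonglongrightarrow> 1" by real_asymp
  define tM where "tM l = (25 * (real l)\<^sup>2 * (real l)\<^sup>2 / den_down (real l)) * ((1 - (\<rho> l)\<^sup>2) * (((real l - 1) / real l)\<^sup>2 - (\<rho> l)\<^sup>2))" for l
  define tZ where "tZ l = 5 * ((real l)\<^sup>2 / ((2 * real l + 1) * (2 * real l + 3)) * (((real l + 1) / real l)\<^sup>2 - (\<rho> l)\<^sup>2)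
      + (real l)\<^sup>2 / ((2 * real l + 1) * (2 * real l - 1)) * (1 - (\<rho> l)\<^sup>2)) - 1" for l
  define E where "E l = real l * A (real l) + (real l ^ 3 * B (real l)) * (\<rho> l)\<^sup>2 + (real l ^ 5 * C (real l)) * \<rho> l ^ 4" for l
  have tM: "tM \<longlonglongrightarrow> (25 / 16) * ((1 - r\<^sup>2) * (1\<^sup>2 - r\<^sup>2))"
    unfolding tM_def by (intro tendsto_intros m1 m2 rho)
  have tZ: "tZ \<longlonglongrightarrow> 5 * (1 / 4 * (1\<^sup>2 - r\<^sup>2) + 1 / 4 * (1 - r\<^sup>2)) - 1"
    unfolding tZ_def by (intro tendsto_intros z1 z2 z3 rho)
  have E: "E \<longlonglongrightarrow> 0 + 25 / 2 * r\<^sup>2 + (- 25 / 2) * r ^ 4"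
    unfolding E_def by (intro tendsto_intros lA lB lC rho)
  let ?G = "\<lambda>l. - (21 / (64 * pi)) * ((\<rho> l)\<^sup>2 * ((real l)\<^sup>2 * (bP (real l) + bM (real l))) * tM l
      + (\<rho> l)\<^sup>2 * (real l * bP (real l)) * E l + (\<rho> l)\<^sup>2 * ((real l)\<^sup>2 * b0 (real l)) * (tZ l * tZ l))"
  have G: "?G \<longlonglongrightarrow> - (21 / (64 * pi)) * (r\<^sup>2 * 0 * ((25 / 16) * ((1 - r\<^sup>2) * (1\<^sup>2 - r\<^sup>2)))
      + r\<^sup>2 * 4 * (0 + 25 / 2 * r\<^sup>2 + (- 25 / 2) * r ^ 4)
      + r\<^sup>2 * 0 * ((5 * (1 / 4 * (1\<^sup>2 - r\<^sup>2) + 1 / 4 * (1 - r\<^sup>2)) - 1) * (5 * (1 / 4 * (1\<^sup>2 - r\<^sup>2) + 1 / 4 * (1 - r\<^sup>2)) - 1)))"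
    by (intro tendsto_mult tendsto_add tendsto_power tendsto_const rho l0 l1 l2 tM tZ E)
  have "curv_coeff (k l) l = ?G l" if l: "l \<ge> 5" for l
  proof -
    define x y where "x = real l" and "y = real (k l)"
    have x: "x \<ge> 5" using l by (simp add: x_def)
    have y: "y = \<rho> l * x" using x by (simp add: \<rho>_def x_def y_def)
    have D: "den_up x \<noteq> 0" "den_down x \<noteq> 0" using x by (auto simp: den_up_def den_down_def)
    have eigval: "eigval (l + 2) = ?L (x + 2)" "eigval l = ?L x" "eigval (l - 2) = ?L (x - 2)"
      using l by (auto simp: eigval_def x_def of_nat_diff)
    have TM: "25 * ((x\<^sup>2 - y\<^sup>2) * ((x - 1)\<^sup>2 - y\<^sup>2)) / den_down x = tM l"
      unfolding tM_def y x_def[symmetric] using x D by (simp add: field_simps power2_eq_square)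
    have TZ: "5 * (((x + 1)\<^sup>2 - y\<^sup>2) / ((2 * x + 1) * (2 * x + 3)) + (x\<^sup>2 - y\<^sup>2) / ((2 * x + 1) * (2 * x - 1))) - 1 = tZ l"
    proof -
      have "(x + 1)\<^sup>2 - y\<^sup>2 = x\<^sup>2 * (((x + 1) / x)\<^sup>2 - (\<rho> l)\<^sup>2)" "x\<^sup>2 - y\<^sup>2 = x\<^sup>2 * (1 - (\<rho> l)\<^sup>2)"
        unfolding y using x by (simp_all add: field_simps power2_eq_square)
      then show ?thesis unfolding tZ_def x_def[symmetric] by simp
    qed
    have TP: "x * (25 * (((x + 1)\<^sup>2 - y\<^sup>2) * ((x + 2)\<^sup>2 - y\<^sup>2)) / den_up x - tM l) = E l"
    proof -
      have "25 * (((x + 1)\<^sup>2 - y\<^sup>2) * ((x + 2)\<^sup>2 - y\<^sup>2)) / den_up x - tM l = A x + B x * y\<^sup>2 + C x * y ^ 4"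
        unfolding TM[symmetric] A_def B_def C_def using D by (simp add: field_simps)
      moreover have "x * (A x + B x * y\<^sup>2 + C x * y ^ 4) = E l"
        unfolding E_def y x_def[symmetric] by algebra
      ultimately show ?thesis by simp
    qed
    have "curv_coeff (k l) l = - y\<^sup>2 * (21 / (64 * pi)) *
       (25 * (((x + 1)\<^sup>2 - y\<^sup>2) * ((x + 2)\<^sup>2 - y\<^sup>2)) / den_up x * bP x + tZ l * tZ l * b0 x + tM l * bM x)"
      unfolding curv_coeff_def zon_up_zon_down[OF l] eigval bP_def bM_def b0_def curv_bracket_def x_def[symmetric] y_def[symmetric] TM TZ ..
    also have "\<dots> = - (21 / (64 * pi)) * ((\<rho> l)\<^sup>2 * (x\<^sup>2 * (bP x + bM x)) * tM l
      + (\<rho> l)\<^sup>2 * (x * bP x) * (x * (25 * (((x + 1)\<^sup>2 - y\<^sup>2) * ((x + 2)\<^sup>2 - y\<^sup>2)) / den_up x - tM l)) + (\<rho> l)\<^sup>2 * (x\<^sup>2 * b0 x) * (tZ l * tZ l))"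
      unfolding y power_mult_distrib by (simp add: algebra_simps power2_eq_square)
    finally show ?thesis unfolding TP unfolding x_def .
  qed
  then have "eventually (\<lambda>l. ?G l = curv_coeff (k l) l) sequentially"
    by (auto intro: eventually_sequentiallyI[of 5])
  from Lim_transform_eventually[OF G this]
  have "(\<lambda>l. curv_coeff (k l) l) \<longlonglongrightarrow> - (21 / (64 * pi)) * (r\<^sup>2 * 4 * (25 / 2 * r\<^sup>2 + (- 25 / 2) * r ^ 4))"
    by simp
  also have "- (21 / (64 * pi)) * (r\<^sup>2 * 4 * (25 / 2 * r\<^sup>2 + (- 25 / 2) * r ^ 4)) = - 525 / (32 * pi) * r ^ 4 * (1 - r\<^sup>2)"
    by (simp add: field_simps)
  finally show ?thesis .
qed

section \<open>The basis fields\<close>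

text \<open>For negative \<open>m\<close> the definition combines a negative power of the sine with
  a derivative of order below \<open>l\<close>. \<open>rodrigues_reflect\<close> supplies twice the
  missing power and the derivative of order \<open>l + \<bar>m\<bar>\<close>, at the cost of the
  constant \<open>e\<close>.\<close>

lemma assoc_leg_eq:
  assumes "\<bar>m\<bar> \<le> int l"
  obtains e where "e \<noteq> 0" "\<And>t. 0 < t \<Longrightarrow> t < pi \<Longrightarrow>
    assoc_leg l m (cos t) = e * (sin t ^ nat \<bar>m\<bar> * poly (leg (nat \<bar>m\<bar>) l) (cos t))"
proof -
  define k where "k = nat \<bar>m\<bar>"
  have k: "k \<le> l" using assms by (simp add: k_def)
  have pw: "(1 - (cos t)\<^sup>2) powr (real_of_int m / 2) = sin t powr real_of_int m" if "0 < t" "t < pi" for t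
  proof -
    have s: "0 < sin t" using that by (rule sin_gt_zero)
    have "1 - (cos t)\<^sup>2 = sin t powr 2" using s by (simp add: sin_squared_eq)
    then show ?thesis by (simp add: powr_powr)
  qed
  show ?thesis
  proof (cases "m \<ge> 0")
    case True
    then have m: "m = int k" by (simp add: k_def)
    then have n: "nat (int l + m) = l + k" by simp
    show ?thesis
    proof (rule that[of 1])
      fix t :: real assume t: "0 < t" "t < pi"
      have "sin t powr real_of_int m = sin t ^ k"
        using sin_gt_zero[OF t] by (simp add: m powr_realpow)
      then show "assoc_leg l m (cos t) = 1 * (sin t ^ nat \<bar>m\<bar> * poly (leg (nat \<bar>m\<bar>) l) (cos t))"
        unfolding assoc_leg_def pw[OF t] n higher_deriv_base k_def[symmetric] leg_def by simp
    qed simp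
  next
    case False
    then have m: "m = - int k" by (simp add: k_def)
    then have n: "nat (int l + m) = l - k" using k by simp
    obtain c where c: "c \<noteq> 0" "rodrigues l (l - k) = smult c ([:-1, 0, 1:] ^ k * rodrigues l (l + k))"
      using rodrigues_reflect[OF k] by blast
    show ?thesis
    proof (rule that[of "c * (-1) ^ k"])
      fix t :: real assume t: "0 < t" "t < pi"
      have s: "0 < sin t" by (rule sin_gt_zero[OF t])
      have "sin t powr real_of_int m = 1 / sin t ^ k"
        using s by (simp add: m powr_minus powr_realpow divide_inverse)
      moreover have "poly ([:-1, 0, 1:] ^ k) (cos t) = (-1) ^ k * sin t ^ k * sin t ^ k"
      proof -
        have "poly [:-1, 0, 1:] (cos t) = (-1) * (sin t * sin t)"
          using sin_cos_squared_add3[of t] by (simp add: algebra_simps)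
        then show ?thesis by (simp only: poly_power power_mult_distrib mult.assoc)
      qed
      ultimately show "assoc_leg l m (cos t) = c * (-1) ^ k * (sin t ^ nat \<bar>m\<bar> * poly (leg (nat \<bar>m\<bar>) l) (cos t))"
        unfolding assoc_leg_def pw[OF t] n higher_deriv_base k_def[symmetric] leg_def c(2) using s
        by (simp del: poly_power)
    qed (use c in simp)
  qed
qed

lemma ebasis_sph_harm:
  assumes "\<bar>m\<bar> \<le> int l" "l \<ge> 1"
  obtains d where "d \<noteq> 0" "chart_eq (ebasis l m) (sgrad (\<lambda>p. d * sph_harm m l p))"
proof -
  obtain e where e: "e \<noteq> 0" "\<And>t. 0 < t \<Longrightarrow> t < pi \<Longrightarrow>
    assoc_leg l m (cos t) = e * (sin t ^ nat \<bar>m\<bar> * poly (leg (nat \<bar>m\<bar>) l) (cos t))"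
    using assoc_leg_eq[OF assms(1)] by blast
  define N where "N = sqrt (fact (nat (int l - m)) / fact (nat (int l + m)) * (2 * real l + 1) / (4 * pi))"
  define S where "S = sqrt (real l * (real l + 1))"
  have "N \<noteq> 0" "S \<noteq> 0" using assms(2) by (auto simp: N_def S_def add_nonneg_eq_0_iff)
  have Y: "Ysh l m p = of_real N * exp (\<i> * of_int m * of_real (snd p)) * of_real (assoc_leg l m (cos (fst p)))" for p
    unfolding Ysh_def N_def ..
  have "of_real (N * e / S) \<noteq> (0::complex)" using e \<open>N \<noteq> 0\<close> \<open>S \<noteq> 0\<close> by simp
  moreover have "chart_eq (\<lambda>p. Ysh l m p / of_real S) (\<lambda>p. of_real (N * e / S) * sph_harm m l p)"
    by (auto simp: chart_eq_def chart_def Y e(2) sph_harm_def harm_fun_def)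
  ultimately show ?thesis
    using that sgrad_chart_cong unfolding ebasis_def S_def by blast
qed

text \<open>Two thirds of the Legendre polynomial of degree 3 times
  \<open>sqrt (21 / pi) / 8\<close>, so that the derivative is the profile of
  \<open>zonal\<close>.\<close>

definition zonal_poly :: "real poly" where
  "zonal_poly = smult (sqrt (21 / pi) / 8) [:0, -1, 0, 5/3:]"

lemma ufield_eq: "chart_eq ufield (sgrad (harm_fun 0 zonal_poly))"
proof -
  have F: "harm_fun 0 zonal_poly = (\<lambda>p. zconst * ((5/3) * (cs p * cs p * cs p) - cs p))"
    by (auto simp: harm_fun_def zonal_poly_def zconst_def fun_eq_iff algebra_simps)
  have "d_theta (harm_fun 0 zonal_poly) = (\<lambda>p. - (zonal p * sn p))" "d_phi (harm_fun 0 zonal_poly) = (\<lambda>p. 0)"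
    unfolding F by (simp_all only: d_theta_simps d_phi_simps chart_alg_rules)
      (simp_all add: zonal_def fun_eq_iff algebra_simps)
  then show ?thesis
    by (auto simp: chart_eq_def sgrad_def ufield_def dest: sn_nonzero)
qed

lemma mode_zonal_poly: "mode 0 (harm_fun 0 zonal_poly) (\<lambda>p. of_real (- eigval 3) * harm_fun 0 zonal_poly p)"
proof (rule mode_harm_fun)
  fix x :: real
  define w where "w = sqrt (21 / pi) / 8"
  have p: "poly zonal_poly x = w * (5 / 3 * x ^ 3 - x)" "poly (pderiv zonal_poly) x = w * (5 * x\<^sup>2 - 1)"
    "poly (pderiv (pderiv zonal_poly)) x = w * (10 * x)"
    by (simp_all add: zonal_poly_def w_def[symmetric] pderiv_smult pderiv_pCons power2_eq_square power3_eq_cube algebra_simps)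
  show "(1 - x\<^sup>2) * poly (pderiv (pderiv zonal_poly)) x - 2 * (real (nat \<bar>0\<bar>) + 1) * x * poly (pderiv zonal_poly) x
     + (eigval 3 - real (nat \<bar>0\<bar>) * (real (nat \<bar>0\<bar>) + 1)) * poly zonal_poly x = 0"
    unfolding p by (simp add: eigval_def power2_eq_square power3_eq_cube algebra_simps)
qed

lemma ebasis_3_0: "chart_eq (ebasis 3 0) ufield"
proof -
  have r: "poly (rodrigues 3 3) x = 120 * x ^ 3 - 72 * x" for x
    by (simp add: rodrigues_def numeral_3_eq_3 pderiv_pCons algebra_simps)
  have c: "sqrt (7 / (4 * pi)) / sqrt 12 = 2 / 3 * (sqrt (21 / pi) / 8)"
  proof -
    have "sqrt (7 / (4 * pi)) / sqrt 12 = sqrt (7 / (4 * pi) / 12)" by (simp only: real_sqrt_divide)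
    also have "7 / (4 * pi) / 12 = (21 / pi) / (12 * 12)" by simp
    also have "sqrt \<dots> = sqrt (21 / pi) / 12" by (simp only: real_sqrt_divide real_sqrt_abs2 abs_numeral)
    finally show ?thesis by simp
  qed
  have "chart_eq (\<lambda>p. Ysh 3 0 p / complex_of_real (sqrt (real 3 * (real 3 + 1)))) (harm_fun 0 zonal_poly)"
    unfolding chart_eq_def
  proof
    fix p assume p: "p \<in> chart"
    \<comment> \<open>The base must be nonzero: \<open>powr\<close> with exponent 0 is 1 there, but
      0 at base 0.\<close>
    have s: "1 - (cos (fst p))\<^sup>2 \<noteq> 0" using sn_nonzero[OF p] by (simp add: cos_squared_eq)
    have a: "assoc_leg 3 0 (cos (fst p)) = (5 * cos (fst p) ^ 3 - 3 * cos (fst p)) / 2"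
      unfolding assoc_leg_def higher_deriv_base using s
      by (simp add: r numeral_3_eq_3[symmetric] fact_numeral field_simps)
    have N: "sqrt (fact (nat (int 3 - 0)) / fact (nat (int 3 + 0)) * (2 * real 3 + 1) / (4 * pi)) = sqrt (7 / (4 * pi))"
      by simp
    have "Ysh 3 0 p / complex_of_real (sqrt (real 3 * (real 3 + 1))) =
      of_real (sqrt (7 / (4 * pi)) / sqrt 12 * ((5 * cos (fst p) ^ 3 - 3 * cos (fst p)) / 2))"
      unfolding Ysh_def a N by simp
    also have "\<dots> = harm_fun 0 zonal_poly p"
      unfolding c by (simp add: harm_fun_def zonal_poly_def field_simps power3_eq_cube)
    finally show "Ysh 3 0 p / complex_of_real (sqrt (real 3 * (real 3 + 1))) = harm_fun 0 zonal_poly p" .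
  qed
  from sgrad_chart_cong[OF this] have "chart_eq (ebasis 3 0) (sgrad (harm_fun 0 zonal_poly))"
    by (simp add: ebasis_def)
  then show ?thesis using ufield_eq chart_eq_sym chart_eq_trans by blast
qed

lemma herm_ufield: "herm ufield ufield = 1"
proof -
  \<comment> \<open>The antiderivative of \<open>g\<close>, found by the substitution
    \<open>x = cos t\<close> in \<open>(5 x^2 - 1)^2 (1 - x^2)\<close>.\<close>
  define G :: "real \<Rightarrow> real" where "G t = 25 / 7 * cos t ^ 7 - 7 * cos t ^ 5 + 11 / 3 * cos t ^ 3 - cos t" for t
  define g :: "real \<Rightarrow> real" where "g t = (5 * (cos t)\<^sup>2 - 1)\<^sup>2 * (sin t)\<^sup>2 * sin t" for t
  let ?F = "\<lambda>p. zonal p * zonal p * (sn p * sn p) * sn p"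
  have F: "?F \<in> chart_alg" by (intro chart_alg_rules zonal_alg)
  have cnj: "cnj (zonal p) = zonal p" for p by (simp add: zonal_def zconst_def)
  have "herm ufield ufield = chart_int ?F"
    unfolding herm_def by (rule chart_lint_eq[OF F]) (simp add: ufield_def cnj power2_eq_square mult_ac)
  also have "\<dots> = integral {0..pi} (\<lambda>x. integral {0..2*pi} (\<lambda>y. ?F (x, y)))"
    unfolding chart_int_def using integral_prod_continuous[OF chart_alg_continuous_on[OF F]] by simp
  also have "(\<lambda>x. integral {0..2*pi} (\<lambda>y. ?F (x, y))) = (\<lambda>x. complex_of_real (2 * pi * (21 / (64 * pi)) * g x))"
  proof
    fix x
    have "?F (x, y) = complex_of_real (21 / (64 * pi) * g x)" for y
    proof -
      have "?F (x, y) = (zconst * zconst) * complex_of_real (g x)"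
        by (simp add: zonal_def g_def power2_eq_square)
      then show ?thesis by (simp add: zconst_sq)
    qed
    then show "integral {0..2*pi} (\<lambda>y. ?F (x, y)) = complex_of_real (2 * pi * (21 / (64 * pi)) * g x)"
      by (simp add: scaleR_conv_of_real)
  qed
  also have "integral {0..pi} \<dots> = complex_of_real (21 / 32 * (G pi - G 0))"
  proof (rule integral_unique)
    have "((\<lambda>t. 21 / 32 * g t) has_integral 21 / 32 * G pi - 21 / 32 * G 0) {0..pi}"
    proof (rule fundamental_theorem_of_calculus)
      fix t :: real
      have "(G has_real_derivative g t) (at t)"
      proof -
        have s: "(sin t)\<^sup>2 = 1 - (cos t)\<^sup>2" by (rule sin_squared_eq)
        show ?thesis
          unfolding G_def g_def s
          by (rule derivative_eq_intros refl)+ (simp add: power2_eq_square, algebra)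
      qed
      from DERIV_cmult[OF this, of "21 / 32"]
      show "((\<lambda>t. 21 / 32 * G t) has_vector_derivative 21 / 32 * g t) (at t within {0..pi})"
        unfolding has_real_derivative_iff_has_vector_derivative by (rule has_vector_derivative_at_within)
    qed simp
    from has_integral_linear[OF this bounded_linear_of_real[where 'a=complex]]
    show "((\<lambda>x. complex_of_real (2 * pi * (21 / (64 * pi)) * g x)) has_integral complex_of_real (21 / 32 * (G pi - G 0))) {0..pi}"
      by (simp add: o_def algebra_simps diff_divide_distrib)
  qed
  also have "G pi - G 0 = 32 / 21" by (simp add: G_def)
  finally show ?thesis by simp
qed

text \<open>\<open>ufield\<close> has norm 1 and is orthogonal to the other field because 12 differs
  from \<open>eigval l\<close>, also for \<open>m = 0\<close>. Numerator and denominator then share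
  the factor \<open>W\<close>, the squared norm of that field.\<close>

lemma sec_curv_ufield:
  assumes l: "l \<ge> 5" and m: "nat \<bar>m\<bar> \<le> l" and d: "d \<noteq> 0"
  shows "sec_curv ufield (sgrad (\<lambda>p. d * sph_harm m l p)) = of_real (curv_coeff (nat \<bar>m\<bar>) l)"
proof -
  let ?v = "sgrad (\<lambda>p. d * sph_harm m l p)"
  have mo: "mode m (\<lambda>p. d * sph_harm m l p) (\<lambda>p. of_real (- eigval l) * (d * sph_harm m l p))"
    using mode_cmult[OF mode_sph_harm, of m d l] by (simp add: mult.left_commute)
  have h: "herm (sgrad (\<lambda>p. d * g p)) ?v = of_real (eigval l) * (d * cnj d) * pairing m l g" if "sphere_fun g" for g
  proof -
    have "herm (sgrad (\<lambda>p. d * g p)) ?v = of_real (eigval l) * chart_int (\<lambda>p. sn p * (d * g p) * cnj (d * sph_harm m l p))"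
      by (rule herm_sgrad_eigen[OF mo]) (intro sphere_fun_mult sphere_fun_const that)
    also have "(\<lambda>p. sn p * (d * g p) * cnj (d * sph_harm m l p)) = (\<lambda>p. (d * cnj d) * (sn p * g p * cnj (sph_harm m l p)))"
      by (auto simp: mult_ac)
    finally show ?thesis by (simp only: chart_int_cmult pairing_def mult.assoc)
  qed
  have W: "of_real (eigval l) * (d * cnj d) * pairing m l (sph_harm m l) \<noteq> 0"
    using sph_harm_norm_pos[OF m] d eigval_nonzero[of l] l by (simp add: pairing_def)
  have "herm ufield ?v = herm (sgrad (harm_fun 0 zonal_poly)) ?v"
    by (rule herm_chart_cong[OF ufield_eq chart_eq_refl])
  also have "\<dots> = of_real (eigval l) * chart_int (\<lambda>p. sn p * harm_fun 0 zonal_poly p * cnj (d * sph_harm m l p))"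
    by (rule herm_sgrad_eigen[OF mo sphere_fun_harm_fun])
  also have "chart_int (\<lambda>p. sn p * harm_fun 0 zonal_poly p * cnj (d * sph_harm m l p)) = 0"
    using l by (intro eigen_orthogonal[OF mode_zonal_poly mo]) (auto dest: eigval_inj)
  finally have uv: "herm ufield ?v = 0" by simp
  have "herm (Rcurv ufield ?v ufield) ?v = herm (sgrad (\<lambda>p. d * curv_fun m l p)) ?v"
    by (rule herm_chart_cong[OF Rcurv_sph_harm[OF l] chart_eq_refl])
  also have "\<dots> = of_real (curv_coeff (nat \<bar>m\<bar>) l) * (of_real (eigval l) * (d * cnj d) * pairing m l (sph_harm m l))"
    unfolding h[OF sphere_fun_curv_fun] pairing_curv_fun[OF l] by (simp add: mult_ac)
  finally show ?thesis
    unfolding sec_curv_def herm_ufield uv h[OF sphere_fun_sph_harm] using W by simp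
qed

theorem theorem5:
  fixes m :: "nat \<Rightarrow> int" and q :: real
  assumes "\<forall>l\<ge>3. \<bar>m l\<bar> \<le> int l"
    and "(\<lambda>l. real_of_int (m l) / real l) \<longlonglongrightarrow> q"
  shows "(\<lambda>l. sec_curv (ebasis 3 0) (ebasis l (m l)))
           \<longlonglongrightarrow> complex_of_real (- 525 / (32 * pi) * q ^ 4 * (1 - q\<^sup>2))"
proof -
  \<comment> \<open>The coefficient depends on \<open>m\<close> through its absolute value, and the
    limit is even in \<open>q\<close>, so the ratio is replaced by its absolute value.\<close>
  have "(\<lambda>l. \<bar>real_of_int (m l) / real l\<bar>) \<longlonglongrightarrow> \<bar>q\<bar>"
    by (rule tendsto_rabs[OF assms(2)])
  then have "(\<lambda>l. real (nat \<bar>m l\<bar>) / real l) \<longlonglongrightarrow> \<bar>q\<bar>" by simp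
  from curv_coeff_limit[OF this]
  have "(\<lambda>l. curv_coeff (nat \<bar>m l\<bar>) l) \<longlonglongrightarrow> - 525 / (32 * pi) * q ^ 4 * (1 - q\<^sup>2)" by simp
  then have lim: "(\<lambda>l. complex_of_real (curv_coeff (nat \<bar>m l\<bar>) l)) \<longlonglongrightarrow> complex_of_real (- 525 / (32 * pi) * q ^ 4 * (1 - q\<^sup>2))"
    by (rule tendsto_of_real)
  have "complex_of_real (curv_coeff (nat \<bar>m l\<bar>) l) = sec_curv (ebasis 3 0) (ebasis l (m l))" if l: "l \<ge> 5" for l
  proof -
    have ml: "\<bar>m l\<bar> \<le> int l" using assms(1) l by simp
    obtain d where d: "d \<noteq> 0" "chart_eq (ebasis l (m l)) (sgrad (\<lambda>p. d * sph_harm (m l) l p))"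
      using ebasis_sph_harm[OF ml] l by auto
    have "sec_curv (ebasis 3 0) (ebasis l (m l)) = sec_curv ufield (sgrad (\<lambda>p. d * sph_harm (m l) l p))"
      by (rule sec_curv_chart_cong[OF ebasis_3_0 d(2)])
    also have "\<dots> = of_real (curv_coeff (nat \<bar>m l\<bar>) l)"
      using ml by (intro sec_curv_ufield l d) simp
    finally show ?thesis by simp
  qed
  then have "eventually (\<lambda>l. complex_of_real (curv_coeff (nat \<bar>m l\<bar>) l) = sec_curv (ebasis 3 0) (ebasis l (m l))) sequentially"
    by (auto intro: eventually_sequentiallyI[of 5])
  with lim show ?thesis by (rule Lim_transform_eventually)
qed

end
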